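(* Let $a=a_c=-\lambda'(1)$, $b\in\mathbb R$, and let $(j_n)_{n\in\mathbb N}$ be positive integers with $\lim_{n\to\infty}(\log n-aj_n)/(\log n)^{1/2}=b$. Then almost surely, as $n\to\infty$, $K_n^{(j_n)}=\Phi\big(-b(a/\lambda''(1))^{1/2}\big)\,n\,(1+o(1)).$
   Context: Standing setup. Let $(P_k)_{k\in\mathbb N}$ be nonnegative random variables with an arbitrary joint law such that $\sum_{k\ge1}P_k=1$ a.s. and $\mathbb E\,\#\{k:P_k>0\}>1$. Let $\mathbb V=\bigcup_{n\ge0}\mathbb N^n$ be the set of finite words (root $\varnothing$; $|u|$ is the length of $u$; $uk$ is the word $u$ followed by $k$), and let $((P_k(u))_{k\in\mathbb N})_{u\in\mathbb V}$ be independent copies of $(P_k)_{k\in\mathbb N}$. Set $P(\varnothing)=1$ and $P(uk)=P(u)P_k(u)$. For $|u|=j$ let $I_u=[\sum_{|v|=j,\,v\prec u}P(v),\ \sum_{|v|=j,\,v\preceq u}P(v))$, where $\prec$ is the lexicographic order on $\mathbb N^j$. Let $U_1,U_2,\dots$ be i.i.d. uniform on $[0,1]$, independent of the weights (ball $i$ falls into every box $u$ with $U_i\in I_u$). For $j,n,k\in\mathbb N$ let $K_n^{(j)}(k)=\#\{u:|u|=j,\ \#\{i\le n:U_i\in I_u\}\ge k\}$ (number of level-$j$ boxes containing at least $k$ of the first $n$ balls), and $K_n^{(j)}=K_n^{(j)}(1)$. Branching random walk: $V(u)=-\log P(u)$ ($V(u)=\infty$ if $P(u)=0$; sums over $|u|=j$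 ignore such $u$). Nonlattice assumption: for all $a>0$, $b\in\mathbb R$, $\mathbb P(V(u)\in a\mathbb Z+b\text{ for all }|u|=1)<1$. Let $\lambda(\theta)=\log\mathbb E\sum_{|u|=1}e^{-\theta V(u)}\in(-\infty,\infty]$ and $\underline\theta=\inf\{\theta:\lambda(\theta)<\infty\}$ (so $\lambda(1)=0$, $\underline\theta\le 1$, and $\lambda$ is strictly convex and decreasing on its domain). It is assumed that there exists $\theta^*$ with $\theta^*\lambda'(\theta^* )-\lambda(\theta^* )=0$ (then $\theta^*>1$). $\Phi$ denotes the standard normal distribution function. *)

theory Defs
  imports "HOL-Probability.Probability"
begin

text \<open>Conventions: children are indexed by nat starting at 0 (the paper uses 1,2,...;
this is a relabelling k \<mapsto> k-1 which preserves the order). Words are nat lists.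
W omega u k is the weight P_k(u); U omega i is the i-th ball (i = 0,1,... ;
the first n balls are i < n).\<close>

type_synonym weights = "nat list \<Rightarrow> nat \<Rightarrow> real"

definition Phi :: "real \<Rightarrow> real" where
  "Phi x = measure (density lborel std_normal_density) {..x}"

definition npos :: "(nat \<Rightarrow> real) \<Rightarrow> ennreal" where
  "npos p = (if finite {k. p k > 0} then of_nat (card {k. p k > 0}) else \<top>)"

text \<open>E sum_{|u|=1} e^{-theta V(u)} = E sum_{k, P_k>0} P_k^theta, as an extended value.\<close>
definition Lapl :: "(nat \<Rightarrow> real) measure \<Rightarrow> real \<Rightarrow> ennreal" where
  "Lapl Q \<theta> = (\<integral>\<^sup>+ p. (\<Sum>k. ennreal (if p k > 0 then p k powr \<theta> else 0)) \<partial>Q)"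

definition lam_dom :: "(nat \<Rightarrow> real) measure \<Rightarrow> real set" where
  "lam_dom Q = {\<theta>. Lapl Q \<theta> < \<top>}"

text \<open>lambda(theta) = log E sum ...  (meaningful on lam_dom Q).\<close>
definition lam :: "(nat \<Rightarrow> real) measure \<Rightarrow> real \<Rightarrow> real" where
  "lam Q \<theta> = ln (enn2real (Lapl Q \<theta>))"

definition Pw :: "weights \<Rightarrow> nat list \<Rightarrow> real" where
  "Pw w u = (\<Prod>i<length u. w (take i u) (u ! i))"

definition lexlt :: "nat list \<Rightarrow> nat list \<Rightarrow> bool" where
  "lexlt v u \<longleftrightarrow> (v, u) \<in> lexord less_than"

definition Ileft :: "weights \<Rightarrow> nat list \<Rightarrow> real" where
  "Ileft w u = (\<Sum>\<^sub>\<infinity> v \<in> {v. length v = length u \<and> lexlt v u}. Pw w v)"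

definition Iright :: "weights \<Rightarrow> nat list \<Rightarrow> real" where
  "Iright w u = (\<Sum>\<^sub>\<infinity> v \<in> {v. length v = length u \<and> (lexlt v u \<or> v = u)}. Pw w v)"

definition Ibox :: "weights \<Rightarrow> nat list \<Rightarrow> real set" where
  "Ibox w u = {Ileft w u ..< Iright w u}"

definition Kcount :: "weights \<Rightarrow> (nat \<Rightarrow> real) \<Rightarrow> nat \<Rightarrow> nat \<Rightarrow> nat \<Rightarrow> nat" where
  "Kcount w U j n k = card {u. length u = j \<and> card {i. i < n \<and> U i \<in> Ibox w u} \<ge> k}"

abbreviation K :: "weights \<Rightarrow> (nat \<Rightarrow> real) \<Rightarrow> nat \<Rightarrow> nat \<Rightarrow> nat" where
  "K w U j n \<equiv> Kcount w U j n 1"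

end

theory Submission
  imports Defs "HOL-Real_Asymp.Real_Asymp"
begin

text \<open>
  The box of level \<open>j\<close> that contains a fixed ball has size \<open>exp (- S\<^sub>j)\<close>, where \<open>S\<close> is a random walk
  whose step law is \<open>E \<Sum>\<^sub>k P\<^sub>k \<delta>(- log P\<^sub>k)\<close>, with mean \<open>a\<close> and variance \<open>s2\<close>; the
  two moments are read off the right derivatives of \<open>\<lambda>\<close> at \<open>1\<close>. Boxes larger than \<open>C / n\<close> are too few to matter,
  and boxes smaller than \<open>c / n\<close> hardly ever receive two balls, so \<open>K / n\<close> is close to the total
  size of the boxes of size below \<open>1 / n\<close>. For a typical tree this total follows the central
  limit theorem of \<open>S\<close>: the subtrees rooted at level \<open>g\<close> are independent and the expected sum of squared
  box sizes decays like \<open>\<rho>\<^sup>g\<close> with \<open>\<rho> < 1\<close>, so freezing the first \<open>g\<close> levels with \<open>g\<close> close to \<open>j powr (1/8)\<close> leaves summable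
  fluctuations, while these levels do not affect the normal limit. Given the tree, the variance of
  \<open>K\<close> is at most \<open>n\<close>, because occupancies of distinct boxes are negatively correlated.
\<close>

section \<open>Integrals and independence\<close>

lemma borel_measurable_nn_integral_countable [measurable (raw)]:
  assumes "\<And>i. i \<in> I \<Longrightarrow> f i \<in> borel_measurable M" "countable I"
  shows "(\<lambda>x. \<integral>\<^sup>+i. f i x \<partial>count_space I) \<in> borel_measurable M"
proof -
  interpret sigma_finite_measure "count_space I"
    by (rule sigma_finite_measure_count_space_countable) fact
  have "case_prod (\<lambda>x i. f i x) \<in> borel_measurable (M \<Otimes>\<^sub>M count_space I)"
    unfolding split_beta
    by (rule measurable_compose_countable'[where g=snd and I=I]) (use assms in auto)
  then show ?thesis by (rule borel_measurable_nn_integral)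
qed

lemma nn_integral_count_space_mult:
  assumes "countable I" and [measurable]: "\<And>v. v \<in> I \<Longrightarrow> c v \<in> borel_measurable M" "\<And>v. v \<in> I \<Longrightarrow> d v \<in> borel_measurable M"
  shows "(\<integral>\<^sup>+x. (\<integral>\<^sup>+v. c v x \<partial>count_space I) * (\<integral>\<^sup>+v. d v x \<partial>count_space I) \<partial>M) =
    (\<integral>\<^sup>+v. \<integral>\<^sup>+v'. \<integral>\<^sup>+x. c v x * d v' x \<partial>M \<partial>count_space I \<partial>count_space I)"
proof -
  have "(\<integral>\<^sup>+x. (\<integral>\<^sup>+v. c v x \<partial>count_space I) * (\<integral>\<^sup>+v. d v x \<partial>count_space I) \<partial>M) =
    (\<integral>\<^sup>+x. \<integral>\<^sup>+v. \<integral>\<^sup>+v'. c v x * d v' x \<partial>count_space I \<partial>count_space I \<partial>M)"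
    by (simp add: nn_integral_cmult nn_integral_multc)
  also have "\<dots> = (\<integral>\<^sup>+v. \<integral>\<^sup>+x. \<integral>\<^sup>+v'. c v x * d v' x \<partial>count_space I \<partial>M \<partial>count_space I)"
    using assms(1) by (intro nn_integral_count_space_nn_integral borel_measurable_nn_integral_countable) auto
  also have "\<dots> = (\<integral>\<^sup>+v. \<integral>\<^sup>+v'. \<integral>\<^sup>+x. c v x * d v' x \<partial>M \<partial>count_space I \<partial>count_space I)"
    using assms(1) by (intro nn_integral_cong nn_integral_count_space_nn_integral) auto
  finally show ?thesis .
qed

lemma infsum_eq_nn_integral_count_space:
  fixes f :: "'i \<Rightarrow> real"
  assumes nonneg: "\<And>x. x \<in> A \<Longrightarrow> 0 \<le> f x"
    and fin: "(\<integral>\<^sup>+x. ennreal (f x) \<partial>count_space A) < \<infinity>"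
  shows "f summable_on A" "infsum f A = enn2real (\<integral>\<^sup>+x. ennreal (f x) \<partial>count_space A)"
proof -
  have int: "integrable (count_space A) f"
    using fin nonneg by (intro integrableI_nonneg) (auto simp: AE_count_space)
  then have "Infinite_Set_Sum.abs_summable_on f A"
    by (simp add: Infinite_Set_Sum.abs_summable_on_def)
  then have abs: "Infinite_Sum.abs_summable_on f A"
    by (rule abs_summable_equivalent[THEN iffD2])
  then show "f summable_on A"
    by (rule abs_summable_summable)
  have "infsum f A = infsetsum f A"
    using abs_summable_equivalent[THEN iffD1, OF abs] by (rule infsetsum_infsum[symmetric])
  also have "\<dots> = enn2real (\<integral>\<^sup>+x. ennreal (f x) \<partial>count_space A)"
    unfolding infsetsum_def using nonneg by (intro integral_eq_nn_integral) (auto simp: AE_count_space)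
  finally show "infsum f A = enn2real (\<integral>\<^sup>+x. ennreal (f x) \<partial>count_space A)" .
qed

lemma (in prob_space) AE_tendsto_0_if_nn_integral_summable:
  assumes [measurable]: "\<And>n. X n \<in> borel_measurable M"
    and sum: "(\<Sum>n. \<integral>\<^sup>+x. ennreal (X n x) \<partial>M) < \<infinity>"
    and nonneg: "\<And>n x. 0 \<le> X n x"
  shows "AE x in M. (\<lambda>n. X n x) \<longlonglongrightarrow> (0::real)"
proof -
  have "(\<integral>\<^sup>+x. (\<Sum>n. ennreal (X n x)) \<partial>M) < \<infinity>"
    using sum by (subst nn_integral_suminf) auto
  then have "AE x in M. (\<Sum>n. ennreal (X n x)) \<noteq> \<infinity>"
    by (intro nn_integral_PInf_AE) auto
  then show ?thesis
  proof eventually_elim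
    case (elim x)
    then have "summable (\<lambda>n. X n x)"
      using nonneg by (intro summable_suminf_not_top) (auto simp: top_unique)
    then show ?case by (rule summable_LIMSEQ_zero)
  qed
qed

lemma (in prob_space) AE_tendsto_0_if_summable_bound:
  assumes [measurable]: "\<And>n. X n \<in> borel_measurable M"
    and nonneg: "\<And>n x. 0 \<le> X n x"
    and le: "\<And>n. (\<integral>\<^sup>+x. ennreal (X n x) \<partial>M) \<le> ennreal (b n)" and b: "summable b" "\<And>n. 0 \<le> b n"
  shows "AE x in M. (\<lambda>n. X n x) \<longlonglongrightarrow> (0::real)"
proof (rule AE_tendsto_0_if_nn_integral_summable)
  have "(\<Sum>n. \<integral>\<^sup>+x. ennreal (X n x) \<partial>M) \<le> (\<Sum>n. ennreal (b n))"
    by (intro suminf_le le) auto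
  also have "\<dots> = ennreal (\<Sum>n. b n)"
    by (rule suminf_ennreal2[OF b(2,1)])
  finally show "(\<Sum>n. \<integral>\<^sup>+x. ennreal (X n x) \<partial>M) < \<infinity>"
    by (rule le_less_trans) simp
qed (use nonneg in auto)

lemma (in prob_space) nn_integral_product_law:
  assumes X [measurable]: "random_variable S X" and Y [measurable]: "random_variable T Y"
    and eq: "distr M S X \<Otimes>\<^sub>M distr M T Y = distr M (S \<Otimes>\<^sub>M T) (\<lambda>x. (X x, Y x))"
    and G [measurable]: "case_prod G \<in> borel_measurable (S \<Otimes>\<^sub>M T)"
  shows "(\<integral>\<^sup>+\<omega>. G (X \<omega>) (Y \<omega>) \<partial>M) = (\<integral>\<^sup>+\<omega>. \<integral>\<^sup>+\<omega>'. G (X \<omega>) (Y \<omega>') \<partial>M \<partial>M)"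
proof -
  interpret Y: prob_space "distr M T Y" by (rule prob_space_distr) simp
  have "(\<integral>\<^sup>+\<omega>. G (X \<omega>) (Y \<omega>) \<partial>M) = (\<integral>\<^sup>+p. case_prod G p \<partial>distr M (S \<Otimes>\<^sub>M T) (\<lambda>x. (X x, Y x)))"
    by (subst nn_integral_distr) auto
  also have "\<dots> = (\<integral>\<^sup>+p. case_prod G p \<partial>(distr M S X \<Otimes>\<^sub>M distr M T Y))"
    by (simp add: eq)
  also have "\<dots> = (\<integral>\<^sup>+x. \<integral>\<^sup>+y. G x y \<partial>distr M T Y \<partial>distr M S X)"
    by (subst Y.nn_integral_fst[symmetric]) auto
  also have "\<dots> = (\<integral>\<^sup>+\<omega>. \<integral>\<^sup>+y. G (X \<omega>) y \<partial>distr M T Y \<partial>M)"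
    by (intro nn_integral_distr) auto
  also have "\<dots> = (\<integral>\<^sup>+\<omega>. \<integral>\<^sup>+\<omega>'. G (X \<omega>) (Y \<omega>') \<partial>M \<partial>M)"
  proof (intro nn_integral_cong nn_integral_distr)
    fix \<omega> assume "\<omega> \<in> space M"
    then have "X \<omega> \<in> space S" by (rule measurable_space[rotated]) simp
    then show "G (X \<omega>) \<in> borel_measurable (distr M T Y)"
      using measurable_Pair2[OF G] by simp
  qed simp
  finally show ?thesis .
qed

lemma (in prob_space) product_law_from_indep_set:
  assumes X [measurable]: "X \<in> measurable M S" and Y [measurable]: "Y \<in> measurable M T"
    and ind: "indep_set (sets (vimage_algebra (space M) X S)) (sets (vimage_algebra (space M) Y T))"
    and f [measurable]: "f \<in> measurable S S'"
  shows "distr M S' (\<lambda>x. f (X x)) \<Otimes>\<^sub>M distr M T Y = distr M (S' \<Otimes>\<^sub>M T) (\<lambda>x. (f (X x), Y x))"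
proof (rule pair_measure_eqI)
  interpret X: prob_space "distr M S' (\<lambda>x. f (X x))" by (rule prob_space_distr) simp
  interpret Y: prob_space "distr M T Y" by (rule prob_space_distr) simp
  show "sigma_finite_measure (distr M S' (\<lambda>x. f (X x)))" "sigma_finite_measure (distr M T Y)"
    by unfold_locales
  fix A B assume "A \<in> sets (distr M S' (\<lambda>x. f (X x)))" "B \<in> sets (distr M T Y)"
  then have AB [measurable]: "A \<in> sets S'" "B \<in> sets T" by auto
  let ?A = "(\<lambda>x. f (X x)) -` A \<inter> space M" and ?B = "Y -` B \<inter> space M"
  have "?A = X -` (f -` A \<inter> space S) \<inter> space M"
    using measurable_space[OF X] by auto
  moreover have "f -` A \<inter> space S \<in> sets S" by measurable
  ultimately have "?A \<in> sets (vimage_algebra (space M) X S)"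
    using in_vimage_algebra by metis
  moreover have "?B \<in> sets (vimage_algebra (space M) Y T)"
    using AB(2) by (rule in_vimage_algebra)
  ultimately have "prob (?A \<inter> ?B) = prob ?A * prob ?B"
    by (rule indep_setD[OF ind])
  moreover have "(\<lambda>x. (f (X x), Y x)) -` (A \<times> B) \<inter> space M = ?A \<inter> ?B" by auto
  ultimately show "emeasure (distr M S' (\<lambda>x. f (X x))) A * emeasure (distr M T Y) B =
      emeasure (distr M (S' \<Otimes>\<^sub>M T) (\<lambda>x. (f (X x), Y x))) (A \<times> B)"
    by (simp add: emeasure_distr emeasure_eq_measure ennreal_mult)
qed simp

section \<open>Weighted trees\<close>

definition level :: "nat \<Rightarrow> nat list set" where
  "level j = {u. length u = j}"

definition good :: "weights \<Rightarrow> bool" where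
  "good w \<longleftrightarrow> (\<forall>u. (\<forall>k. 0 \<le> w u k) \<and> w u sums 1)"

definition subtree :: "weights \<Rightarrow> nat list \<Rightarrow> weights" where
  "subtree w v = (\<lambda>u. w (v @ u))"

definition level_mean :: "nat \<Rightarrow> weights \<Rightarrow> (real \<Rightarrow> ennreal) \<Rightarrow> ennreal" where
  "level_mean j w f = (\<integral>\<^sup>+u. ennreal (Pw w u) * f (Pw w u) \<partial>count_space (level j))"

lemma level_0: "level 0 = {[]}"
  by (auto simp: level_def)

lemma Pw_Nil [simp]: "Pw w [] = 1"
  by (simp add: Pw_def)

lemma Pw_snoc: "Pw w (u @ [k]) = Pw w u * w u k"
  by (simp add: Pw_def nth_append)

lemma Pw_append: "Pw w (u @ v) = Pw w u * Pw (subtree w u) v"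
proof (induction v rule: rev_induct)
  case (snoc k v)
  have "Pw w (u @ v @ [k]) = Pw w (u @ v) * w (u @ v) k"
    using Pw_snoc[of w "u @ v"] by simp
  then show ?case by (simp add: snoc Pw_snoc subtree_def)
qed simp

lemma Pw_nonneg: "good w \<Longrightarrow> 0 \<le> Pw w u"
  by (auto simp: Pw_def good_def intro!: prod_nonneg)

lemma good_le_1: "good w \<Longrightarrow> w u k \<le> 1"
  using sum_le_suminf[of "w u" "{k}"] by (auto simp: good_def sums_iff)

lemma Pw_le_1: "good w \<Longrightarrow> Pw w u \<le> 1"
  by (auto simp: Pw_def good_le_1 good_def intro!: prod_le_1)

lemma good_subtree: "good w \<Longrightarrow> good (subtree w v)"
  by (simp add: good_def subtree_def)

lemma nn_integral_level_add:
  "(\<integral>\<^sup>+u. F u \<partial>count_space (level (i + j))) =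
   (\<integral>\<^sup>+u. \<integral>\<^sup>+v. F (u @ v) \<partial>count_space (level j) \<partial>count_space (level i))"
proof -
  interpret sigma_finite_measure "count_space (level j)"
    by (rule sigma_finite_measure_count_space_countable) simp
  have inj: "inj_on (\<lambda>(u, v). u @ v) (level i \<times> level j)"
    by (auto simp: inj_on_def level_def)
  have img: "(\<lambda>(u, v). u @ v) ` (level i \<times> level j) = level (i + j)"
  proof (intro equalityI subsetI)
    fix u assume "u \<in> level (i + j)"
    then have "u = (\<lambda>(u, v). u @ v) (take i u, drop i u)" "(take i u, drop i u) \<in> level i \<times> level j"
      by (auto simp: level_def)
    then show "u \<in> (\<lambda>(u, v). u @ v) ` (level i \<times> level j)" by blast
  qed (auto simp: level_def)
  have "(\<integral>\<^sup>+u. F u \<partial>count_space (level (i + j))) =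
      (\<integral>\<^sup>+p. F (case p of (u, v) \<Rightarrow> u @ v) \<partial>count_space (level i \<times> level j))"
    using inj img by (intro nn_integral_bij_count_space[symmetric]) (auto simp: bij_betw_def)
  also have "\<dots> = (\<integral>\<^sup>+p. F (case p of (u, v) \<Rightarrow> u @ v) \<partial>(count_space (level i) \<Otimes>\<^sub>M count_space (level j)))"
    by (simp add: pair_measure_countable)
  also have "\<dots> = (\<integral>\<^sup>+u. \<integral>\<^sup>+v. F (u @ v) \<partial>count_space (level j) \<partial>count_space (level i))"
    by (subst nn_integral_fst[symmetric]) (auto simp: pair_measure_countable)
  finally show ?thesis .
qed

lemma nn_integral_level_1: "(\<integral>\<^sup>+u. F u \<partial>count_space (level 1)) = (\<integral>\<^sup>+k. F [k] \<partial>count_space UNIV)"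
proof -
  have "bij_betw (\<lambda>k. [k]) UNIV (level 1)"
    by (auto simp: bij_betw_def inj_on_def level_def length_Suc_conv)
  then show ?thesis by (rule nn_integral_bij_count_space[symmetric])
qed

lemma level_mean_0 [simp]: "level_mean 0 w f = f 1"
  by (simp add: level_mean_def level_0 nn_integral_count_space_finite)

lemma level_mean_add:
  assumes "good w"
  shows "level_mean (i + j) w f =
    (\<integral>\<^sup>+u. ennreal (Pw w u) * level_mean j (subtree w u) (\<lambda>y. f (Pw w u * y)) \<partial>count_space (level i))"
  unfolding level_mean_def nn_integral_level_add
  using assms
  by (intro nn_integral_cong)
    (simp add: Pw_append ennreal_mult Pw_nonneg good_subtree nn_integral_cmult[symmetric] mult.assoc)

lemma level_mean_1:
  assumes "good w"
  shows "level_mean j w (\<lambda>_. 1) = 1"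
  using assms
proof (induction j arbitrary: w)
  case (Suc j)
  have "level_mean (Suc j) w (\<lambda>_. 1) = (\<integral>\<^sup>+k. ennreal (w [] k) \<partial>count_space UNIV)"
    using level_mean_add[OF Suc.prems, of 1 j "\<lambda>_. 1"] Suc.IH[OF good_subtree[OF Suc.prems]]
      Pw_snoc[of w "[]"]
    by (subst (asm) nn_integral_level_1) simp
  also have "\<dots> = (\<Sum>k. ennreal (w [] k))"
    by (rule nn_integral_count_space_nat)
  also have "\<dots> = ennreal 1"
    using Suc.prems by (intro suminf_ennreal_eq) (auto simp: good_def)
  finally show ?case by simp
qed simp

lemma level_mean_mono: "(\<And>x. f x \<le> g x) \<Longrightarrow> level_mean j w f \<le> level_mean j w g"
  unfolding level_mean_def by (intro nn_integral_mono mult_left_mono) auto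

lemma level_mean_le_1: "good w \<Longrightarrow> (\<And>x. f x \<le> 1) \<Longrightarrow> level_mean j w f \<le> 1"
  using level_mean_mono[of f "\<lambda>_. 1" j w] by (simp add: level_mean_1)

lemma level_mean_plus:
  "level_mean j w (\<lambda>x. f x + g x) = level_mean j w f + level_mean j w g"
  unfolding level_mean_def by (subst nn_integral_add[symmetric]) (auto simp: distrib_left)

lemma nn_integral_Pw_level_le:
  assumes "good w" "A \<subseteq> level j"
  shows "(\<integral>\<^sup>+u. ennreal (Pw w u) \<partial>count_space A) \<le> 1"
proof -
  have "(\<integral>\<^sup>+u. ennreal (Pw w u) \<partial>count_space A) \<le> (\<integral>\<^sup>+u. ennreal (Pw w u) \<partial>count_space (level j))"
    using assms(2)
    by (subst (1 2) nn_integral_count_space_indicator)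
      (auto intro!: nn_integral_mono split: split_indicator)
  also have "\<dots> = 1"
    using level_mean_1[OF assms(1), of j] by (simp add: level_mean_def)
  finally show ?thesis .
qed

lemma
  assumes "good w" "A \<subseteq> level j"
  shows Pw_summable_on: "Pw w summable_on A"
    and infsum_Pw_eq: "infsum (Pw w) A = enn2real (\<integral>\<^sup>+u. ennreal (Pw w u) \<partial>count_space A)"
    and infsum_Pw_le_1: "infsum (Pw w) A \<le> 1"
    and infsum_Pw_nonneg: "0 \<le> infsum (Pw w) A"
proof -
  have *: "(\<integral>\<^sup>+u. ennreal (Pw w u) \<partial>count_space A) \<le> 1"
    using nn_integral_Pw_level_le[OF assms] .
  then have **: "(\<integral>\<^sup>+u. ennreal (Pw w u) \<partial>count_space A) < \<infinity>"
    by (rule le_less_trans) simp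
  show "Pw w summable_on A"
    and eq: "infsum (Pw w) A = enn2real (\<integral>\<^sup>+u. ennreal (Pw w u) \<partial>count_space A)"
    using infsum_eq_nn_integral_count_space[OF _ **] assms(1) by (auto simp: Pw_nonneg)
  show "infsum (Pw w) A \<le> 1" "0 \<le> infsum (Pw w) A"
    unfolding eq using * by (auto simp: enn2real_leI)
qed

lemma Iright_eq:
  assumes "good w"
  shows "Iright w u = Ileft w u + Pw w u"
proof -
  have "\<not> lexlt u u"
    by (simp add: lexlt_def lexord_irreflexive)
  moreover have "{v. length v = length u \<and> (lexlt v u \<or> v = u)} =
    insert u {v. length v = length u \<and> lexlt v u}" by auto
  ultimately show ?thesis
    using Pw_summable_on[OF assms, of "{v. length v = length u \<and> lexlt v u}" "length u"]
    unfolding Iright_def Ileft_def by (simp add: infsum_insert level_def subset_eq)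
qed

lemma Iright_le_Ileft:
  assumes "good w" "length v = length u" "lexlt v u"
  shows "Iright w v \<le> Ileft w u"
proof -
  have trans: "lexlt x u" if "lexlt x v" for x
    using that assms(3) unfolding lexlt_def by (rule lexord_trans) (auto simp: trans_def)
  show ?thesis
    unfolding Iright_def Ileft_def
    using Pw_summable_on[OF assms(1), of _ "length u"] assms trans
    by (intro infsum_mono2) (auto simp: level_def Pw_nonneg subset_eq)
qed

lemma lexlt_linear: "length v = length u \<Longrightarrow> u \<noteq> v \<Longrightarrow> lexlt u v \<or> lexlt v u"
  unfolding lexlt_def using lexord_linear[of less_than u v]
  by (simp add: nat_neq_iff) (metis linorder_neqE_nat)

lemma Ibox_disjoint:
  assumes "good w" "u \<in> level j" "v \<in> level j" "u \<noteq> v"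
  shows "Ibox w u \<inter> Ibox w v = {}"
  using lexlt_linear[of v u] assms Iright_le_Ileft[of w u v] Iright_le_Ileft[of w v u]
  by (auto simp: Ibox_def level_def)

lemma Ileft_nonneg: "good w \<Longrightarrow> 0 \<le> Ileft w u"
  unfolding Ileft_def by (rule infsum_Pw_nonneg[of _ _ "length u"]) (auto simp: level_def)

lemma Iright_le_1: "good w \<Longrightarrow> Iright w u \<le> 1"
  unfolding Iright_def by (rule infsum_Pw_le_1[of _ _ "length u"]) (auto simp: level_def)

section \<open>The spine walk\<close>

abbreviation sequence_borel :: "(nat \<Rightarrow> real) measure" where
  "sequence_borel \<equiv> Pi\<^sub>M UNIV (\<lambda>_. borel)"

abbreviation tree_space :: "weights measure" where
  "tree_space \<equiv> Pi\<^sub>M UNIV (\<lambda>_. sequence_borel)"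

lemma measurable_Pw:
  assumes "\<And>i. i < length u \<Longrightarrow> (\<lambda>x. h x (take i u)) \<in> measurable N sequence_borel"
  shows "(\<lambda>x. Pw (h x) u) \<in> borel_measurable N"
  unfolding Pw_def
  by (intro borel_measurable_prod measurable_compose[OF assms measurable_component_singleton]) auto

lemma measurable_level_mean:
  assumes h: "\<And>u. (\<lambda>x. h x u) \<in> measurable N sequence_borel"
    and [measurable]: "f \<in> borel_measurable borel" "g \<in> borel_measurable N"
  shows "(\<lambda>x. level_mean j (h x) (\<lambda>y. f (g x * y))) \<in> borel_measurable N"
proof -
  have [measurable]: "(\<lambda>x. Pw (h x) u) \<in> borel_measurable N" for u
    by (intro measurable_Pw h)
  show ?thesis
    unfolding level_mean_def by (intro borel_measurable_nn_integral_countable) auto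
qed

lemma measurable_tree_component: "(\<lambda>w. w u) \<in> measurable tree_space sequence_borel"
  by (rule measurable_component_singleton) simp

lemma Pw_cong: "(\<And>i. i < length u \<Longrightarrow> w (take i u) = w' (take i u)) \<Longrightarrow> Pw w u = Pw w' u"
  by (simp add: Pw_def)

text \<open>The walk is kept multiplicative: \<open>spine Q\<close> is the law of the weight of a size-biased child,
  so that the steps of the additive walk are \<open>- ln\<close> of its samples. Children of weight \<open>0\<close> carry no mass.\<close>

definition spine :: "(nat \<Rightarrow> real) measure \<Rightarrow> real measure" where
  "spine Q = distr (density (Q \<Otimes>\<^sub>M count_space UNIV) (\<lambda>(p, k). ennreal (p k))) borel (\<lambda>(p, k). p k)"

definition walk_mean :: "real measure \<Rightarrow> nat \<Rightarrow> (real \<Rightarrow> ennreal) \<Rightarrow> real \<Rightarrow> ennreal" where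
  "walk_mean \<kappa> m f x = (\<integral>\<^sup>+s. f (x * (\<Prod>i<m. s i)) \<partial>Pi\<^sub>M UNIV (\<lambda>_::nat. \<kappa>))"

lemma sets_spine [measurable_cong, simp]: "sets (spine Q) = sets borel"
  by (simp add: spine_def)

lemma space_spine [simp]: "space (spine Q) = UNIV"
  by (simp add: spine_def)

lemma measurable_eval_pair:
  assumes "sets Q = sets sequence_borel"
  shows "(\<lambda>(p, k). p k) \<in> borel_measurable (Q \<Otimes>\<^sub>M count_space (UNIV::nat set))"
proof -
  have "(\<lambda>p. p k) \<in> borel_measurable Q" for k :: nat
    by (subst measurable_cong_sets[OF assms refl]) (rule measurable_component_singleton, simp)
  then have "(\<lambda>x. fst x (snd x)) \<in> borel_measurable (Q \<Otimes>\<^sub>M count_space (UNIV::nat set))"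
    by (intro measurable_compose_countable'[where g=snd and I=UNIV and f="\<lambda>k x. fst x k"]
        measurable_compose[OF measurable_fst]) auto
  then show ?thesis by (simp add: split_beta')
qed

lemma nn_integral_spine:
  assumes Q: "sets Q = sets sequence_borel" and [measurable]: "f \<in> borel_measurable borel"
  shows "(\<integral>\<^sup>+y. f y \<partial>spine Q) = (\<integral>\<^sup>+p. \<integral>\<^sup>+k. ennreal (p k) * f (p k) \<partial>count_space UNIV \<partial>Q)"
proof -
  interpret sigma_finite_measure "count_space (UNIV::nat set)"
    by (rule sigma_finite_measure_count_space_countable) simp
  note [measurable] = measurable_eval_pair[OF Q]
  have *: "(\<lambda>x. ennreal (case x of (p, k) \<Rightarrow> p k) * f (case x of (p, k) \<Rightarrow> p k))
      \<in> borel_measurable (Q \<Otimes>\<^sub>M count_space (UNIV::nat set))" by measurable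
  have "(\<integral>\<^sup>+y. f y \<partial>spine Q) =
    (\<integral>\<^sup>+x. ennreal (case x of (p, k) \<Rightarrow> p k) * f (case x of (p, k) \<Rightarrow> p k) \<partial>(Q \<Otimes>\<^sub>M count_space UNIV))"
    unfolding spine_def
    by (subst nn_integral_distr) (auto simp: nn_integral_density split_beta')
  also have "\<dots> = (\<integral>\<^sup>+p. \<integral>\<^sup>+k. ennreal (p k) * f (p k) \<partial>count_space UNIV \<partial>Q)"
    by (subst nn_integral_fst[OF *, symmetric]) simp
  finally show ?thesis .
qed

locale probability_on_reals = kappa: prob_space \<kappa> for \<kappa> :: "real measure" +
  assumes sets_kappa [measurable_cong, simp]: "sets \<kappa> = sets borel"
begin

abbreviation walk_space :: "(nat \<Rightarrow> real) measure" where
  "walk_space \<equiv> Pi\<^sub>M UNIV (\<lambda>_. \<kappa>)"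

sublocale sequence_space \<kappa>
  by unfold_locales

lemma walk_mean_0 [simp]: "walk_mean \<kappa> 0 f x = f x"
  by (simp add: walk_mean_def P.emeasure_space_1)

lemma measurable_walk_mean [measurable]:
  assumes [measurable]: "f \<in> borel_measurable borel"
  shows "walk_mean \<kappa> m f \<in> borel_measurable borel"
  unfolding walk_mean_def by measurable

lemma walk_mean_Suc:
  assumes [measurable]: "f \<in> borel_measurable borel"
  shows "walk_mean \<kappa> (Suc m) f x = (\<integral>\<^sup>+y. walk_mean \<kappa> m f (x * y) \<partial>\<kappa>)"
proof -
  have [measurable]: "(\<lambda>p. case_nat (fst p) (snd p)) \<in> measurable (\<kappa> \<Otimes>\<^sub>M walk_space) walk_space"
    by measurable
  have "walk_mean \<kappa> (Suc m) f x =
      (\<integral>\<^sup>+s. f (x * (\<Prod>i<Suc m. s i)) \<partial>distr (\<kappa> \<Otimes>\<^sub>M walk_space) walk_space (\<lambda>(s, \<omega>). case_nat s \<omega>))"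
    unfolding walk_mean_def PiM_iter ..
  also have "\<dots> = (\<integral>\<^sup>+p. f (x * (fst p * (\<Prod>i<m. snd p i))) \<partial>(\<kappa> \<Otimes>\<^sub>M walk_space))"
    by (subst nn_integral_distr, measurable)
      (simp add: prod.lessThan_Suc_shift split_beta' del: prod.lessThan_Suc)
  also have "\<dots> = (\<integral>\<^sup>+y. \<integral>\<^sup>+s. f (x * (y * (\<Prod>i<m. s i))) \<partial>walk_space \<partial>\<kappa>)"
    by (subst P.nn_integral_fst[symmetric]) auto
  finally show ?thesis
    by (simp add: walk_mean_def mult.assoc)
qed

end

locale weight_tree = prob_space M for M :: "'a measure" +
  fixes Q :: "(nat \<Rightarrow> real) measure" and W :: "'a \<Rightarrow> weights"
  assumes W_indep: "indep_vars (\<lambda>_. sequence_borel) (\<lambda>u \<omega>. W \<omega> u) UNIV"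
    and W_law: "\<And>u. distr M sequence_borel (\<lambda>\<omega>. W \<omega> u) = Q"
    and W_good: "\<And>\<omega>. good (W \<omega>)"
begin

lemma measurable_W_component [measurable]: "(\<lambda>\<omega>. W \<omega> u) \<in> measurable M sequence_borel"
  using W_indep by (simp add: indep_vars_def)

lemma measurable_W [measurable]: "W \<in> measurable M tree_space"
proof -
  have "(\<lambda>\<omega>. \<lambda>u\<in>UNIV. W \<omega> u) \<in> measurable M tree_space"
    by (intro measurable_restrict) auto
  then show ?thesis by (simp add: restrict_UNIV)
qed

lemma measurable_Pw_W [measurable]: "(\<lambda>\<omega>. Pw (W \<omega>) u) \<in> borel_measurable M"
  by (rule measurable_Pw) simp

lemma measurable_level_mean_W [measurable]:
  assumes "f \<in> borel_measurable borel"
  shows "(\<lambda>\<omega>. level_mean j (W \<omega>) f) \<in> borel_measurable M"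
  using measurable_level_mean[of W M f "\<lambda>_. 1" j] assms by simp

lemma sets_Q [measurable_cong]: "sets Q = sets sequence_borel"
  by (subst W_law[of "[]", symmetric]) simp

lemma prob_space_Q: "prob_space Q"
  by (subst W_law[of "[]", symmetric]) (rule prob_space_distr, simp)

lemma nn_integral_Q:
  assumes "F \<in> borel_measurable sequence_borel"
  shows "(\<integral>\<^sup>+p. F p \<partial>Q) = (\<integral>\<^sup>+\<omega>. F (W \<omega> u) \<partial>M)"
  using assms by (subst W_law[of u, symmetric], subst nn_integral_distr) auto

lemma nn_integral_spine_W:
  assumes [measurable]: "f \<in> borel_measurable borel"
  shows "(\<integral>\<^sup>+y. f y \<partial>spine Q) = (\<integral>\<^sup>+\<omega>. \<integral>\<^sup>+k. ennreal (W \<omega> u k) * f (W \<omega> u k) \<partial>count_space UNIV \<partial>M)"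
  unfolding nn_integral_spine[OF sets_Q assms]
  by (rule nn_integral_Q) (intro borel_measurable_nn_integral_countable; measurable)

lemma prob_space_spine: "prob_space (spine Q)"
proof
  have "emeasure (spine Q) UNIV = (\<integral>\<^sup>+y. 1 \<partial>spine Q)" by simp
  also have "\<dots> = (\<integral>\<^sup>+\<omega>. level_mean 1 (W \<omega>) (\<lambda>_. 1) \<partial>M)"
    by (subst nn_integral_spine_W[of _ "[]"])
      (auto simp: level_mean_def nn_integral_level_1[unfolded One_nat_def] Pw_snoc[of _ "[]", simplified])
  also have "\<dots> = 1"
    by (simp add: level_mean_1 W_good emeasure_space_1 del: One_nat_def)
  finally show "emeasure (spine Q) (space (spine Q)) = 1" by simp
qed

sublocale spine: probability_on_reals "spine Q"
  by (intro probability_on_reals.intro prob_space_spine probability_on_reals_axioms.intro) simp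

lemma law_subtree: "distr M tree_space (\<lambda>\<omega>. subtree (W \<omega>) v) = distr M tree_space W"
proof -
  have W: "distr M tree_space W = Pi\<^sub>M UNIV (\<lambda>_. Q)"
    using indep_vars_iff_distr_eq_PiM[THEN iffD1, OF _ _ W_indep]
    by (simp add: restrict_UNIV W_law cong: distr_cong)
  have "distr M tree_space (\<lambda>\<omega>. subtree (W \<omega>) v) = distr (distr M tree_space W) tree_space (\<lambda>w. subtree w v)"
    unfolding subtree_def
    by (subst distr_distr)
      (auto simp: comp_def space_PiM intro!: measurable_PiM_single' measurable_tree_component)
  also have "\<dots> = distr (Pi\<^sub>M UNIV (\<lambda>_. Q)) (Pi\<^sub>M UNIV (\<lambda>_. Q)) (\<lambda>w. \<lambda>u\<in>UNIV. w (v @ u))"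
    unfolding W by (intro distr_cong sets_PiM_cong) (auto simp: subtree_def sets_Q)
  also have "\<dots> = Pi\<^sub>M UNIV (\<lambda>_. Q)"
    using distr_PiM_reindex[of UNIV "\<lambda>_. Q" "\<lambda>u. v @ u" UNIV] prob_space_Q by (simp add: inj_on_def)
  finally show ?thesis by (simp add: W)
qed

text \<open>The subtree at \<open>v\<close> may be resampled independently of whatever the other nodes determine.\<close>

lemma nn_integral_resample_subtree:
  fixes v :: "nat list"
  defines "B \<equiv> - range (\<lambda>u. v @ u)"
  assumes Y: "Y \<in> measurable (Pi\<^sub>M B (\<lambda>_. sequence_borel)) N"
    and X: "\<And>\<omega>. X \<omega> = Y (restrict (W \<omega>) B)"
    and G: "case_prod G \<in> borel_measurable (N \<Otimes>\<^sub>M tree_space)"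
  shows "(\<integral>\<^sup>+\<omega>. G (X \<omega>) (subtree (W \<omega>) v) \<partial>M) = (\<integral>\<^sup>+\<omega>. \<integral>\<^sup>+\<omega>'. G (X \<omega>) (W \<omega>') \<partial>M \<partial>M)"
proof -
  let ?A = "range (\<lambda>u. v @ u)"
  have ind: "indep_var (Pi\<^sub>M B (\<lambda>_. sequence_borel)) (\<lambda>\<omega>. restrict (\<lambda>u. W \<omega> u) B)
      (Pi\<^sub>M ?A (\<lambda>_. sequence_borel)) (\<lambda>\<omega>. restrict (\<lambda>u. W \<omega> u) ?A)"
    by (rule indep_var_restrict[OF W_indep]) (auto simp: B_def)
  have [measurable]: "(\<lambda>w u. w (v @ u)) \<in> measurable (Pi\<^sub>M ?A (\<lambda>_. sequence_borel)) tree_space"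
    by (rule measurable_PiM_single') (auto simp: space_PiM intro!: measurable_component_singleton)
  note [measurable] = Y G
  have meas: "random_variable (Pi\<^sub>M B (\<lambda>_. sequence_borel)) (\<lambda>\<omega>. restrict (\<lambda>u. W \<omega> u) B)"
    "random_variable (Pi\<^sub>M ?A (\<lambda>_. sequence_borel)) (\<lambda>\<omega>. restrict (\<lambda>u. W \<omega> u) ?A)"
    by (intro measurable_restrict; simp)+
  have [measurable]: "X \<in> measurable M N"
    unfolding X using meas(1) Y by (rule measurable_compose)
  have [measurable]: "(\<lambda>\<omega>. subtree (W \<omega>) v) \<in> measurable M tree_space"
    unfolding subtree_def by (rule measurable_PiM_single') (auto simp: space_PiM)
  have "(\<integral>\<^sup>+\<omega>. G (X \<omega>) (subtree (W \<omega>) v) \<partial>M) = (\<integral>\<^sup>+\<omega>. \<integral>\<^sup>+\<omega>'. G (X \<omega>) (subtree (W \<omega>') v) \<partial>M \<partial>M)"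
    using nn_integral_product_law[OF meas ind[unfolded indep_var_distribution_eq, THEN conjunct2, THEN conjunct2],
        of "\<lambda>s t. G (Y s) (\<lambda>u. t (v @ u))"]
    by (simp add: X subtree_def split_beta')
  also have "\<dots> = (\<integral>\<^sup>+\<omega>. \<integral>\<^sup>+\<omega>'. G (X \<omega>) (W \<omega>') \<partial>M \<partial>M)"
  proof (rule nn_integral_cong)
    fix \<omega> assume "\<omega> \<in> space M"
    then have "X \<omega> \<in> space N" by (rule measurable_space[rotated]) simp
    then have [measurable]: "G (X \<omega>) \<in> borel_measurable tree_space"
      using measurable_Pair2[OF G] by simp
    have "(\<integral>\<^sup>+\<omega>'. G (X \<omega>) (subtree (W \<omega>') v) \<partial>M) = (\<integral>\<^sup>+w. G (X \<omega>) w \<partial>distr M tree_space (\<lambda>\<omega>. subtree (W \<omega>) v))"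
      by (subst nn_integral_distr) auto
    also have "\<dots> = (\<integral>\<^sup>+\<omega>'. G (X \<omega>) (W \<omega>') \<partial>M)"
      unfolding law_subtree by (subst nn_integral_distr) auto
    finally show "(\<integral>\<^sup>+\<omega>'. G (X \<omega>) (subtree (W \<omega>') v) \<partial>M) = (\<integral>\<^sup>+\<omega>'. G (X \<omega>) (W \<omega>') \<partial>M)" .
  qed
  finally show ?thesis .
qed

lemma many_to_one:
  assumes [measurable]: "f \<in> borel_measurable borel"
  shows "(\<integral>\<^sup>+\<omega>. level_mean m (W \<omega>) (\<lambda>y. f (x * y)) \<partial>M) = walk_mean (spine Q) m f x"
proof (induction m arbitrary: x)
  case (Suc m)
  have m1: "case_prod (\<lambda>z w. ennreal z * level_mean m w (\<lambda>y. f (x * z * y)))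
      \<in> borel_measurable (borel \<Otimes>\<^sub>M tree_space)"
    unfolding split_beta
    by (intro borel_measurable_times_ennreal measurable_level_mean measurable_compose[OF measurable_snd]
        measurable_tree_component) measurable
  have m2 [measurable]: "(\<lambda>\<omega>. level_mean m (subtree (W \<omega>) [k]) (\<lambda>y. f (x * W \<omega> [] k * y))) \<in> borel_measurable M" for k
    by (intro measurable_level_mean) (auto simp: subtree_def)
  have "(\<integral>\<^sup>+\<omega>. level_mean (Suc m) (W \<omega>) (\<lambda>y. f (x * y)) \<partial>M) =
      (\<integral>\<^sup>+\<omega>. \<integral>\<^sup>+k. ennreal (W \<omega> [] k) * level_mean m (subtree (W \<omega>) [k]) (\<lambda>y. f (x * W \<omega> [] k * y))
        \<partial>count_space UNIV \<partial>M)"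
    using level_mean_add[OF W_good, of 1 m _ "\<lambda>y. f (x * y)"] Pw_snoc[of _ "[]"]
    by (simp add: nn_integral_level_1[unfolded One_nat_def] mult.assoc)
  also have "\<dots> = (\<integral>\<^sup>+k. \<integral>\<^sup>+\<omega>. ennreal (W \<omega> [] k) * level_mean m (subtree (W \<omega>) [k]) (\<lambda>y. f (x * W \<omega> [] k * y))
        \<partial>M \<partial>count_space UNIV)"
    by (rule nn_integral_count_space_nn_integral) auto
  also have "\<dots> = (\<integral>\<^sup>+k. \<integral>\<^sup>+\<omega>. \<integral>\<^sup>+\<omega>'. ennreal (W \<omega> [] k) * level_mean m (W \<omega>') (\<lambda>y. f (x * W \<omega> [] k * y))
        \<partial>M \<partial>M \<partial>count_space UNIV)"
  proof (rule nn_integral_cong)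
    fix k
    have "(\<lambda>s. s [] k) \<in> borel_measurable (Pi\<^sub>M (- range ((@) [k])) (\<lambda>_. sequence_borel))"
      by (rule measurable_compose[where f="\<lambda>s. s []" and N=sequence_borel])
        (auto intro!: measurable_component_singleton)
    moreover have "W \<omega> [] k = restrict (W \<omega>) (- range ((@) [k])) [] k" for \<omega>
      by auto
    ultimately
    show "(\<integral>\<^sup>+\<omega>. ennreal (W \<omega> [] k) * level_mean m (subtree (W \<omega>) [k]) (\<lambda>y. f (x * W \<omega> [] k * y)) \<partial>M) =
      (\<integral>\<^sup>+\<omega>. \<integral>\<^sup>+\<omega>'. ennreal (W \<omega> [] k) * level_mean m (W \<omega>') (\<lambda>y. f (x * W \<omega> [] k * y)) \<partial>M \<partial>M)"
      by (rule nn_integral_resample_subtree[where v="[k]" and N=borel and X="\<lambda>\<omega>. W \<omega> [] k"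
            and Y="\<lambda>s. s [] k" and G="\<lambda>z w. ennreal z * level_mean m w (\<lambda>y. f (x * z * y))", OF _ _ m1])
  qed
  also have "\<dots> = (\<integral>\<^sup>+k. \<integral>\<^sup>+\<omega>. ennreal (W \<omega> [] k) * walk_mean (spine Q) m f (x * W \<omega> [] k) \<partial>M \<partial>count_space UNIV)"
  proof (intro nn_integral_cong)
    fix k \<omega>
    have "(\<lambda>\<omega>'. level_mean m (W \<omega>') (\<lambda>y. f (x * W \<omega> [] k * y))) \<in> borel_measurable M"
      by (intro measurable_level_mean) auto
    then show "(\<integral>\<^sup>+\<omega>'. ennreal (W \<omega> [] k) * level_mean m (W \<omega>') (\<lambda>y. f (x * W \<omega> [] k * y)) \<partial>M) =
      ennreal (W \<omega> [] k) * walk_mean (spine Q) m f (x * W \<omega> [] k)"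
      by (simp add: nn_integral_cmult Suc.IH)
  qed
  also have "\<dots> = (\<integral>\<^sup>+y. walk_mean (spine Q) m f (x * y) \<partial>spine Q)"
    by (subst nn_integral_count_space_nn_integral[symmetric])
      (auto intro!: nn_integral_spine_W[symmetric] spine.measurable_walk_mean)
  also have "\<dots> = walk_mean (spine Q) (Suc m) f x"
    by (rule spine.walk_mean_Suc[symmetric]) simp
  finally show ?case .
qed (simp add: emeasure_space_1)

end

section \<open>Conditional variance\<close>

context weight_tree
begin

lemma AE_spineI:
  assumes [measurable]: "Measurable.pred borel R"
    and R: "\<And>\<omega> k. 0 < W \<omega> [] k \<Longrightarrow> W \<omega> [] k \<le> 1 \<Longrightarrow> R (W \<omega> [] k)"
  shows "AE y in spine Q. R y"
proof -
  have 0: "ennreal (W \<omega> [] k) * indicator {y. \<not> R y} (W \<omega> [] k) = 0" for \<omega> k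
  proof -
    have "0 \<le> W \<omega> [] k" using W_good[of \<omega>] by (simp add: good_def)
    then show ?thesis
      using R[of \<omega> k] good_le_1[OF W_good, of \<omega> "[]" k]
      by (cases "W \<omega> [] k = 0") (auto split: split_indicator)
  qed
  have "(\<integral>\<^sup>+y. indicator {y. \<not> R y} y \<partial>spine Q) = 0"
    by (subst nn_integral_spine_W[of _ "[]"]) (simp_all add: 0)
  then have "AE y in spine Q. indicator {y. \<not> R y} y = (0::ennreal)"
    by (subst (asm) nn_integral_0_iff_AE) auto
  then show ?thesis
    by eventually_elim (auto split: split_indicator_asm)
qed

lemma AE_spine_range: "AE y in spine Q. 0 < y \<and> y \<le> 1"
  by (rule AE_spineI) auto

definition rho :: ennreal where
  "rho = (\<integral>\<^sup>+y. ennreal y \<partial>spine Q)"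

lemma walk_mean_ennreal: "0 \<le> x \<Longrightarrow> walk_mean (spine Q) m ennreal x = ennreal x * rho ^ m"
proof (induction m arbitrary: x)
  case (Suc m)
  have "walk_mean (spine Q) (Suc m) ennreal x = (\<integral>\<^sup>+y. walk_mean (spine Q) m ennreal (x * y) \<partial>spine Q)"
    by (rule spine.walk_mean_Suc) simp
  also have "\<dots> = (\<integral>\<^sup>+y. ennreal x * rho ^ m * ennreal y \<partial>spine Q)"
    by (intro nn_integral_cong_AE, use AE_spine_range in eventually_elim)
      (use Suc in \<open>auto simp: ennreal_mult mult_ac\<close>)
  also have "\<dots> = ennreal x * rho ^ Suc m"
    by (subst nn_integral_cmult) (auto simp: rho_def mult_ac)
  finally show ?case .
qed simp

lemma walk_mean_le_1:
  assumes "\<And>x. f x \<le> 1"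
  shows "walk_mean (spine Q) m f x \<le> 1"
proof -
  have "walk_mean (spine Q) m f x \<le> (\<integral>\<^sup>+s. 1 \<partial>spine.walk_space)"
    unfolding walk_mean_def by (intro nn_integral_mono assms)
  then show ?thesis by (simp add: spine.P.emeasure_space_1)
qed

lemma nn_integral_resample_factor:
  fixes v :: "nat list" and m :: nat
  defines "B \<equiv> - range (\<lambda>u. v @ u)"
  assumes [measurable]: "f \<in> borel_measurable borel"
    and C [measurable]: "C \<in> borel_measurable (Pi\<^sub>M B (\<lambda>_. sequence_borel))"
    and c: "\<And>\<omega>. c \<omega> = C (restrict (W \<omega>) B)"
  shows "(\<integral>\<^sup>+\<omega>. ennreal (Pw (W \<omega>) v) * level_mean m (subtree (W \<omega>) v) (\<lambda>y. f (Pw (W \<omega>) v * y)) * c \<omega> \<partial>M) =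
    (\<integral>\<^sup>+\<omega>. ennreal (Pw (W \<omega>) v) * walk_mean (spine Q) m f (Pw (W \<omega>) v) * c \<omega> \<partial>M)"
proof -
  let ?N = "borel \<Otimes>\<^sub>M (borel :: ennreal measure)"
  have take_B: "take i v \<in> B" if "i < length v" for i
    using that by (auto simp: B_def dest!: arg_cong[where f=length])
  have [measurable]: "(\<lambda>s. Pw s v) \<in> borel_measurable (Pi\<^sub>M B (\<lambda>_. sequence_borel))"
    by (intro measurable_Pw measurable_component_singleton take_B)
  have "(\<integral>\<^sup>+\<omega>. ennreal (Pw (W \<omega>) v) * level_mean m (subtree (W \<omega>) v) (\<lambda>y. f (Pw (W \<omega>) v * y)) * c \<omega> \<partial>M)
    = (\<integral>\<^sup>+\<omega>. (\<lambda>x w. ennreal (fst x) * level_mean m w (\<lambda>y. f (fst x * y)) * snd x)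
          (Pw (W \<omega>) v, c \<omega>) (subtree (W \<omega>) v) \<partial>M)"
    by simp
  also have "\<dots> = (\<integral>\<^sup>+\<omega>. \<integral>\<^sup>+\<omega>'. (\<lambda>x w. ennreal (fst x) * level_mean m w (\<lambda>y. f (fst x * y)) * snd x)
          (Pw (W \<omega>) v, c \<omega>) (W \<omega>') \<partial>M \<partial>M)"
  proof (rule nn_integral_resample_subtree)
    show "(\<lambda>s. (Pw s v, C s)) \<in> measurable (Pi\<^sub>M (- range ((@) v)) (\<lambda>_. sequence_borel)) ?N"
      unfolding B_def[symmetric] by measurable
    show "(Pw (W \<omega>) v, c \<omega>) = (Pw (restrict (W \<omega>) (- range ((@) v))) v, C (restrict (W \<omega>) (- range ((@) v))))" for \<omega>
      unfolding B_def[symmetric] c using take_B by (auto intro!: Pw_cong)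
    show "(\<lambda>(x, w). ennreal (fst x) * level_mean m w (\<lambda>y. f (fst x * y)) * snd x)
        \<in> borel_measurable (?N \<Otimes>\<^sub>M tree_space)"
      unfolding split_beta
      by (intro borel_measurable_times_ennreal measurable_level_mean measurable_compose[OF measurable_snd]
        measurable_tree_component) measurable
  qed
  also have "\<dots> = (\<integral>\<^sup>+\<omega>. ennreal (Pw (W \<omega>) v) * walk_mean (spine Q) m f (Pw (W \<omega>) v) * c \<omega> \<partial>M)"
  proof (rule nn_integral_cong)
    fix \<omega>
    have "(\<lambda>\<omega>'. level_mean m (W \<omega>') (\<lambda>y. f (Pw (W \<omega>) v * y))) \<in> borel_measurable M"
      by (intro measurable_level_mean) auto
    then show "(\<integral>\<^sup>+\<omega>'. (\<lambda>x w. ennreal (fst x) * level_mean m w (\<lambda>y. f (fst x * y)) * snd x)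
          (Pw (W \<omega>) v, c \<omega>) (W \<omega>') \<partial>M) = ennreal (Pw (W \<omega>) v) * walk_mean (spine Q) m f (Pw (W \<omega>) v) * c \<omega>"
      by (simp add: nn_integral_cmult nn_integral_multc many_to_one)
  qed
  finally show ?thesis .
qed

text \<open>Subtrees at distinct nodes of level \<open>g\<close> are independent, so only the diagonal
  \<open>\<Sum> P(v)\<^sup>2\<close> contributes to the conditional variance given the first \<open>g\<close> levels.\<close>

lemma level_mean_conditional_variance:
  fixes g m :: nat
  assumes f [measurable]: "f \<in> borel_measurable borel" and f_le: "\<And>x. f x \<le> 1"
  defines "h \<equiv> walk_mean (spine Q) m f"
  shows "(\<integral>\<^sup>+\<omega>. ennreal ((enn2real (level_mean (g + m) (W \<omega>) f) - enn2real (level_mean g (W \<omega>) h))\<^sup>2) \<partial>M)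
    \<le> rho ^ g"
proof -
  define L where "L v \<omega> = level_mean m (subtree (W \<omega>) v) (\<lambda>y. f (Pw (W \<omega>) v * y))" for v \<omega>
  define c where "c v \<omega> = ennreal (Pw (W \<omega>) v) * L v \<omega>" for v \<omega>
  define d where "d v \<omega> = ennreal (Pw (W \<omega>) v) * h (Pw (W \<omega>) v)" for v \<omega>
  let ?CL = "count_space (level g)"
  have [measurable]: "h \<in> borel_measurable borel"
    unfolding h_def by measurable
  have [measurable]: "L v \<in> borel_measurable M" for v
    unfolding L_def by (intro measurable_level_mean) (auto simp: subtree_def)
  have [measurable]: "c v \<in> borel_measurable M" "d v \<in> borel_measurable M" for v
    unfolding c_def d_def by measurable
  have h_le: "h x \<le> 1" for x
    unfolding h_def by (rule walk_mean_le_1[OF f_le])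
  have L_le: "L v \<omega> \<le> 1" for v \<omega>
    unfolding L_def by (intro level_mean_le_1 good_subtree W_good f_le)
  have Zj: "level_mean (g + m) (W \<omega>) f = (\<integral>\<^sup>+v. c v \<omega> \<partial>?CL)" for \<omega>
    unfolding c_def L_def by (rule level_mean_add[OF W_good])
  have Zg: "level_mean g (W \<omega>) h = (\<integral>\<^sup>+v. d v \<omega> \<partial>?CL)" for \<omega>
    unfolding d_def level_mean_def ..
  have notin: "take i v' \<in> - range (\<lambda>u. v @ u)" if "length v = length v'" "i < length v'" for i v v'
    using that by (auto dest!: arg_cong[where f=length])
  have meas_Pw: "(\<lambda>s. Pw s v') \<in> borel_measurable (Pi\<^sub>M (- range (\<lambda>u. v @ u)) (\<lambda>_. sequence_borel))"
    if "length v = length v'" for v v'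
    using that by (intro measurable_Pw measurable_component_singleton notin)
  have restrict_Pw: "Pw (W \<omega>) v' = Pw (restrict (W \<omega>) (- range (\<lambda>u. v @ u))) v'"
    if "length v = length v'" for v v' \<omega>
    using notin[OF that] by (intro Pw_cong) auto
  have cd: "(\<integral>\<^sup>+\<omega>. c v \<omega> * d v' \<omega> \<partial>M) = (\<integral>\<^sup>+\<omega>. d v \<omega> * d v' \<omega> \<partial>M)"
    if "v \<in> level g" "v' \<in> level g" for v v'
  proof -
    have len: "length v = length v'" using that by (simp add: level_def)
    note [measurable] = meas_Pw[OF len]
    show ?thesis
      unfolding c_def L_def d_def[of v] h_def
      by (rule nn_integral_resample_factor[OF f, where C="\<lambda>s. ennreal (Pw s v') * h (Pw s v')"])
        (measurable, simp add: d_def restrict_Pw[OF len])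
  qed
  have cc: "(\<integral>\<^sup>+\<omega>. c v \<omega> * c v' \<omega> \<partial>M) = (\<integral>\<^sup>+\<omega>. d v \<omega> * d v' \<omega> \<partial>M)"
    if "v \<in> level g" "v' \<in> level g" "v \<noteq> v'" for v v'
  proof -
    have len: "length v = length v'" using that by (simp add: level_def)
    note [measurable] = meas_Pw[OF len]
    have mem: "v' @ u \<in> - range (\<lambda>u. v @ u)" for u
      using len \<open>v \<noteq> v'\<close> by auto
    have [measurable]: "(\<lambda>s. level_mean m (subtree s v') (\<lambda>y. f (Pw s v' * y)))
        \<in> borel_measurable (Pi\<^sub>M (- range (\<lambda>u. v @ u)) (\<lambda>_. sequence_borel))"
      unfolding subtree_def by (intro measurable_level_mean measurable_component_singleton mem) auto
    have sub: "subtree (W \<omega>) v' = subtree (restrict (W \<omega>) (- range (\<lambda>u. v @ u))) v'" for \<omega>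
      using mem by (auto simp: subtree_def fun_eq_iff)
    have "(\<integral>\<^sup>+\<omega>. c v \<omega> * c v' \<omega> \<partial>M) = (\<integral>\<^sup>+\<omega>. d v \<omega> * c v' \<omega> \<partial>M)"
      unfolding c_def[of v] L_def[of v] d_def h_def
      by (rule nn_integral_resample_factor[OF f,
            where C="\<lambda>s. ennreal (Pw s v') * level_mean m (subtree s v') (\<lambda>y. f (Pw s v' * y))"])
        (measurable, simp only: c_def L_def restrict_Pw[OF len] sub)
    also have "\<dots> = (\<integral>\<^sup>+\<omega>. d v \<omega> * d v' \<omega> \<partial>M)"
      using cd[OF that(2,1)] by (simp add: mult.commute)
    finally show ?thesis .
  qed
  have c_le: "c v \<omega> \<le> ennreal (Pw (W \<omega>) v)" for v \<omega>
    unfolding c_def using mult_left_mono[OF L_le] by auto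
  have cc_le: "(\<integral>\<^sup>+\<omega>. c v \<omega> * c v' \<omega> \<partial>M) \<le>
      (\<integral>\<^sup>+\<omega>. ennreal (Pw (W \<omega>) v) * ennreal (Pw (W \<omega>) v) \<partial>M) * indicator {v} v' + (\<integral>\<^sup>+\<omega>. d v \<omega> * d v' \<omega> \<partial>M)"
    if "v \<in> level g" "v' \<in> level g" for v v'
  proof (cases "v = v'")
    case True
    have "(\<integral>\<^sup>+\<omega>. c v \<omega> * c v \<omega> \<partial>M) \<le> (\<integral>\<^sup>+\<omega>. ennreal (Pw (W \<omega>) v) * ennreal (Pw (W \<omega>) v) \<partial>M)"
      by (intro nn_integral_mono mult_mono c_le) auto
    then show ?thesis using True by (auto intro: add_increasing2)
  qed (use cc that in auto)
  have rho: "(\<integral>\<^sup>+v. \<integral>\<^sup>+\<omega>. ennreal (Pw (W \<omega>) v) * ennreal (Pw (W \<omega>) v) \<partial>M \<partial>?CL) = rho ^ g"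
  proof -
    have "(\<integral>\<^sup>+v. \<integral>\<^sup>+\<omega>. ennreal (Pw (W \<omega>) v) * ennreal (Pw (W \<omega>) v) \<partial>M \<partial>?CL) =
        (\<integral>\<^sup>+\<omega>. level_mean g (W \<omega>) (\<lambda>y. ennreal (1 * y)) \<partial>M)"
      unfolding level_mean_def by (subst nn_integral_count_space_nn_integral[symmetric]) auto
    also have "\<dots> = rho ^ g"
      by (subst many_to_one) (auto simp: walk_mean_ennreal)
    finally show ?thesis .
  qed
  let ?J = "\<lambda>\<omega>. level_mean (g + m) (W \<omega>) f" and ?G = "\<lambda>\<omega>. level_mean g (W \<omega>) h"
  have JG: "(\<integral>\<^sup>+\<omega>. ?J \<omega> * ?G \<omega> \<partial>M) = (\<integral>\<^sup>+\<omega>. ?G \<omega> * ?G \<omega> \<partial>M)"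
    unfolding Zj Zg
    by (subst (1 2) nn_integral_count_space_mult, measurable)
      (rule nn_integral_cong, rule nn_integral_cong, simp add: cd)
  have "(\<integral>\<^sup>+\<omega>. ?J \<omega> * ?J \<omega> \<partial>M) \<le> (\<integral>\<^sup>+v. \<integral>\<^sup>+v'.
      ((\<integral>\<^sup>+\<omega>. ennreal (Pw (W \<omega>) v) * ennreal (Pw (W \<omega>) v) \<partial>M) * indicator {v} v' + (\<integral>\<^sup>+\<omega>. d v \<omega> * d v' \<omega> \<partial>M)) \<partial>?CL \<partial>?CL)"
    unfolding Zj by (subst nn_integral_count_space_mult) (auto intro!: nn_integral_mono cc_le)
  also have "\<dots> = (\<integral>\<^sup>+v. \<integral>\<^sup>+\<omega>. ennreal (Pw (W \<omega>) v) * ennreal (Pw (W \<omega>) v) \<partial>M \<partial>?CL) + (\<integral>\<^sup>+\<omega>. ?G \<omega> * ?G \<omega> \<partial>M)"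
    unfolding Zg
    by (subst nn_integral_count_space_mult)
      (auto simp: nn_integral_add nn_integral_cmult one_ennreal_def[symmetric] intro!: arg_cong2[where f="(+)"] nn_integral_cong)
  finally have JJ: "(\<integral>\<^sup>+\<omega>. ?J \<omega> * ?J \<omega> \<partial>M) \<le> rho ^ g + (\<integral>\<^sup>+\<omega>. ?G \<omega> * ?G \<omega> \<partial>M)"
    unfolding rho .
  have J_le: "?J \<omega> \<le> 1" and G_le: "?G \<omega> \<le> 1" for \<omega>
    by (intro level_mean_le_1 W_good f_le h_le)+
  have real: "ennreal ((enn2real (?J \<omega>) - enn2real (?G \<omega>))\<^sup>2) + (?J \<omega> * ?G \<omega> + ?J \<omega> * ?G \<omega>)
      = ?J \<omega> * ?J \<omega> + ?G \<omega> * ?G \<omega>" for \<omega>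
  proof -
    obtain x y where x: "?J \<omega> = ennreal x" "0 \<le> x" and y: "?G \<omega> = ennreal y" "0 \<le> y"
      using J_le[of \<omega>] G_le[of \<omega>] by (metis ennreal_cases ennreal_one_neq_top neq_top_trans)
    have "ennreal ((x - y)\<^sup>2) + (ennreal (x * y) + ennreal (x * y)) = ennreal ((x - y)\<^sup>2 + (x * y + x * y))"
      using x(2) y(2) by (simp only: ennreal_plus zero_le_power2 mult_nonneg_nonneg add_nonneg_nonneg)
    also have "\<dots> = ennreal (x * x + y * y)"
      by (simp add: power2_eq_square algebra_simps)
    also have "\<dots> = ennreal (x * x) + ennreal (y * y)"
      using x(2) y(2) by simp
    finally show ?thesis
      unfolding x(1) y(1) using x(2) y(2) by (simp add: ennreal_mult[symmetric])
  qed
  have "(\<integral>\<^sup>+\<omega>. ennreal ((enn2real (?J \<omega>) - enn2real (?G \<omega>))\<^sup>2) \<partial>M) + 2 * (\<integral>\<^sup>+\<omega>. ?G \<omega> * ?G \<omega> \<partial>M)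
    = (\<integral>\<^sup>+\<omega>. ennreal ((enn2real (?J \<omega>) - enn2real (?G \<omega>))\<^sup>2) \<partial>M) +
      ((\<integral>\<^sup>+\<omega>. ?J \<omega> * ?G \<omega> \<partial>M) + (\<integral>\<^sup>+\<omega>. ?J \<omega> * ?G \<omega> \<partial>M))"
    by (simp only: JG mult_2)
  also have "\<dots> = (\<integral>\<^sup>+\<omega>. ennreal ((enn2real (?J \<omega>) - enn2real (?G \<omega>))\<^sup>2) + (?J \<omega> * ?G \<omega> + ?J \<omega> * ?G \<omega>) \<partial>M)"
    by (simp add: nn_integral_add)
  also have "\<dots> = (\<integral>\<^sup>+\<omega>. ?J \<omega> * ?J \<omega> + ?G \<omega> * ?G \<omega> \<partial>M)"
    by (simp only: real)
  also have "\<dots> = (\<integral>\<^sup>+\<omega>. ?J \<omega> * ?J \<omega> \<partial>M) + (\<integral>\<^sup>+\<omega>. ?G \<omega> * ?G \<omega> \<partial>M)"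
    by (simp add: nn_integral_add)
  also have "\<dots> \<le> rho ^ g + 2 * (\<integral>\<^sup>+\<omega>. ?G \<omega> * ?G \<omega> \<partial>M)"
    using add_right_mono[OF JJ] by (simp add: mult_2 add.assoc)
  finally have *: "2 * (\<integral>\<^sup>+\<omega>. ?G \<omega> * ?G \<omega> \<partial>M) + (\<integral>\<^sup>+\<omega>. ennreal ((enn2real (?J \<omega>) - enn2real (?G \<omega>))\<^sup>2) \<partial>M)
    \<le> 2 * (\<integral>\<^sup>+\<omega>. ?G \<omega> * ?G \<omega> \<partial>M) + rho ^ g"
    by (simp add: add.commute)
  have "(\<integral>\<^sup>+\<omega>. ?G \<omega> * ?G \<omega> \<partial>M) \<le> (\<integral>\<^sup>+\<omega>. 1 \<partial>M)"
    using mult_mono[OF G_le G_le] by (intro nn_integral_mono) auto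
  then have "2 * (\<integral>\<^sup>+\<omega>. ?G \<omega> * ?G \<omega> \<partial>M) \<noteq> \<infinity>"
    by (auto simp: emeasure_space_1 ennreal_mult_eq_top_iff top_unique)
  with * show ?thesis
    by (simp add: ennreal_add_left_cancel_le)
qed

end

section \<open>Moments of the spine\<close>

lemma nn_integral_eq_LIMSEQ_dominated:
  fixes g :: "nat \<Rightarrow> 'a \<Rightarrow> ennreal"
  assumes [measurable]: "\<And>n. g n \<in> borel_measurable M" "f \<in> borel_measurable M"
    and le: "\<And>n. AE x in M. g n x \<le> f x"
    and lim: "AE x in M. (\<lambda>n. g n x) \<longlonglongrightarrow> f x"
    and int: "(\<lambda>n. \<integral>\<^sup>+x. g n x \<partial>M) \<longlonglongrightarrow> c"
  shows "(\<integral>\<^sup>+x. f x \<partial>M) = c"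
proof (rule antisym)
  have "(\<integral>\<^sup>+x. f x \<partial>M) = (\<integral>\<^sup>+x. liminf (\<lambda>n. g n x) \<partial>M)"
    by (intro nn_integral_cong_AE, use lim in eventually_elim) (simp add: lim_imp_Liminf)
  also have "\<dots> \<le> liminf (\<lambda>n. \<integral>\<^sup>+x. g n x \<partial>M)"
    by (rule nn_integral_liminf) measurable
  also have "\<dots> = c"
    using int by (intro lim_imp_Liminf) auto
  finally show "(\<integral>\<^sup>+x. f x \<partial>M) \<le> c" .
  show "c \<le> (\<integral>\<^sup>+x. f x \<partial>M)"
    using int by (rule LIMSEQ_le_const2) (auto intro!: nn_integral_mono_AE le)
qed

lemma LIMSEQ_difference_quotient_right:
  fixes f :: "real \<Rightarrow> real"
  assumes "(f has_real_derivative D) (at t within {t0..})" "t0 \<le> t"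
  shows "(\<lambda>n. (f t - f (t + 1 / real (Suc n))) / (1 / real (Suc n))) \<longlonglongrightarrow> - D"
proof -
  have "filterlim (\<lambda>n. t + 1 / real (Suc n)) (at t within {t0..}) sequentially"
    unfolding filterlim_at
  proof
    have "0 \<le> 1 / real (Suc n)" for n by simp
    then have "t0 \<le> t + 1 / real (Suc n)" for n
      using assms(2) by (rule add_increasing2)
    then show "\<forall>\<^sub>F n in sequentially. t + 1 / real (Suc n) \<in> {t0..} \<and> t + 1 / real (Suc n) \<noteq> t"
      by simp
    show "(\<lambda>n. t + 1 / real (Suc n)) \<longlonglongrightarrow> t"
      using tendsto_add[OF tendsto_const LIMSEQ_Suc[OF lim_1_over_n], of t] by simp
  qed
  from filterlim_compose[OF assms(1)[unfolded has_field_derivative_iff] this]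
  have "(\<lambda>n. (f (t + 1 / real (Suc n)) - f t) / (1 / real (Suc n))) \<longlonglongrightarrow> D" by simp
  from tendsto_minus[OF this] show ?thesis
    by (simp add: minus_mult_left del: of_nat_Suc)
qed

lemma LIMSEQ_one_minus_exp_quotient:
  fixes x :: real
  shows "(\<lambda>n. (1 - exp (- (1 / real (Suc n)) * x)) / (1 / real (Suc n))) \<longlonglongrightarrow> x"
proof -
  have "((\<lambda>h. exp (- h * x)) has_real_derivative - x) (at 0 within {0..})"
    by (auto intro!: derivative_eq_intros)
  from LIMSEQ_difference_quotient_right[OF this] show ?thesis by simp
qed

lemma one_minus_exp_quotient_le:
  fixes x h :: real
  assumes "0 < h"
  shows "(1 - exp (- h * x)) / h \<le> x"
  using exp_ge_add_one_self[of "- h * x"] assms by (simp add: field_simps)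

context probability_on_reals
begin

lemma nn_integral_moment_from_derivative:
  fixes F :: "real \<Rightarrow> real" and \<psi> :: "real \<Rightarrow> real"
  assumes range: "AE y in \<kappa>. 0 < y \<and> y \<le> 1"
    and [measurable]: "\<psi> \<in> borel_measurable borel" and \<psi>: "AE y in \<kappa>. 0 \<le> \<psi> y"
    and deriv: "(F has_real_derivative - D) (at t within {t0..})" "t0 \<le> t"
    and F: "\<forall>\<^sub>F n in sequentially. 0 \<le> F (t + 1 / real (Suc n)) \<and>
      (\<integral>\<^sup>+y. ennreal (\<psi> y * y powr (1 / real (Suc n))) \<partial>\<kappa>) = ennreal (F (t + 1 / real (Suc n)))"
    and F0: "0 \<le> F t" "(\<integral>\<^sup>+y. ennreal (\<psi> y) \<partial>\<kappa>) = ennreal (F t)"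
  shows "(\<integral>\<^sup>+y. ennreal (\<psi> y * - ln y) \<partial>\<kappa>) = ennreal D" "0 \<le> D"
proof -
  let ?h = "\<lambda>n. 1 / real (Suc n)"
  have le: "AE y in \<kappa>. ennreal (\<psi> y * y powr ?h n) \<le> ennreal (\<psi> y)" for n
    using range \<psi>
  proof eventually_elim
    case (elim y)
    then show ?case
      using powr_mono2[of "?h n" y 1] by (intro ennreal_leI mult_left_le) (auto simp del: of_nat_Suc)
  qed
  have "\<forall>\<^sub>F n in sequentially. 0 \<le> (F t - F (t + ?h n)) / ?h n"
    using F
  proof eventually_elim
    case (elim n)
    then have "ennreal (F (t + ?h n)) \<le> ennreal (F t)"
      using nn_integral_mono_AE[OF le[of n]] F0 by simp
    then show ?case using F0 by (simp add: ennreal_le_iff del: of_nat_Suc)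
  qed
  with LIMSEQ_difference_quotient_right[OF deriv] show "0 \<le> D"
    by (auto dest: tendsto_lowerbound)
  show "(\<integral>\<^sup>+y. ennreal (\<psi> y * - ln y) \<partial>\<kappa>) = ennreal D"
  proof (rule nn_integral_eq_LIMSEQ_dominated)
    let ?g = "\<lambda>n y. \<psi> y * ((1 - y powr ?h n) / ?h n)"
    show "(\<lambda>y. ennreal (?g n y)) \<in> borel_measurable \<kappa>" for n
      by measurable
    show "(\<lambda>y. ennreal (\<psi> y * - ln y)) \<in> borel_measurable \<kappa>"
      by measurable
    show "AE y in \<kappa>. ennreal (?g n y) \<le> ennreal (\<psi> y * - ln y)" for n
      using range \<psi>
    proof eventually_elim
      case (elim y)
      then show ?case
        using one_minus_exp_quotient_le[of "?h n" "- ln y"]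
        by (intro ennreal_leI mult_left_mono) (auto simp: powr_def)
    qed
    show "AE y in \<kappa>. (\<lambda>n. ennreal (?g n y)) \<longlonglongrightarrow> ennreal (\<psi> y * - ln y)"
      using range
    proof eventually_elim
      case (elim y)
      then show ?case
        using LIMSEQ_one_minus_exp_quotient[of "- ln y"]
        by (intro tendsto_ennrealI tendsto_mult tendsto_const) (auto simp: powr_def simp del: of_nat_Suc)
    qed
    have eq: "\<forall>\<^sub>F n in sequentially. (\<integral>\<^sup>+y. ennreal (?g n y) \<partial>\<kappa>) = ennreal ((F t - F (t + ?h n)) / ?h n)"
      using F
    proof eventually_elim
      case (elim n)
      have h: "0 < ?h n" by simp
      have "(\<integral>\<^sup>+y. ennreal (?g n y) \<partial>\<kappa>) = (\<integral>\<^sup>+y. ennreal (1 / ?h n) * (ennreal (\<psi> y) - ennreal (\<psi> y * y powr ?h n)) \<partial>\<kappa>)"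
      proof (intro nn_integral_cong_AE, use range \<psi> in eventually_elim)
        case (elim y)
        then have "?g n y = 1 / ?h n * (\<psi> y - \<psi> y * y powr ?h n)" "y powr ?h n \<le> 1"
          using powr_mono2[of "?h n" y 1] by (auto simp: field_simps simp del: of_nat_Suc)
        then show ?case
          using elim by (simp add: ennreal_mult[symmetric] ennreal_minus mult_left_le del: of_nat_Suc)
      qed
      also have "\<dots> = ennreal (1 / ?h n) * (ennreal (F t) - ennreal (F (t + ?h n)))"
      proof (subst nn_integral_cmult)
        show "ennreal (1 / ?h n) * (\<integral>\<^sup>+y. ennreal (\<psi> y) - ennreal (\<psi> y * y powr ?h n) \<partial>\<kappa>) =
          ennreal (1 / ?h n) * (ennreal (F t) - ennreal (F (t + ?h n)))"
          using elim F0 le[of n] by (subst nn_integral_diff) auto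
      qed measurable
      also have "\<dots> = ennreal ((F t - F (t + ?h n)) / ?h n)"
        using h elim by (simp add: ennreal_minus ennreal_mult'[symmetric] mult.commute del: of_nat_Suc)
      finally show ?case .
    qed
    have "(\<lambda>n. ennreal ((F t - F (t + ?h n)) / ?h n)) \<longlonglongrightarrow> ennreal D"
      using LIMSEQ_difference_quotient_right[OF deriv] by (intro tendsto_ennrealI) simp
    then show "(\<lambda>n. \<integral>\<^sup>+y. ennreal (?g n y) \<partial>\<kappa>) \<longlonglongrightarrow> ennreal D"
      by (rule Lim_transform_eventually) (use eq in eventually_elim, simp)
  qed
qed

lemma moments_from_log_Laplace:
  fixes l d :: "real \<Rightarrow> real"
  assumes range: "AE y in \<kappa>. 0 < y \<and> y \<le> 1"
    and l: "\<And>t. 0 \<le> t \<Longrightarrow> l t = ln (enn2real (\<integral>\<^sup>+y. ennreal (y powr t) \<partial>\<kappa>))"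
    and \<epsilon>: "0 < \<epsilon>"
    and d: "\<And>t. 0 \<le> t \<Longrightarrow> t \<le> \<epsilon> \<Longrightarrow> (l has_real_derivative d t) (at t within {0..})"
    and d0: "d 0 = - a" and s2: "(d has_real_derivative s2) (at 0 within {0..})"
  shows "integrable \<kappa> (\<lambda>y. - ln y)" "(\<integral>y. - ln y \<partial>\<kappa>) = a"
    "integrable \<kappa> (\<lambda>y. (- ln y)\<^sup>2)" "(\<integral>y. (- ln y)\<^sup>2 \<partial>\<kappa>) = a\<^sup>2 + s2"
proof -
  define \<phi> where "\<phi> t = enn2real (\<integral>\<^sup>+y. ennreal (y powr t) \<partial>\<kappa>)" for t
  have powr_le: "AE y in \<kappa>. y powr t \<le> 1" if "0 \<le> t" for t
    using range
  proof eventually_elim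
    case (elim y) then show ?case using powr_mono2[of t y 1] that by auto
  qed
  have powr_int_le: "(\<integral>\<^sup>+y. ennreal (y powr t) \<partial>\<kappa>) \<le> 1" if "0 \<le> t" for t
  proof -
    have "(\<integral>\<^sup>+y. ennreal (y powr t) \<partial>\<kappa>) \<le> (\<integral>\<^sup>+y. 1 \<partial>\<kappa>)"
      using powr_le[OF that] by (intro nn_integral_mono_AE) auto
    then show ?thesis by (simp add: kappa.emeasure_space_1)
  qed
  have \<phi>_eq: "(\<integral>\<^sup>+y. ennreal (y powr t) \<partial>\<kappa>) = ennreal (\<phi> t)" if "0 \<le> t" for t
    using powr_int_le[OF that] unfolding \<phi>_def
    by (intro ennreal_enn2real[symmetric]) (auto simp: top_unique less_top[symmetric])
  have \<phi>_pos: "0 < \<phi> t" if "0 \<le> t" for t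
  proof -
    have "(\<integral>\<^sup>+y. ennreal (y powr t) \<partial>\<kappa>) \<noteq> 0"
    proof
      assume "(\<integral>\<^sup>+y. ennreal (y powr t) \<partial>\<kappa>) = 0"
      then have "AE y in \<kappa>. ennreal (y powr t) = 0"
        by (subst (asm) nn_integral_0_iff_AE) auto
      with range have "AE y in \<kappa>. False"
        by eventually_elim auto
      then show False by simp
    qed
    then show ?thesis
      unfolding \<phi>_eq[OF that] by (simp add: ennreal_eq_0_iff not_le)
  qed
  have \<phi>_exp: "\<phi> t = exp (l t)" if "0 \<le> t" for t
    using \<phi>_pos[OF that] l[OF that] by (simp add: \<phi>_def)
  have \<phi>_0: "\<phi> 0 = 1"
  proof -
    have "(\<integral>\<^sup>+y. ennreal (y powr 0) \<partial>\<kappa>) = (\<integral>\<^sup>+y. 1 \<partial>\<kappa>)"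
      by (intro nn_integral_cong_AE, use range in eventually_elim) auto
    then show ?thesis by (simp add: \<phi>_def kappa.emeasure_space_1)
  qed
  have \<phi>_deriv: "(\<phi> has_real_derivative \<phi> t * d t) (at t within {0..})" if "0 \<le> t" "t \<le> \<epsilon>" for t
  proof -
    have "((\<lambda>t. exp (l t)) has_real_derivative \<phi> t * d t) (at t within {0..})"
      using d[OF that] \<phi>_exp[OF that(1)] by (auto intro!: derivative_eq_intros)
    then show ?thesis
      by (rule has_field_derivative_transform_within[of _ _ _ _ 1]) (use that \<phi>_exp in auto)
  qed
  have first: "(\<integral>\<^sup>+y. ennreal (y powr t * - ln y) \<partial>\<kappa>) = ennreal (- (\<phi> t * d t))"
    and first_nonneg: "0 \<le> - (\<phi> t * d t)" if t: "0 \<le> t" "t \<le> \<epsilon>" for t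
  proof -
    have 1: "(\<phi> has_real_derivative - (- (\<phi> t * d t))) (at t within {0..})"
      using \<phi>_deriv[OF t] by simp
    have 2: "\<forall>\<^sub>F n in sequentially. 0 \<le> \<phi> (t + 1 / real (Suc n)) \<and>
        (\<integral>\<^sup>+y. ennreal (y powr t * y powr (1 / real (Suc n))) \<partial>\<kappa>) = ennreal (\<phi> (t + 1 / real (Suc n)))"
      using t \<phi>_pos
      by (intro always_eventually allI) (auto simp: powr_add[symmetric] \<phi>_eq less_imp_le simp del: of_nat_Suc)
    note moment = nn_integral_moment_from_derivative[OF range _ _ 1 t(1) 2 less_imp_le[OF \<phi>_pos[OF t(1)]] \<phi>_eq[OF t(1)]]
    show "(\<integral>\<^sup>+y. ennreal (y powr t * - ln y) \<partial>\<kappa>) = ennreal (- (\<phi> t * d t))" "0 \<le> - (\<phi> t * d t)"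
      by (rule moment; simp)+
  qed
  have first_0: "(\<integral>\<^sup>+y. ennreal (- ln y) \<partial>\<kappa>) = ennreal a"
  proof -
    have "(\<integral>\<^sup>+y. ennreal (- ln y) \<partial>\<kappa>) = (\<integral>\<^sup>+y. ennreal (y powr 0 * - ln y) \<partial>\<kappa>)"
      by (intro nn_integral_cong_AE, use range in eventually_elim) auto
    then show ?thesis using first[of 0] \<epsilon> \<phi>_0 d0 by simp
  qed
  have nonneg: "AE y in \<kappa>. 0 \<le> - ln y"
    using range by eventually_elim (auto simp: ln_le_zero_iff)
  have 1: "((\<lambda>t. - (\<phi> t * d t)) has_real_derivative - (a\<^sup>2 + s2)) (at 0 within {0..})"
    using \<phi>_deriv[of 0] \<epsilon> s2 \<phi>_0 d0
    by (auto intro!: derivative_eq_intros simp: power2_eq_square)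
  have "\<forall>\<^sub>F n in sequentially. 1 / real (Suc n) < \<epsilon>"
    using order_tendstoD(2)[OF LIMSEQ_Suc[OF lim_1_over_n] \<epsilon>] by simp
  then have 2: "\<forall>\<^sub>F n in sequentially. 0 \<le> - (\<phi> (0 + 1 / real (Suc n)) * d (0 + 1 / real (Suc n))) \<and>
      (\<integral>\<^sup>+y. ennreal (- ln y * y powr (1 / real (Suc n))) \<partial>\<kappa>) =
        ennreal (- (\<phi> (0 + 1 / real (Suc n)) * d (0 + 1 / real (Suc n))))"
  proof eventually_elim
    case (elim n)
    then show ?case
      using first[of "1 / real (Suc n)"] first_nonneg[of "1 / real (Suc n)"]
      by (simp add: mult.commute del: of_nat_Suc)
  qed
  have a: "0 \<le> a" using first_nonneg[of 0] d0 \<phi>_0 \<epsilon> by simp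
  have second: "(\<integral>\<^sup>+y. ennreal (- ln y * - ln y) \<partial>\<kappa>) = ennreal (a\<^sup>2 + s2)" and nonneg2: "0 \<le> a\<^sup>2 + s2"
    by (rule nn_integral_moment_from_derivative[OF range _ _ 1 order_refl 2];
        use nonneg a first_0 \<phi>_0 d0 in simp)+
  have second': "(\<integral>\<^sup>+y. ennreal ((- ln y)\<^sup>2) \<partial>\<kappa>) = ennreal (a\<^sup>2 + s2)"
    using second by (simp add: power2_eq_square)
  show int1: "integrable \<kappa> (\<lambda>y. - ln y)"
    by (rule integrableI_nonneg) (use nonneg first_0 in auto)
  show "(\<integral>y. - ln y \<partial>\<kappa>) = a"
    using nonneg first_0 a by (subst integral_eq_nn_integral) auto
  show int2: "integrable \<kappa> (\<lambda>y. (- ln y)\<^sup>2)"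
    by (rule integrableI_nonneg) (use second' in auto)
  show "(\<integral>y. (- ln y)\<^sup>2 \<partial>\<kappa>) = a\<^sup>2 + s2"
    using second' nonneg2 by (subst integral_eq_nn_integral) auto
qed

end

section \<open>Central limit theorem for the walk and for the tree\<close>

lemma LIMSEQ_mono_moving_argument:
  fixes F :: "nat \<Rightarrow> real \<Rightarrow> real"
  assumes mono: "\<And>m. mono (F m)"
    and lim: "\<And>q. q \<in> \<rat> \<Longrightarrow> (\<lambda>m. F m q) \<longlonglongrightarrow> G q"
    and cont: "isCont G x"
    and m: "filterlim m at_top sequentially" and x: "X \<longlonglongrightarrow> x"
  shows "(\<lambda>n. F (m n) (X n)) \<longlonglongrightarrow> G x"
proof (rule LIMSEQ_I)
  fix e :: real assume e: "0 < e"
  from cont e obtain \<delta> where \<delta>: "0 < \<delta>" "\<And>z. \<bar>z - x\<bar> < \<delta> \<Longrightarrow> \<bar>G z - G x\<bar> < e / 2"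
    unfolding continuous_at_eps_delta dist_real_def by (metis half_gt_zero)
  obtain l where l: "l \<in> \<rat>" "x - \<delta> < l" "l < x"
    using Rats_dense_in_real[of "x - \<delta>" x] \<delta>(1) by auto
  obtain u where u: "u \<in> \<rat>" "x < u" "u < x + \<delta>"
    using Rats_dense_in_real[of x "x + \<delta>"] \<delta>(1) by auto
  have G: "\<bar>G l - G x\<bar> < e / 2" "\<bar>G u - G x\<bar> < e / 2"
    by (rule \<delta>(2), use l u in linarith)+
  have F: "\<forall>\<^sub>F n in sequentially. \<bar>F (m n) q - G q\<bar> < e / 2" if "q \<in> \<rat>" for q
    using tendstoD[OF filterlim_compose[OF lim[OF that] m], of "e / 2"] e by (simp add: dist_real_def)
  have X: "\<forall>\<^sub>F n in sequentially. l < X n" "\<forall>\<^sub>F n in sequentially. X n < u"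
    using order_tendstoD[OF x] l u by auto
  from F[OF l(1)] F[OF u(1)] X have "\<forall>\<^sub>F n in sequentially. norm (F (m n) (X n) - G x) < e"
  proof eventually_elim
    case (elim n)
    then have "F (m n) l \<le> F (m n) (X n)" "F (m n) (X n) \<le> F (m n) u"
      using monoD[OF mono] by auto
    with elim G show ?case unfolding real_norm_def by linarith
  qed
  then show "\<exists>N. \<forall>n\<ge>N. norm (F (m n) (X n) - G x) < e"
    by (simp add: eventually_sequentially)
qed

lemma Phi_eq_cdf: "Phi x = cdf std_normal_distribution x"
  by (simp add: Phi_def cdf_def)

lemma isCont_Phi: "isCont Phi x"
proof -
  interpret real_distribution std_normal_distribution
    by (rule real_dist_normal_dist)
  have "emeasure std_normal_distribution {x} = 0"
    by (subst emeasure_density) (auto intro!: nn_integral_0_iff_AE[THEN iffD2] AE_lborel_singleton[of x, THEN AE_mp])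
  then show ?thesis
    unfolding Phi_eq_cdf[abs_def] isCont_cdf by (simp add: measure_def)
qed

lemma Phi_minus: "Phi (- x) = 1 - Phi x"
proof -
  interpret real_distribution std_normal_distribution
    by (rule real_dist_normal_dist)
  have "emeasure std_normal_distribution {..- x} = emeasure std_normal_distribution {x..}"
  proof -
    have "emeasure std_normal_distribution {..- x} = (\<integral>\<^sup>+y. ennreal (std_normal_density y) * indicator {..- x} y \<partial>lborel)"
      by (rule emeasure_density) auto
    also have "\<dots> = (\<integral>\<^sup>+y. ennreal (std_normal_density (- y)) * indicator {..- x} (- y) \<partial>lborel)"
      by (subst lborel_distr_uminus[symmetric], subst nn_integral_distr) auto
    also have "\<dots> = (\<integral>\<^sup>+y. ennreal (std_normal_density y) * indicator {x..} y \<partial>lborel)"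
      by (intro nn_integral_cong) (auto simp: std_normal_density_def split: split_indicator)
    also have "\<dots> = emeasure std_normal_distribution {x..}"
      by (rule emeasure_density[symmetric]) auto
    finally show ?thesis .
  qed
  then have "Phi (- x) = measure std_normal_distribution {x..}"
    by (simp add: Phi_def measure_def)
  also have "\<dots> = measure std_normal_distribution {x} + measure std_normal_distribution {x<..}"
    by (subst finite_measure_Union[symmetric]) (auto intro!: arg_cong2[where f=measure])
  also have "measure std_normal_distribution {x} = 0"
    using isCont_Phi[of x] unfolding Phi_eq_cdf[abs_def] isCont_cdf .
  also have "measure std_normal_distribution {x<..} = 1 - Phi x"
    using prob_compl[of "{..x}"] by (simp add: Phi_def Compl_eq_Diff_UNIV[symmetric] space_eq_univ)
  finally show ?thesis by simp
qed

context probability_on_reals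
begin

definition walk_cdf :: "nat \<Rightarrow> real \<Rightarrow> real" where
  "walk_cdf m y = P.prob {s \<in> space walk_space. (\<Sum>i<m. - ln (s i)) \<le> y}"

lemma walk_cdf_mono: "y \<le> y' \<Longrightarrow> walk_cdf m y \<le> walk_cdf m y'"
  unfolding walk_cdf_def by (rule P.finite_measure_mono) auto

lemma walk_cdf_nonneg: "0 \<le> walk_cdf m y"
  by (simp add: walk_cdf_def)

lemma distr_coordinate: "distr walk_space \<kappa> (\<lambda>s. s i) = \<kappa>"
  by (rule distr_PiM_component) (auto intro: kappa.prob_space_axioms)

lemma AE_walk_coordinate:
  assumes "AE y in \<kappa>. R y"
  shows "AE s in walk_space. R (s i)"
proof -
  have "AE y in distr walk_space \<kappa> (\<lambda>s. s i). R y"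
    by (subst distr_coordinate) (rule assms)
  then show ?thesis by (rule AE_distrD[rotated]) simp
qed

lemma walk_mean_indicator:
  assumes range: "AE y in \<kappa>. 0 < y \<and> y \<le> 1" and x: "0 < x"
  shows "walk_mean \<kappa> m (indicator {exp (- y)..}) x = ennreal (walk_cdf m (y + ln x))"
proof -
  have pos: "AE s in walk_space. \<forall>i. 0 < s i"
    by (subst AE_all_countable) (auto intro: AE_walk_coordinate[OF range, THEN AE_mp])
  have "walk_mean \<kappa> m (indicator {exp (- y)..}) x =
      (\<integral>\<^sup>+s. indicator {s \<in> space walk_space. (\<Sum>i<m. - ln (s i)) \<le> y + ln x} s \<partial>walk_space)"
    unfolding walk_mean_def
  proof (intro nn_integral_cong_AE, use AE_space pos in eventually_elim)
    case (elim s)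
    then have pos: "0 < x * (\<Prod>i<m. s i)" using x by (auto intro!: mult_pos_pos prod_pos)
    have "ln (x * (\<Prod>i<m. s i)) = ln x + (\<Sum>i<m. ln (s i))"
      using elim x by (subst ln_mult_pos) (auto intro!: prod_pos simp: ln_prod less_imp_neq[symmetric])
    moreover have "exp (- y) \<le> x * (\<Prod>i<m. s i) \<longleftrightarrow> - y \<le> ln (x * (\<Prod>i<m. s i))"
      using pos by (subst ln_ge_iff) auto
    ultimately have "exp (- y) \<le> x * (\<Prod>i<m. s i) \<longleftrightarrow> (\<Sum>i<m. - ln (s i)) \<le> y + ln x"
      by (auto simp: sum_negf)
    then show ?case using elim by (auto split: split_indicator)
  qed
  also have "\<dots> = ennreal (walk_cdf m (y + ln x))"
    by (subst nn_integral_indicator) (auto simp: walk_cdf_def P.emeasure_eq_measure)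
  finally show ?thesis .
qed

lemma walk_mean_Markov:
  assumes range: "AE y in \<kappa>. 0 < y \<and> y \<le> 1"
    and int: "integrable \<kappa> (\<lambda>y. - ln y)" "(\<integral>y. - ln y \<partial>\<kappa>) = a" and c: "0 < c"
  shows "walk_mean \<kappa> m (indicator {..<exp (- c)}) 1 \<le> ennreal (real m * a / c)"
proof -
  have first: "(\<integral>\<^sup>+s. ennreal (- ln (s i)) \<partial>walk_space) = ennreal a" for i
  proof -
    have "(\<integral>\<^sup>+s. ennreal (- ln (s i)) \<partial>walk_space) = (\<integral>\<^sup>+y. ennreal (- ln y) \<partial>distr walk_space \<kappa> (\<lambda>s. s i))"
      by (subst nn_integral_distr) auto
    also have "\<dots> = ennreal a"
      unfolding distr_coordinate int(2)[symmetric]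
      by (rule nn_integral_eq_integral[OF int(1)])
        (use range in eventually_elim, auto simp: ln_le_zero_iff)
    finally show ?thesis .
  qed
  have a: "0 \<le> a"
    unfolding int(2)[symmetric] by (rule integral_nonneg_AE) (use range in eventually_elim, auto)
  have "AE s in walk_space. \<forall>i. 0 < s i \<and> s i \<le> 1"
    by (subst AE_all_countable) (intro allI AE_walk_coordinate[OF range])
  then have "walk_mean \<kappa> m (indicator {..<exp (- c)}) 1 \<le>
      (\<integral>\<^sup>+s. ennreal (1 / c) * (\<Sum>i<m. ennreal (- ln (s i))) \<partial>walk_space)"
    unfolding walk_mean_def
  proof (intro nn_integral_mono_AE, eventually_elim)
    case (elim s)
    then have nn: "0 \<le> - ln (s i)" for i by (simp add: ln_le_zero_iff)
    show ?case
    proof (cases "(\<Prod>i<m. s i) < exp (- c)")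
      case True
      have pos: "0 < (\<Prod>i<m. s i)" using elim by (intro prod_pos) auto
      have "c \<le> - ln (\<Prod>i<m. s i)"
        using True pos ln_less_cancel_iff[of "\<Prod>i<m. s i" "exp (- c)"] by simp
      also have "ln (\<Prod>i<m. s i) = (\<Sum>i<m. ln (s i))"
        using elim by (intro ln_prod) (auto simp: less_imp_neq[symmetric])
      finally have "1 \<le> 1 / c * (\<Sum>i<m. - ln (s i))"
        using c by (simp add: field_simps sum_negf)
      then have "ennreal 1 \<le> ennreal (1 / c * (\<Sum>i<m. - ln (s i)))"
        by (rule ennreal_leI)
      also have "\<dots> = ennreal (1 / c) * (\<Sum>i<m. ennreal (- ln (s i)))"
        using c nn by (subst ennreal_mult) (auto simp: sum_ennreal intro!: sum_nonneg)
      finally show ?thesis using True by simp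
    qed simp
  qed
  also have "\<dots> = ennreal (1 / c) * (\<Sum>i<m. ennreal a)"
    by (subst nn_integral_cmult) (auto simp: nn_integral_sum first)
  also have "\<dots> = ennreal (real m * a / c)"
    using a c by (simp add: ennreal_mult[symmetric] ennreal_of_nat_eq_real_of_nat)
  finally show ?thesis .
qed

lemma walk_cdf_CLT:
  assumes int: "integrable \<kappa> (\<lambda>y. - ln y)" "(\<integral>y. - ln y \<partial>\<kappa>) = a"
    and sq: "integrable \<kappa> (\<lambda>y. (- ln y)\<^sup>2)" "(\<integral>y. (- ln y)\<^sup>2 \<partial>\<kappa>) = a\<^sup>2 + s2" and s2: "0 < s2"
    and m: "filterlim m at_top sequentially"
    and y: "(\<lambda>n. (y n - a * real (m n)) / sqrt (s2 * real (m n))) \<longlonglongrightarrow> x"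
  shows "(\<lambda>n. walk_cdf (m n) (y n)) \<longlonglongrightarrow> Phi x"
proof -
  have coord_int: "(\<integral>s. f (s i) \<partial>walk_space) = (\<integral>y. f y \<partial>\<kappa>)"
    and coord_integrable: "integrable \<kappa> f \<Longrightarrow> integrable walk_space (\<lambda>s. f (s i))"
    if [measurable]: "f \<in> borel_measurable borel" for f :: "real \<Rightarrow> real" and i
    by (subst (2) distr_coordinate[of i, symmetric], subst integral_distr, auto)
      (subst (asm) distr_coordinate[of i, symmetric], subst (asm) integrable_distr_eq, auto)
  have "P.indep_vars (\<lambda>_. \<kappa>) (\<lambda>i s. s i) UNIV"
    by (subst P.indep_vars_iff_distr_eq_PiM)
      (auto simp: distr_coordinate restrict_UNIV)
  then have indep: "P.indep_vars (\<lambda>_. borel) (\<lambda>i s. - ln (s i)) UNIV"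
    by (rule P.indep_vars_compose2) measurable
  define S where "S k s = (\<Sum>i<k. - ln (s i) - a) / sqrt (real k * (sqrt s2)\<^sup>2)" for k and s :: "nat \<Rightarrow> real"
  have [measurable]: "S k \<in> borel_measurable walk_space" for k
    unfolding S_def by measurable
  have "weak_conv_m (\<lambda>k. distr walk_space borel (S k)) std_normal_distribution"
    unfolding S_def
  proof (rule P.central_limit_theorem[OF indep, where \<mu>="distr \<kappa> borel (\<lambda>y. - ln y)"])
    show "P.expectation (\<lambda>s. - ln (s i)) = a" for i
      using coord_int[of "\<lambda>y. - ln y" i] int by simp
    show "integrable walk_space (\<lambda>s. (- ln (s i))\<^sup>2)" for i
      using coord_integrable[of "\<lambda>y. (- ln y)\<^sup>2" i] sq by simp
    show "P.variance (\<lambda>s. - ln (s i)) = (sqrt s2)\<^sup>2" for i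
    proof -
      have ln_mean: "(\<integral>y. ln y \<partial>\<kappa>) = - a" using int by simp
      have "P.expectation (\<lambda>s. - ln (s i)) = a"
        using coord_int[of "\<lambda>y. - ln y" i] int by simp
      then have "P.variance (\<lambda>s. - ln (s i)) = (\<integral>y. (- ln y - a)\<^sup>2 \<partial>\<kappa>)"
        using coord_int[of "\<lambda>y. (- ln y - a)\<^sup>2" i] by simp
      also have "\<dots> = (\<integral>y. (- ln y)\<^sup>2 - 2 * a * (- ln y) + a\<^sup>2 \<partial>\<kappa>)"
        by (intro Bochner_Integration.integral_cong) (auto simp: power2_eq_square algebra_simps)
      also have "\<dots> = (a\<^sup>2 + s2) - 2 * a * a + a\<^sup>2"
        using int sq by (simp add: kappa.prob_space ln_mean)
      finally show ?thesis using s2 by (simp add: power2_eq_square)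
    qed
    show "distr walk_space borel (\<lambda>s. - ln (s i)) = distr \<kappa> borel (\<lambda>y. - ln y)" for i
      by (subst (2) distr_coordinate[of i, symmetric], subst distr_distr) (auto simp: comp_def)
  qed (use s2 in auto)
  then have cdf: "(\<lambda>k. cdf (distr walk_space borel (S k)) z) \<longlonglongrightarrow> Phi z" for z
    using isCont_Phi[of z] unfolding weak_conv_m_def weak_conv_def Phi_eq_cdf[abs_def] by simp
  have "(\<lambda>n. cdf (distr walk_space borel (S (m n))) ((y n - a * real (m n)) / sqrt (s2 * real (m n)))) \<longlonglongrightarrow> Phi x"
  proof (rule LIMSEQ_mono_moving_argument[OF _ cdf isCont_Phi m y])
    fix k
    interpret D: prob_space "distr walk_space borel (S k)"
      by (rule P.prob_space_distr) simp
    show "mono (cdf (distr walk_space borel (S k)))"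
      unfolding cdf_def by (intro monoI D.finite_measure_mono) auto
  qed
  moreover have "\<forall>\<^sub>F n in sequentially.
      cdf (distr walk_space borel (S (m n))) ((y n - a * real (m n)) / sqrt (s2 * real (m n))) = walk_cdf (m n) (y n)"
    using filterlim_at_top[THEN iffD1, OF m, rule_format, of 1]
  proof eventually_elim
    case (elim n)
    then have pos: "0 < sqrt (s2 * real (m n))" using s2 by simp
    have "S (m n) s = ((\<Sum>i<m n. - ln (s i)) - a * real (m n)) / sqrt (s2 * real (m n))" for s
      using s2 by (simp add: S_def sum_subtractf mult.commute)
    with pos have "S (m n) s \<le> (y n - a * real (m n)) / sqrt (s2 * real (m n)) \<longleftrightarrow> (\<Sum>i<m n. - ln (s i)) \<le> y n" for s
      by (simp add: divide_le_cancel not_less)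
    then show ?case
      unfolding cdf_def walk_cdf_def by (subst measure_distr) (auto intro!: arg_cong2[where f=measure])
  qed
  ultimately show ?thesis by (rule Lim_transform_eventually)
qed

end

lemma npos_eq_1:
  assumes "\<And>k. 0 \<le> p k" "p sums 1" "\<And>k. 0 < p k \<Longrightarrow> p k = 1"
  shows "npos p = 1"
proof -
  have "\<exists>k. 0 < p k"
  proof (rule ccontr)
    assume "\<nexists>k. 0 < p k"
    then have "p = (\<lambda>_. 0)" using assms(1) by (intro ext antisym) (auto simp: not_less)
    then show False using assms(2) sums_unique2[OF assms(2), of 0] by simp
  qed
  then obtain k where k: "0 < p k" by auto
  have "l = k" if "0 < p l" for l
  proof (rule ccontr)
    assume "l \<noteq> k"
    have "sum p {l, k} \<le> suminf p"
      by (rule sum_le_suminf) (use assms(1,2) in \<open>simp_all add: sums_iff\<close>)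
    then have "sum p {l, k} \<le> 1" using assms(2) by (simp add: sums_iff)
    then show False using assms(3)[OF k] assms(3)[OF that] \<open>l \<noteq> k\<close> by simp
  qed
  then have "{k. 0 < p k} = {k}" using k by blast
  then show ?thesis by (simp add: npos_def)
qed

context weight_tree
begin

lemma space_Q: "space Q = UNIV"
  using sets_eq_imp_space_eq[OF sets_Q] by (simp add: space_PiM)

lemma measurable_Q_component: "(\<lambda>p. p k) \<in> borel_measurable Q"
  by (subst measurable_cong_sets[OF sets_Q refl]) (rule measurable_component_singleton, simp)

lemma AE_spineD:
  assumes [measurable]: "Measurable.pred borel R" and R: "AE y in spine Q. R y"
  shows "AE p in Q. \<forall>k. 0 < p k \<longrightarrow> R (p k)"
proof -
  have [measurable]: "indicator {y. \<not> R y} \<in> borel_measurable (spine Q)" by measurable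
  have "(\<integral>\<^sup>+y. indicator {y. \<not> R y} y \<partial>spine Q) = 0"
    using R by (subst nn_integral_0_iff_AE) (auto elim!: eventually_mono)
  then have "(\<integral>\<^sup>+p. \<integral>\<^sup>+k. ennreal (p k) * indicator {y. \<not> R y} (p k) \<partial>count_space UNIV \<partial>Q) = 0"
    by (subst (asm) nn_integral_spine[OF sets_Q]) auto
  moreover have "(\<lambda>p. \<integral>\<^sup>+k. ennreal (p k) * indicator {y. \<not> R y} (p k) \<partial>count_space UNIV) \<in> borel_measurable Q"
    using measurable_Q_component by (intro borel_measurable_nn_integral_countable) measurable
  ultimately have "AE p in Q. (\<integral>\<^sup>+k. ennreal (p k) * indicator {y. \<not> R y} (p k) \<partial>count_space UNIV) = 0"
    by (subst (asm) nn_integral_0_iff_AE) auto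
  then show ?thesis
  proof eventually_elim
    case (elim p)
    then have "\<forall>k. ennreal (p k) * indicator {y. \<not> R y} (p k) = 0"
      by (subst (asm) nn_integral_0_iff_AE) (auto simp: AE_count_space)
    then show ?case by (auto split: split_indicator_asm simp: ennreal_eq_0_iff)
  qed
qed

lemma spine_not_AE_1:
  assumes Q_sum: "AE p in Q. (\<forall>k. 0 \<le> p k) \<and> p sums 1" and Q_npos: "1 < (\<integral>\<^sup>+p. npos p \<partial>Q)"
  shows "\<not> (AE y in spine Q. y = 1)"
proof
  interpret Q: prob_space Q by (rule prob_space_Q)
  assume "AE y in spine Q. y = 1"
  from AE_spineD[OF _ this] Q_sum have "AE p in Q. npos p = 1"
    by (auto intro!: npos_eq_1 elim!: eventually_elim2)
  then have "(\<integral>\<^sup>+p. npos p \<partial>Q) = (\<integral>\<^sup>+p. 1 \<partial>Q)"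
    by (rule nn_integral_cong_AE)
  then show False using Q_npos by (simp add: Q.emeasure_space_1)
qed

lemma rho_less_1:
  assumes "\<not> (AE y in spine Q. y = 1)"
  shows "rho < 1"
proof -
  have "(\<integral>\<^sup>+y. ennreal (1 - y) \<partial>spine Q) + rho = (\<integral>\<^sup>+y. ennreal (1 - y) + ennreal y \<partial>spine Q)"
    unfolding rho_def by (intro nn_integral_add[symmetric]) measurable
  also have "\<dots> = (\<integral>\<^sup>+y. 1 \<partial>spine Q)"
    by (intro nn_integral_cong_AE, use AE_spine_range in eventually_elim) (auto simp: ennreal_plus[symmetric] simp del: ennreal_plus)
  finally have sum: "(\<integral>\<^sup>+y. ennreal (1 - y) \<partial>spine Q) + rho = 1"
    using spine.kappa.emeasure_space_1 by simp
  have "rho \<noteq> 1"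
  proof
    assume "rho = 1"
    with sum have "1 + (\<integral>\<^sup>+y. ennreal (1 - y) \<partial>spine Q) = 1 + 0" by (simp add: add.commute)
    then have "(\<integral>\<^sup>+y. ennreal (1 - y) \<partial>spine Q) = 0"
      by (subst (asm) ennreal_add_left_cancel) simp
    then have "AE y in spine Q. ennreal (1 - y) = 0"
      by (subst (asm) nn_integral_0_iff_AE) auto
    with AE_spine_range have "AE y in spine Q. y = 1"
      by eventually_elim (auto simp: ennreal_eq_0_iff)
    with assms show False by simp
  qed
  moreover have "rho \<le> 1"
    by (subst sum[symmetric]) simp
  ultimately show ?thesis by simp
qed

lemma spine_mean_pos:
  assumes "integrable (spine Q) (\<lambda>y. - ln y)" "(\<integral>y. - ln y \<partial>spine Q) = a" "\<not> (AE y in spine Q. y = 1)"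
  shows "0 < a"
proof -
  have nn: "AE y in spine Q. 0 \<le> - ln y"
    using AE_spine_range by eventually_elim auto
  have "a \<noteq> 0"
  proof
    assume "a = 0"
    then have "AE y in spine Q. - ln y = 0"
      using assms(1,2) nn by (simp only: integral_nonneg_eq_0_iff_AE)
    with AE_spine_range have "AE y in spine Q. y = 1" by eventually_elim auto
    with assms(3) show False by simp
  qed
  moreover have "0 \<le> a"
    unfolding assms(2)[symmetric] by (rule integral_nonneg_AE[OF nn])
  ultimately show ?thesis by simp
qed

lemma spine_variance_pos:
  assumes int: "integrable (spine Q) (\<lambda>y. - ln y)" "(\<integral>y. - ln y \<partial>spine Q) = a"
    and sq: "integrable (spine Q) (\<lambda>y. (- ln y)\<^sup>2)" "(\<integral>y. (- ln y)\<^sup>2 \<partial>spine Q) = a\<^sup>2 + s2"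
    and nonlattice: "\<And>c d. 0 < c \<Longrightarrow> measure Q {p. \<forall>k. 0 < p k \<longrightarrow> (\<exists>z::int. - ln (p k) = c * of_int z + d)} < 1"
  shows "0 < s2"
proof -
  interpret Q: prob_space Q by (rule prob_space_Q)
  have eq: "(- ln y - a)\<^sup>2 = (- ln y)\<^sup>2 - 2 * a * (- ln y) + a\<^sup>2" for y
    by (simp add: power2_eq_square algebra_simps)
  have integrable: "integrable (spine Q) (\<lambda>y. (- ln y - a)\<^sup>2)"
    unfolding eq using int sq by auto
  have ln_mean: "(\<integral>y. ln y \<partial>spine Q) = - a" using int by simp
  have "(\<integral>y. (- ln y - a)\<^sup>2 \<partial>spine Q) = (a\<^sup>2 + s2) - 2 * a * a + a\<^sup>2"
    unfolding eq using int sq by (simp add: spine.kappa.prob_space[simplified] ln_mean)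
  then have var: "(\<integral>y. (- ln y - a)\<^sup>2 \<partial>spine Q) = s2" by (simp add: power2_eq_square)
  have "s2 \<noteq> 0"
  proof
    assume "s2 = 0"
    then have "AE y in spine Q. (- ln y - a)\<^sup>2 = 0"
      using var integrable by (subst integral_nonneg_eq_0_iff_AE[symmetric]) auto
    then have "AE y in spine Q. - ln y = a"
      by eventually_elim simp
    then have "AE p in Q. \<forall>k. 0 < p k \<longrightarrow> - ln (p k) = a"
      by (intro AE_spineD) auto
    then have "AE p in Q. \<forall>k. 0 < p k \<longrightarrow> (\<exists>z::int. - ln (p k) = 1 * of_int z + a)"
      by eventually_elim (metis add_0 mult_1 of_int_0)
    then have "measure Q {p \<in> space Q. \<forall>k. 0 < p k \<longrightarrow> (\<exists>z::int. - ln (p k) = 1 * of_int z + a)} = 1"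
      using measurable_Q_component by (subst Q.prob_Collect_eq_1) measurable
    then show False using nonlattice[of 1 a] by (simp add: space_Q)
  qed
  moreover have "0 \<le> s2"
    unfolding var[symmetric] by (rule integral_nonneg_AE) simp
  ultimately show ?thesis by simp
qed

end

locale finite_variance_tree = weight_tree M Q W for M :: "'a measure" and Q W +
  fixes a s2 :: real
  assumes ln_integrable: "integrable (spine Q) (\<lambda>y. - ln y)" and ln_mean: "(\<integral>y. - ln y \<partial>spine Q) = a"
    and ln_sq_integrable: "integrable (spine Q) (\<lambda>y. (- ln y)\<^sup>2)"
    and ln_sq_mean: "(\<integral>y. (- ln y)\<^sup>2 \<partial>spine Q) = a\<^sup>2 + s2"
    and a_pos: "0 < a" and s2_pos: "0 < s2" and rho_less: "rho < 1"
begin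

definition level_cdf :: "'a \<Rightarrow> nat \<Rightarrow> real \<Rightarrow> real" where
  "level_cdf \<omega> j y = enn2real (level_mean j (W \<omega>) (indicator {exp (- y)..}))"

definition cut :: "nat \<Rightarrow> nat" where
  "cut j = nat \<lfloor>real j powr (1/8)\<rfloor>"

lemma real_cut: "real (cut j) \<le> real j powr (1/8)" "real j powr (1/8) - 1 < real (cut j)"
  by (auto simp: cut_def)

lemma cut_le: "cut j \<le> j"
proof (cases "j = 0")
  case False
  then have "real j powr (1/8) \<le> real j powr 1" by (intro powr_mono) auto
  then have "real (cut j) \<le> real j" using real_cut(1)[of j] by simp
  then show ?thesis by simp
qed (simp add: cut_def)

lemma filterlim_cut: "filterlim cut at_top sequentially"
proof -
  have "filterlim (\<lambda>j. real (cut j)) at_top sequentially"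
    by (rule filterlim_at_top_mono[of "\<lambda>j. real j powr (1/8) - 1"])
      (real_asymp, use real_cut(2) in \<open>auto intro!: always_eventually less_imp_le\<close>)
  then show ?thesis by (simp add: filterlim_sequentially_iff_filterlim_real)
qed

lemma cut_power_div_sqrt: "k \<le> 3 \<Longrightarrow> (\<lambda>j. real (cut j) ^ k / sqrt (real j)) \<longlonglongrightarrow> 0 "
proof (rule tendsto_sandwich[OF _ _ tendsto_const])
  assume k: "k \<le> 3"
  show "\<forall>\<^sub>F j in sequentially. real (cut j) ^ k / sqrt (real j) \<le> (real j powr (1/8)) ^ 3 / sqrt (real j)"
    using eventually_ge_at_top[of 1]
  proof eventually_elim
    case (elim j)
    have "real (cut j) ^ k \<le> (real j powr (1/8)) ^ k"
      using real_cut(1) by (intro power_mono) auto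
    also have "\<dots> \<le> (real j powr (1/8)) ^ 3"
      using elim k by (intro power_increasing) (auto intro: ge_one_powr_ge_zero)
    finally show ?case by (intro divide_right_mono) auto
  qed
  show "(\<lambda>j. (real j powr (1/8)) ^ 3 / sqrt (real j)) \<longlonglongrightarrow> 0" by real_asymp
qed auto

lemma cut_div: "(\<lambda>j. real (cut j) / real j) \<longlonglongrightarrow> 0"
proof (rule tendsto_sandwich[OF _ _ tendsto_const])
  show "\<forall>\<^sub>F j in sequentially. real (cut j) / real j \<le> real j powr (1/8) / real j"
    using real_cut(1) by (auto intro!: always_eventually divide_right_mono)
  show "(\<lambda>j. real j powr (1/8) / real j) \<longlonglongrightarrow> 0" by real_asymp
qed auto

lemma cut_centering:
  assumes c: "(\<lambda>j. c j / sqrt (real j)) \<longlonglongrightarrow> 0"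
  shows "(\<lambda>j. (a * real j + x * sqrt (s2 * real j) - c j - a * real (j - cut j)) / sqrt (s2 * real (j - cut j))) \<longlonglongrightarrow> x"
proof -
  have 1: "(\<lambda>j. ((a * (real (cut j) ^ 1 / sqrt (real j)) - c j / sqrt (real j)) / sqrt s2 + x) / sqrt (1 - real (cut j) / real j))
      \<longlonglongrightarrow> ((a * 0 - 0) / sqrt s2 + x) / sqrt (1 - 0)"
    using s2_pos by (intro tendsto_intros c cut_power_div_sqrt cut_div) auto
  have "\<forall>\<^sub>F j in sequentially. real (cut j) / real j < 1"
    using order_tendstoD(2)[OF cut_div, of 1] by simp
  then have "\<forall>\<^sub>F j in sequentially.
      ((a * (real (cut j) ^ 1 / sqrt (real j)) - c j / sqrt (real j)) / sqrt s2 + x) / sqrt (1 - real (cut j) / real j) =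
      (a * real j + x * sqrt (s2 * real j) - c j - a * real (j - cut j)) / sqrt (s2 * real (j - cut j))"
    using eventually_gt_at_top[of 0]
  proof eventually_elim
    case (elim j)
    define q where "q = sqrt (real j)"
    define r where "r = sqrt (1 - real (cut j) / real j)"
    define s where "s = sqrt s2"
    have pos: "0 < q" "0 < r" "0 < s" using elim s2_pos by (auto simp: q_def r_def s_def)
    have "sqrt (s2 * real (j - cut j)) = sqrt (s2 * (real j * (1 - real (cut j) / real j)))"
      using elim cut_le[of j] by (simp add: of_nat_diff field_simps)
    then have den: "sqrt (s2 * real (j - cut j)) = s * (q * r)"
      by (simp add: real_sqrt_mult q_def r_def s_def)
    have num: "a * real j + x * sqrt (s2 * real j) - c j - a * real (j - cut j) = a * real (cut j) + x * (s * q) - c j"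
      using cut_le[of j] by (simp add: of_nat_diff algebra_simps real_sqrt_mult q_def s_def)
    show ?case
      unfolding num den q_def[symmetric] r_def[symmetric] s_def[symmetric]
      using pos by (simp add: field_simps)
  qed
  from Lim_transform_eventually[OF 1 this] show ?thesis by simp
qed

lemma filterlim_minus_cut: "filterlim (\<lambda>j. j - cut j) at_top sequentially"
proof -
  have "filterlim (\<lambda>j. real (j - cut j)) at_top sequentially"
  proof (rule filterlim_at_top_mono[of "\<lambda>j. real j - real j powr (1/8)"])
    show "\<forall>\<^sub>F j in sequentially. real j - real j powr (1/8) \<le> real (j - cut j)"
      using real_cut(1) cut_le by (intro always_eventually) (auto simp: of_nat_diff)
  qed real_asymp
  then show ?thesis by (simp add: filterlim_sequentially_iff_filterlim_real)
qed

lemma summable_rho_cut: "summable (\<lambda>j. enn2real rho ^ cut j)"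
proof -
  define r where "r = max (1/2) (enn2real rho)"
  have "enn2real rho < 1" using rho_less by (metis enn2real_1 enn2real_less_iff ennreal_1 zero_less_one less_trans ennreal_one_less_top)
  then have r: "0 < r" "r < 1" "enn2real rho \<le> r" by (auto simp: r_def)
  define c where "c = ln r"
  have c: "c < 0" using r by (simp add: c_def)
  have "(\<lambda>j. exp (c * (real j powr (1/8) - 1))) \<in> O(\<lambda>j. 1 / real j ^ 2)"
    using c by real_asymp
  then have sum: "summable (\<lambda>j. exp (c * (real j powr (1/8) - 1)))"
    by (rule summable_comparison_test_bigo[rotated])
      (use inverse_power_summable[of 2, where 'a=real] in \<open>simp add: field_simps\<close>)
  show ?thesis
  proof (rule summable_comparison_test'[OF sum])
    fix j :: nat
    have "enn2real rho ^ cut j \<le> r ^ cut j" using r by (intro power_mono) auto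
    also have "\<dots> = exp (c * real (cut j))"
      using r by (simp add: c_def exp_of_nat2_mult)
    also have "\<dots> \<le> exp (c * (real j powr (1/8) - 1))"
      using real_cut(2)[of j] c by (simp add: mult_le_cancel_left less_imp_le)
    finally show "norm (enn2real rho ^ cut j) \<le> exp (c * (real j powr (1/8) - 1))" by simp
  qed
qed

lemma quenched_CLT_fixed:
  "AE \<omega> in M. (\<lambda>j. level_cdf \<omega> j (a * real j + x * sqrt (s2 * real j))) \<longlonglongrightarrow> Phi x"
proof -
  define y where "y j = a * real j + x * sqrt (s2 * real j)" for j
  define f :: "nat \<Rightarrow> real \<Rightarrow> ennreal" where "f j = indicator {exp (- y j)..}" for j
  define h where "h j = walk_mean (spine Q) (j - cut j) (f j)" for j
  define G where "G j \<omega> = level_mean (cut j) (W \<omega>) (h j)" for j \<omega>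
  define A where "A g \<omega> = level_mean g (W \<omega>) (indicator {..<exp (- (real g ^ 3))})" for g \<omega>
  have [measurable]: "f j \<in> borel_measurable borel" for j unfolding f_def by measurable
  have [measurable]: "h j \<in> borel_measurable borel" for j unfolding h_def by measurable
  have [measurable]: "G j \<in> borel_measurable M" "A j \<in> borel_measurable M" for j
    unfolding G_def A_def by measurable
  have f_le: "f j z \<le> 1" for j z by (simp add: f_def split: split_indicator)
  have rho_fin: "rho = ennreal (enn2real rho)"
    using rho_less by (intro ennreal_enn2real[symmetric]) (auto intro: less_trans)
  have AE1: "AE \<omega> in M. (\<lambda>j. (level_cdf \<omega> j (y j) - enn2real (G j \<omega>))\<^sup>2) \<longlonglongrightarrow> 0"
  proof (rule AE_tendsto_0_if_summable_bound)
    show "(\<integral>\<^sup>+\<omega>. ennreal ((level_cdf \<omega> j (y j) - enn2real (G j \<omega>))\<^sup>2) \<partial>M) \<le> ennreal (enn2real rho ^ cut j)" for j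
      using level_mean_conditional_variance[of "f j" "cut j" "j - cut j", OF _ f_le] cut_le[of j]
      by (simp add: level_cdf_def G_def h_def f_def rho_fin[symmetric] ennreal_power[symmetric])
    show "(\<lambda>\<omega>. (level_cdf \<omega> j (y j) - enn2real (G j \<omega>))\<^sup>2) \<in> borel_measurable M" for j
      unfolding level_cdf_def by measurable
  qed (use summable_rho_cut in auto)
  have AE2: "AE \<omega> in M. (\<lambda>g. enn2real (A (Suc g) \<omega>)) \<longlonglongrightarrow> 0"
  proof (rule AE_tendsto_0_if_summable_bound)
    fix g :: nat
    have "(\<integral>\<^sup>+\<omega>. ennreal (enn2real (A (Suc g) \<omega>)) \<partial>M) \<le> (\<integral>\<^sup>+\<omega>. A (Suc g) \<omega> \<partial>M)"
      by (intro nn_integral_mono) (simp add: ennreal_enn2real_if)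
    also have "\<dots> = walk_mean (spine Q) (Suc g) (indicator {..<exp (- (real (Suc g) ^ 3))}) 1"
      unfolding A_def
      using many_to_one[of "indicator {..<exp (- (real (Suc g) ^ 3))}" "Suc g" 1] by simp
    also have "\<dots> \<le> ennreal (real (Suc g) * a / real (Suc g) ^ 3)"
      by (rule spine.walk_mean_Markov[OF AE_spine_range ln_integrable ln_mean]) simp
    also have "real (Suc g) * a / real (Suc g) ^ 3 = a * (1 / real (Suc g) ^ 2)"
      by (simp add: power2_eq_square power3_eq_cube del: of_nat_Suc)
    finally show "(\<integral>\<^sup>+\<omega>. ennreal (enn2real (A (Suc g) \<omega>)) \<partial>M) \<le> ennreal (a * (1 / real (Suc g) ^ 2))" .
  next
    have "summable (\<lambda>g. 1 / real (Suc g) ^ 2)"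
      using inverse_power_summable[of 2, where 'a=real] by (subst summable_Suc_iff) (simp add: field_simps)
    then show "summable (\<lambda>g. a * (1 / real (Suc g) ^ 2))" by (rule summable_mult)
  qed (use a_pos in auto)
  have h_eq: "h j u = ennreal (spine.walk_cdf (j - cut j) (y j + ln u))" if "0 < u" for j u
    unfolding h_def f_def by (rule spine.walk_mean_indicator[OF AE_spine_range that])
  have upper: "enn2real (G j \<omega>) \<le> spine.walk_cdf (j - cut j) (y j)" for j \<omega>
  proof -
    let ?t = "ennreal (spine.walk_cdf (j - cut j) (y j))"
    have "G j \<omega> \<le> (\<integral>\<^sup>+u. ennreal (Pw (W \<omega>) u) * ?t \<partial>count_space (level (cut j)))"
      unfolding G_def level_mean_def
    proof (intro nn_integral_mono)
      fix u
      show "ennreal (Pw (W \<omega>) u) * h j (Pw (W \<omega>) u) \<le> ennreal (Pw (W \<omega>) u) * ?t"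
      proof (cases "0 < Pw (W \<omega>) u")
        case True
        then show ?thesis
          using Pw_le_1[OF W_good, of \<omega> u]
          by (intro mult_left_mono) (auto simp: h_eq intro!: ennreal_leI spine.walk_cdf_mono)
      qed (simp add: ennreal_neg not_less)
    qed
    also have "\<dots> = ?t"
      using level_mean_1[OF W_good, of "cut j" \<omega>] by (simp add: nn_integral_multc level_mean_def)
    finally show ?thesis by (intro enn2real_leI spine.walk_cdf_nonneg)
  qed
  have lower: "spine.walk_cdf (j - cut j) (y j - real (cut j) ^ 3) \<le> enn2real (G j \<omega>) + enn2real (A (cut j) \<omega>)" for j \<omega>
  proof -
    let ?t = "ennreal (spine.walk_cdf (j - cut j) (y j - real (cut j) ^ 3))"
    have "?t = (\<integral>\<^sup>+u. ennreal (Pw (W \<omega>) u) * ?t \<partial>count_space (level (cut j)))"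
      using level_mean_1[OF W_good, of "cut j" \<omega>] by (simp add: nn_integral_multc level_mean_def)
    also have "\<dots> \<le> level_mean (cut j) (W \<omega>) (\<lambda>u. h j u + indicator {..<exp (- (real (cut j) ^ 3))} u)"
      unfolding level_mean_def
    proof (intro nn_integral_mono)
      fix u
      let ?P = "Pw (W \<omega>) u"
      show "ennreal ?P * ?t \<le> ennreal ?P * (h j ?P + indicator {..<exp (- (real (cut j) ^ 3))} ?P)"
      proof (cases "0 < ?P")
        case True
        have "?t \<le> h j ?P + indicator {..<exp (- (real (cut j) ^ 3))} ?P"
        proof (cases "?P < exp (- (real (cut j) ^ 3))")
          case True
          have "?t \<le> 1"
            unfolding spine.walk_cdf_def by (intro ennreal_le_1[THEN iffD2] spine.P.prob_le_1)
          then show ?thesis using True by (auto intro: add_increasing)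
        next
          case False
          then have "- (real (cut j) ^ 3) \<le> ln ?P"
            using \<open>0 < ?P\<close> by (subst ln_ge_iff) auto
          then show ?thesis
            using False \<open>0 < ?P\<close> by (auto simp: h_eq intro!: ennreal_leI spine.walk_cdf_mono)
        qed
        then show ?thesis by (rule mult_left_mono) simp
      qed (simp add: ennreal_neg not_less)
    qed
    also have "\<dots> = G j \<omega> + A (cut j) \<omega>"
      unfolding G_def A_def by (rule level_mean_plus)
    also have "\<dots> = ennreal (enn2real (G j \<omega>) + enn2real (A (cut j) \<omega>))"
    proof -
      have "G j \<omega> \<le> 1" "A (cut j) \<omega> \<le> 1"
        unfolding G_def A_def h_def
        by (intro level_mean_le_1 W_good walk_mean_le_1 f_le; simp split: split_indicator)+
      then have "G j \<omega> \<noteq> \<top>" "A (cut j) \<omega> \<noteq> \<top>"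
        by (auto simp: top_unique)
      then show ?thesis
        by (simp add: ennreal_plus ennreal_enn2real_if)
    qed
    finally show ?thesis by (subst (asm) ennreal_le_iff) auto
  qed
  have lim_upper: "(\<lambda>j. spine.walk_cdf (j - cut j) (y j)) \<longlonglongrightarrow> Phi x"
    using cut_centering[of "\<lambda>_. 0" x]
    by (intro spine.walk_cdf_CLT[OF ln_integrable ln_mean ln_sq_integrable ln_sq_mean s2_pos filterlim_minus_cut])
      (simp add: y_def)
  have lim_lower: "(\<lambda>j. spine.walk_cdf (j - cut j) (y j - real (cut j) ^ 3)) \<longlonglongrightarrow> Phi x"
    using cut_centering[OF cut_power_div_sqrt, of 3 x]
    by (intro spine.walk_cdf_CLT[OF ln_integrable ln_mean ln_sq_integrable ln_sq_mean s2_pos filterlim_minus_cut])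
      (simp add: y_def)
  show ?thesis
    using AE1 AE2
  proof eventually_elim
    case (elim \<omega>)
    have A: "(\<lambda>j. enn2real (A (cut j) \<omega>)) \<longlonglongrightarrow> 0"
      by (rule filterlim_compose[OF LIMSEQ_imp_Suc[OF elim(2)] filterlim_cut])
    have G: "(\<lambda>j. enn2real (G j \<omega>)) \<longlonglongrightarrow> Phi x"
    proof (rule tendsto_sandwich[OF _ _ _ lim_upper])
      show "(\<lambda>j. spine.walk_cdf (j - cut j) (y j - real (cut j) ^ 3) - enn2real (A (cut j) \<omega>)) \<longlonglongrightarrow> Phi x"
        using tendsto_diff[OF lim_lower A] by simp
      show "\<forall>\<^sub>F j in sequentially. spine.walk_cdf (j - cut j) (y j - real (cut j) ^ 3) - enn2real (A (cut j) \<omega>) \<le> enn2real (G j \<omega>)"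
        using lower by (intro always_eventually allI) (simp add: algebra_simps)
    qed (use upper in auto)
    have "(\<lambda>j. sqrt ((level_cdf \<omega> j (y j) - enn2real (G j \<omega>))\<^sup>2)) \<longlonglongrightarrow> sqrt 0"
      by (rule tendsto_real_sqrt[OF elim(1)])
    then have "(\<lambda>j. level_cdf \<omega> j (y j) - enn2real (G j \<omega>)) \<longlonglongrightarrow> 0"
      by (simp add: tendsto_rabs_zero_iff)
    from tendsto_add[OF this G] show ?case by (simp add: y_def)
  qed
qed

lemma level_cdf_mono: "y \<le> y' \<Longrightarrow> level_cdf \<omega> j y \<le> level_cdf \<omega> j y'"
proof -
  assume "y \<le> y'"
  then have "level_mean j (W \<omega>) (indicator {exp (- y)..}) \<le> level_mean j (W \<omega>) (indicator {exp (- y')..})"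
    by (intro level_mean_mono) (auto split: split_indicator intro: order_trans[rotated])
  moreover have "level_mean j (W \<omega>) (indicator {exp (- y')..}) \<le> 1"
    by (intro level_mean_le_1 W_good) (simp split: split_indicator)
  ultimately show ?thesis
    unfolding level_cdf_def by (intro enn2real_mono) (auto intro: le_less_trans)
qed

theorem quenched_CLT:
  "AE \<omega> in M. \<forall>j y x. filterlim j at_top sequentially \<longrightarrow>
    (\<lambda>n. (y n - a * real (j n)) / sqrt (s2 * real (j n))) \<longlonglongrightarrow> x \<longrightarrow>
    (\<lambda>n. level_cdf \<omega> (j n) (y n)) \<longlonglongrightarrow> Phi x"
proof -
  have "AE \<omega> in M. \<forall>x\<in>\<rat>. (\<lambda>j. level_cdf \<omega> j (a * real j + x * sqrt (s2 * real j))) \<longlonglongrightarrow> Phi x"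
    by (subst AE_ball_countable) (auto intro: quenched_CLT_fixed simp: countable_rat)
  then show ?thesis
  proof (eventually_elim, intro allI impI)
    fix \<omega> and j :: "nat \<Rightarrow> nat" and y :: "nat \<Rightarrow> real" and x
    assume rat: "\<forall>x\<in>\<rat>. (\<lambda>j. level_cdf \<omega> j (a * real j + x * sqrt (s2 * real j))) \<longlonglongrightarrow> Phi x"
      and j: "filterlim j at_top sequentially"
      and y: "(\<lambda>n. (y n - a * real (j n)) / sqrt (s2 * real (j n))) \<longlonglongrightarrow> x"
    have "(\<lambda>n. level_cdf \<omega> (j n) (a * real (j n) + (y n - a * real (j n)) / sqrt (s2 * real (j n)) * sqrt (s2 * real (j n))))
        \<longlonglongrightarrow> Phi x"
    proof (rule LIMSEQ_mono_moving_argument[OF _ _ isCont_Phi j y,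
          where F="\<lambda>m z. level_cdf \<omega> m (a * real m + z * sqrt (s2 * real m))"])
      show "mono (\<lambda>z. level_cdf \<omega> m (a * real m + z * sqrt (s2 * real m)))" for m
        using s2_pos by (intro monoI level_cdf_mono) (auto intro!: mult_right_mono)
    qed (use rat in auto)
    moreover have "\<forall>\<^sub>F n in sequentially.
      level_cdf \<omega> (j n) (a * real (j n) + (y n - a * real (j n)) / sqrt (s2 * real (j n)) * sqrt (s2 * real (j n))) =
      level_cdf \<omega> (j n) (y n)"
      using filterlim_at_top[THEN iffD1, OF j, rule_format, of 1]
      by eventually_elim (use s2_pos in simp)
    ultimately show "(\<lambda>n. level_cdf \<omega> (j n) (y n)) \<longlonglongrightarrow> Phi x"
      by (rule Lim_transform_eventually)
  qed
qed

end

section \<open>Occupied boxes for a fixed tree\<close>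

definition occupied :: "weights \<Rightarrow> (nat \<Rightarrow> real) \<Rightarrow> nat \<Rightarrow> nat \<Rightarrow> nat list set" where
  "occupied w x j n = {u \<in> level j. \<exists>i<n. x i \<in> Ibox w u}"

lemma K_eq_card_occupied: "K w x j n = card (occupied w x j n)"
proof -
  have "1 \<le> card {i. i < n \<and> x i \<in> Ibox w u} \<longleftrightarrow> (\<exists>i<n. x i \<in> Ibox w u)" for u
    by (subst Suc_le_eq[of 0, unfolded One_nat_def[symmetric]], subst card_gt_0_iff) auto
  then show ?thesis by (simp add: Kcount_def occupied_def level_def)
qed

lemma occupied_Suc: "occupied w x j (Suc n) = occupied w x j n \<union> {u \<in> level j. x n \<in> Ibox w u}"
  by (auto simp: occupied_def less_Suc_eq)

lemma card_boxes_containing: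
  assumes "good w"
  shows "finite {u \<in> level j. z \<in> Ibox w u}" "card {u \<in> level j. z \<in> Ibox w u} \<le> 1"
proof -
  have "\<exists>v. {u \<in> level j. z \<in> Ibox w u} \<subseteq> {v}"
    using Ibox_disjoint[OF assms, of _ j] by blast
  then obtain v where "{u \<in> level j. z \<in> Ibox w u} \<subseteq> {v}" ..
  then show "finite {u \<in> level j. z \<in> Ibox w u}" "card {u \<in> level j. z \<in> Ibox w u} \<le> 1"
    using finite_subset card_mono[of "{v}"] by auto
qed

lemma finite_occupied: "good w \<Longrightarrow> finite (occupied w x j n)"
  by (induction n) (auto simp: occupied_Suc card_boxes_containing occupied_def[of _ _ _ 0])

lemma K_Suc:
  assumes "good w"
  shows "K w x j n \<le> K w x j (Suc n)" "K w x j (Suc n) \<le> K w x j n + 1"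
proof -
  show "K w x j n \<le> K w x j (Suc n)"
    unfolding K_eq_card_occupied
    by (intro card_mono finite_occupied assms) (auto simp: occupied_Suc)
  show "K w x j (Suc n) \<le> K w x j n + 1"
    unfolding K_eq_card_occupied occupied_Suc
    using card_Un_le[of "occupied w x j n" "{u \<in> level j. x n \<in> Ibox w u}"] card_boxes_containing(2)[OF assms, of j "x n"]
    by linarith
qed

lemma K_add:
  assumes "good w"
  shows "K w x j n \<le> K w x j (n + d)" "K w x j (n + d) \<le> K w x j n + d"
proof (induction d)
  case (Suc d)
  case 1 show ?case using K_Suc(1)[OF assms, of x j "n + d"] Suc(1) unfolding add_Suc_right by linarith
  case 2 show ?case using K_Suc(2)[OF assms, of x j "n + d"] Suc(2) unfolding add_Suc_right by linarith
qed auto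

definition occupied_mean :: "weights \<Rightarrow> nat \<Rightarrow> nat \<Rightarrow> ennreal" where
  "occupied_mean w j n = (\<integral>\<^sup>+u. ennreal (1 - (1 - Pw w u) ^ n) \<partial>count_space (level j))"

lemma K_eq_nn_integral:
  assumes "good w"
  shows "ennreal (real (K w x j n)) = (\<integral>\<^sup>+u. (if \<exists>i<n. x i \<in> Ibox w u then 1 else 0) \<partial>count_space (level j))"
proof -
  have "(\<integral>\<^sup>+u. (if \<exists>i<n. x i \<in> Ibox w u then 1 else 0) \<partial>count_space (level j)) =
      (\<integral>\<^sup>+u. indicator (occupied w x j n) u \<partial>count_space (level j))"
    by (intro nn_integral_cong) (auto simp: occupied_def split: split_indicator)
  also have "\<dots> = emeasure (count_space (level j)) (occupied w x j n)"
    by (rule nn_integral_indicator) (auto simp: occupied_def)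
  also have "\<dots> = ennreal (real (K w x j n))"
    using finite_occupied[OF assms] unfolding K_eq_card_occupied
    by (subst emeasure_count_space_finite) (auto simp: occupied_def ennreal_of_nat_eq_real_of_nat)
  finally show ?thesis ..
qed

lemma occupied_mean_le:
  assumes "good w"
  shows "occupied_mean w j n \<le> ennreal (real n)"
proof -
  have "occupied_mean w j n \<le> (\<integral>\<^sup>+u. ennreal (Pw w u) * ennreal (real n) \<partial>count_space (level j))"
    unfolding occupied_mean_def
  proof (intro nn_integral_mono)
    fix u
    have "1 + real n * (- Pw w u) \<le> (1 + (- Pw w u)) ^ n"
      using Pw_le_1[OF assms, of u] by (intro Bernoulli_inequality) auto
    then have "1 - (1 - Pw w u) ^ n \<le> Pw w u * real n"
      by (simp add: algebra_simps)
    then show "ennreal (1 - (1 - Pw w u) ^ n) \<le> ennreal (Pw w u) * ennreal (real n)"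
      using Pw_nonneg[OF assms, of u] by (simp add: ennreal_mult[symmetric] ennreal_leI)
  qed
  also have "\<dots> = ennreal (real n)"
    using level_mean_1[OF assms, of j] by (simp add: nn_integral_multc level_mean_def)
  finally show ?thesis .
qed

lemma one_minus_power_lower:
  fixes p :: real
  assumes "0 \<le> p" "p \<le> 1"
  shows "n * p / (1 + n * p) \<le> 1 - (1 - p) ^ n"
proof -
  have "(1 - p) ^ n * (1 + n * p) \<le> (1 - p) ^ n * (1 + p) ^ n"
    using assms Bernoulli_inequality[of p n] by (intro mult_left_mono) auto
  also have "\<dots> = (1 - p\<^sup>2) ^ n"
    by (simp add: power_mult_distrib[symmetric] power2_eq_square algebra_simps)
  also have "\<dots> \<le> 1"
    using assms by (intro power_le_one) (auto simp: power_le_one)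
  finally have "(1 - p) ^ n \<le> 1 / (1 + n * p)"
    using assms by (simp add: pos_le_divide_eq add_pos_nonneg)
  also have "\<dots> = 1 - n * p / (1 + n * p)"
    using assms by (simp add: field_simps add_pos_nonneg add_nonneg_eq_0_iff)
  finally show ?thesis by simp
qed

lemma occupied_mean_bounds:
  fixes j n :: nat and c :: real
  assumes w: "good w" and n: "0 < n" and c: "0 < c"
  defines "R \<equiv> enn2real (level_mean j w (indicator {c / real n..}))"
  shows "enn2real (occupied_mean w j n) / real n \<le> 1 / c + (1 - R)"
    and "(1 - R) / (1 + c) \<le> enn2real (occupied_mean w j n) / real n"
proof -
  let ?t = "c / real n" and ?CL = "count_space (level j)"
  have t: "0 < ?t" using n c by simp
  have le1: "level_mean j w (indicator A) \<le> 1" for A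
    by (intro level_mean_le_1 w) (simp split: split_indicator)
  have R: "level_mean j w (indicator {?t..}) = ennreal R" "0 \<le> R" "R \<le> 1"
    using le1[of "{?t..}"] unfolding R_def
    by (auto intro!: ennreal_enn2real[symmetric] enn2real_leI simp: less_top[symmetric] top_unique)
  have sum: "level_mean j w (indicator {..<?t}) + ennreal R = 1"
  proof -
    have "level_mean j w (indicator {..<?t}) + ennreal R = level_mean j w (\<lambda>x. indicator {..<?t} x + indicator {?t..} x)"
      unfolding R(1)[symmetric] by (rule level_mean_plus[symmetric])
    also have "\<dots> = level_mean j w (\<lambda>_. 1)"
      by (intro arg_cong[where f="level_mean j w"] ext) (auto split: split_indicator)
    finally show ?thesis using level_mean_1[OF w] by simp
  qed
  have L: "level_mean j w (indicator {..<?t}) = ennreal (1 - R)"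
  proof -
    have "level_mean j w (indicator {..<?t}) + ennreal R = ennreal (1 - R) + ennreal R"
      using sum R by (subst ennreal_plus[symmetric]) auto
    then show ?thesis
      by (simp add: add.commute[of _ "ennreal R"] ennreal_add_left_cancel)
  qed
  have occ: "ennreal (enn2real (occupied_mean w j n)) = occupied_mean w j n"
    using occupied_mean_le[OF w, of j n] by (intro ennreal_enn2real) (auto simp: less_top[symmetric] top_unique)
  have "occupied_mean w j n \<le> (\<integral>\<^sup>+u. ennreal (1 / ?t) * (ennreal (Pw w u) * indicator {?t..} (Pw w u)) +
      ennreal (real n) * (ennreal (Pw w u) * indicator {..<?t} (Pw w u)) \<partial>?CL)"
    unfolding occupied_mean_def
  proof (intro nn_integral_mono)
    fix u
    have p: "0 \<le> Pw w u" "Pw w u \<le> 1" using Pw_nonneg[OF w] Pw_le_1[OF w] by auto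
    show "ennreal (1 - (1 - Pw w u) ^ n) \<le> ennreal (1 / ?t) * (ennreal (Pw w u) * indicator {?t..} (Pw w u)) +
      ennreal (real n) * (ennreal (Pw w u) * indicator {..<?t} (Pw w u))"
    proof (cases "Pw w u < ?t")
      case True
      have "1 + real n * (- Pw w u) \<le> (1 + (- Pw w u)) ^ n"
        using p by (intro Bernoulli_inequality) auto
      then show ?thesis
        using True p by (auto simp: ennreal_mult[symmetric] algebra_simps intro!: ennreal_leI)
    next
      case False
      have "1 - (1 - Pw w u) ^ n \<le> 1" using p by simp
      also have "1 \<le> 1 / ?t * Pw w u" using False n c by (simp add: field_simps not_less)
      finally show ?thesis
        using False p t c by (auto simp: ennreal_mult[symmetric] intro!: ennreal_leI)
    qed
  qed
  also have "\<dots> = ennreal (1 / ?t) * level_mean j w (indicator {?t..}) + ennreal (real n) * level_mean j w (indicator {..<?t})"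
    unfolding level_mean_def by (subst nn_integral_add) (auto simp: nn_integral_cmult)
  also have "\<dots> = ennreal (R / ?t + real n * (1 - R))"
    using R t c n by (simp add: L R(1) ennreal_mult[symmetric] ennreal_plus[symmetric] del: ennreal_plus)
  finally have "enn2real (occupied_mean w j n) \<le> R / ?t + real n * (1 - R)"
    using R t n c by (intro enn2real_leI) auto
  also have "\<dots> \<le> 1 / ?t + real n * (1 - R)"
    using R t by (intro add_right_mono divide_right_mono) auto
  finally show "enn2real (occupied_mean w j n) / real n \<le> 1 / c + (1 - R)"
    using n c by (simp add: field_simps)
  have "ennreal (real n / (1 + c)) * level_mean j w (indicator {..<?t}) \<le> occupied_mean w j n"
    unfolding level_mean_def occupied_mean_def
  proof (subst nn_integral_cmult[symmetric], simp, intro nn_integral_mono)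
    fix u
    have p: "0 \<le> Pw w u" "Pw w u \<le> 1" using Pw_nonneg[OF w] Pw_le_1[OF w] by auto
    show "ennreal (real n / (1 + c)) * (ennreal (Pw w u) * indicator {..<?t} (Pw w u)) \<le> ennreal (1 - (1 - Pw w u) ^ n)"
    proof (cases "Pw w u < ?t")
      case True
      have "real n * Pw w u \<le> c" using True n by (simp add: field_simps)
      then have "real n * Pw w u / (1 + c) \<le> real n * Pw w u / (1 + real n * Pw w u)"
        using p c by (intro divide_left_mono) (auto intro!: mult_pos_pos add_pos_nonneg)
      then have "real n / (1 + c) * Pw w u \<le> real n * Pw w u / (1 + real n * Pw w u)" by simp
      also have "\<dots> \<le> 1 - (1 - Pw w u) ^ n" by (rule one_minus_power_lower[OF p])
      finally show ?thesis
        using True p c by (auto simp: ennreal_mult[symmetric] intro!: ennreal_leI)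
    qed simp
  qed
  then have "ennreal (real n / (1 + c) * (1 - R)) \<le> ennreal (enn2real (occupied_mean w j n))"
    using R c unfolding L occ by (subst ennreal_mult) auto
  then have "real n / (1 + c) * (1 - R) \<le> enn2real (occupied_mean w j n)"
    by (subst (asm) ennreal_le_iff) auto
  then show "(1 - R) / (1 + c) \<le> enn2real (occupied_mean w j n) / real n"
    using n c by (simp add: field_simps)
qed

locale uniform_balls = prob_space M for M :: "'a measure" +
  fixes U :: "'a \<Rightarrow> nat \<Rightarrow> real"
  assumes U_indep: "indep_vars (\<lambda>_. borel) (\<lambda>i \<omega>. U \<omega> i) UNIV"
    and U_law: "\<And>i. distr M lborel (\<lambda>\<omega>. U \<omega> i) = uniform_measure lborel {0..1}"
begin

lemma measurable_U_component [measurable]: "(\<lambda>\<omega>. U \<omega> i) \<in> borel_measurable M"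
  using U_indep by (simp add: indep_vars_def)

lemma prob_all_balls_in:
  assumes [measurable]: "A \<in> sets borel"
  shows "prob {\<omega> \<in> space M. \<forall>i<n. U \<omega> i \<in> A} = measure (uniform_measure lborel {0..1}) A ^ n"
proof (cases "n = 0")
  case False
  have "prob {\<omega> \<in> space M. U \<omega> i \<in> A} = measure (uniform_measure lborel {0..1}) A" for i
    unfolding U_law[of i, symmetric] by (subst measure_distr) (auto intro!: arg_cong[where f=prob])
  then have "(\<Prod>i<n. prob ((\<lambda>\<omega>. U \<omega> i) -` A \<inter> space M)) = measure (uniform_measure lborel {0..1}) A ^ n"
    by (simp add: vimage_def Int_def conj_commute)
  moreover have "prob (\<Inter>i\<in>{..<n}. (\<lambda>\<omega>. U \<omega> i) -` A \<inter> space M) = (\<Prod>i<n. prob ((\<lambda>\<omega>. U \<omega> i) -` A \<inter> space M))"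
    using False by (intro indep_varsD[OF U_indep]) auto
  moreover have "{\<omega> \<in> space M. \<forall>i<n. U \<omega> i \<in> A} = (\<Inter>i\<in>{..<n}. (\<lambda>\<omega>. U \<omega> i) -` A \<inter> space M)"
    using False by auto
  ultimately show ?thesis by simp
qed (simp add: prob_space)

lemma measure_uniform_Ibox:
  assumes "good w"
  shows "measure (uniform_measure lborel {0..1}) (Ibox w u) = Pw w u"
proof -
  have "Ibox w u \<subseteq> {0..1}"
    using Ileft_nonneg[OF assms, of u] Iright_le_1[OF assms, of u] by (auto simp: Ibox_def)
  then show ?thesis
    using Iright_eq[OF assms, of u] Pw_nonneg[OF assms, of u]
    by (subst measure_uniform_measure) (auto simp: Int_absorb1 Ibox_def)
qed

lemma prob_box_empty:
  assumes w: "good w"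
  shows "prob {\<omega> \<in> space M. \<forall>i<n. U \<omega> i \<notin> Ibox w u} = (1 - Pw w u) ^ n"
proof -
  interpret u: prob_space "uniform_measure lborel {0..1::real}"
    by (rule prob_space_uniform_measure) auto
  have "measure (uniform_measure lborel {0..1}) (- Ibox w u) = 1 - Pw w u"
    using u.prob_compl[of "Ibox w u"] measure_uniform_Ibox[OF w, of u]
    by (simp add: Compl_eq_Diff_UNIV Ibox_def)
  then show ?thesis
    using prob_all_balls_in[of "- Ibox w u" n] by (simp add: Ibox_def)
qed

lemma prob_two_boxes_empty:
  assumes w: "good w" and uv: "u \<in> level j" "v \<in> level j" "u \<noteq> v"
  shows "prob {\<omega> \<in> space M. \<forall>i<n. U \<omega> i \<notin> Ibox w u \<and> U \<omega> i \<notin> Ibox w v} = (1 - Pw w u - Pw w v) ^ n"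
    and "Pw w u + Pw w v \<le> 1"
proof -
  interpret u: prob_space "uniform_measure lborel {0..1::real}"
    by (rule prob_space_uniform_measure) auto
  have un: "measure (uniform_measure lborel {0..1}) (Ibox w u \<union> Ibox w v) = Pw w u + Pw w v"
    using Ibox_disjoint[OF w uv] measure_uniform_Ibox[OF w]
    by (subst u.finite_measure_Union) (auto simp: Ibox_def)
  then have "measure (uniform_measure lborel {0..1}) (- (Ibox w u \<union> Ibox w v)) = 1 - Pw w u - Pw w v"
    using u.prob_compl[of "Ibox w u \<union> Ibox w v"] by (simp add: Compl_eq_Diff_UNIV Ibox_def)
  then show "prob {\<omega> \<in> space M. \<forall>i<n. U \<omega> i \<notin> Ibox w u \<and> U \<omega> i \<notin> Ibox w v} = (1 - Pw w u - Pw w v) ^ n"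
    using prob_all_balls_in[of "- (Ibox w u \<union> Ibox w v)" n] by (simp add: Ibox_def)
  show "Pw w u + Pw w v \<le> 1"
    unfolding un[symmetric] by (rule u.prob_le_1)
qed

definition hit :: "weights \<Rightarrow> nat \<Rightarrow> nat list \<Rightarrow> 'a set" where
  "hit w n u = {\<omega> \<in> space M. \<exists>i<n. U \<omega> i \<in> Ibox w u}"

lemma sets_hit [measurable]: "hit w n u \<in> events"
  unfolding hit_def Ibox_def by measurable

lemma prob_hit:
  assumes "good w"
  shows "prob (hit w n u) = 1 - (1 - Pw w u) ^ n"
proof -
  have "hit w n u = space M - {\<omega> \<in> space M. \<forall>i<n. U \<omega> i \<notin> Ibox w u}" by (auto simp: hit_def)
  moreover have "{\<omega> \<in> space M. \<forall>i<n. U \<omega> i \<notin> Ibox w u} \<in> events"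
    unfolding Ibox_def by measurable
  ultimately show ?thesis
    using prob_box_empty[OF assms, of n u] prob_compl[of "{\<omega> \<in> space M. \<forall>i<n. U \<omega> i \<notin> Ibox w u}"]
    by (simp only:)
qed

lemma prob_hit_Int_le:
  assumes w: "good w" and uv: "u \<in> level j" "v \<in> level j" "u \<noteq> v"
  shows "prob (hit w n u \<inter> hit w n v) \<le> prob (hit w n u) * prob (hit w n v)"
proof -
  let ?E = "{\<omega> \<in> space M. \<forall>i<n. U \<omega> i \<notin> Ibox w u \<and> U \<omega> i \<notin> Ibox w v}"
  have "?E \<in> events" unfolding Ibox_def by measurable
  moreover have "hit w n u \<union> hit w n v = space M - ?E" by (auto simp: hit_def)
  ultimately have union: "prob (hit w n u \<union> hit w n v) = 1 - (1 - Pw w u - Pw w v) ^ n"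
    using prob_two_boxes_empty(1)[OF assms, of n] prob_compl[of ?E] by (simp only:)
  have "prob (hit w n u \<inter> hit w n v) = prob (hit w n u) + prob (hit w n v) - prob (hit w n u \<union> hit w n v)"
    using measure_Un3[of "hit w n u" M "hit w n v"] by (simp add: fmeasurable_eq_sets)
  moreover have "(1 - Pw w u - Pw w v) ^ n \<le> ((1 - Pw w u) * (1 - Pw w v)) ^ n"
    using prob_two_boxes_empty(2)[OF assms] Pw_nonneg[OF w]
    by (intro power_mono) (auto simp: algebra_simps)
  moreover have "(1 - (1 - Pw w u) ^ n) * (1 - (1 - Pw w v) ^ n) =
      1 - (1 - Pw w u) ^ n - (1 - Pw w v) ^ n + ((1 - Pw w u) * (1 - Pw w v)) ^ n"
    by (simp only: power_mult_distrib) (simp add: algebra_simps)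
  ultimately show ?thesis
    unfolding union prob_hit[OF w] by linarith
qed

lemma variance_K_le:
  assumes w: "good w"
  shows "(\<integral>\<^sup>+\<omega>. ennreal ((real (K w (U \<omega>) j n) - enn2real (occupied_mean w j n))\<^sup>2) \<partial>M) \<le> ennreal (real n)"
proof -
  define S where "S = enn2real (occupied_mean w j n)"
  have S: "ennreal S = occupied_mean w j n" "0 \<le> S" "S \<le> real n"
    using occupied_mean_le[OF w, of j n] unfolding S_def
    by (auto intro!: ennreal_enn2real enn2real_leI simp: less_top[symmetric] top_unique)
  let ?CL = "count_space (level j)"
  have K: "ennreal (real (K w (U \<omega>) j n)) = (\<integral>\<^sup>+u. indicator (hit w n u) \<omega> \<partial>?CL)" if "\<omega> \<in> space M" for \<omega>
    using that unfolding K_eq_nn_integral[OF w]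
    by (intro nn_integral_cong) (auto simp: hit_def split: split_indicator)
  have meas [measurable]: "(\<lambda>\<omega>. \<integral>\<^sup>+u. indicator (hit w n u) \<omega> \<partial>?CL) \<in> borel_measurable M"
    by (rule borel_measurable_nn_integral_countable) auto
  have meas_K [measurable]: "(\<lambda>\<omega>. ennreal (real (K w (U \<omega>) j n))) \<in> borel_measurable M"
    using meas by (subst measurable_cong[OF K])
  have [measurable]: "(\<lambda>\<omega>. real (K w (U \<omega>) j n)) \<in> borel_measurable M"
    using borel_measurable_enn2real[OF meas_K] by simp
  have emeasure_hit: "emeasure M (hit w n u) = ennreal (1 - (1 - Pw w u) ^ n)" for u
    by (simp add: emeasure_eq_measure prob_hit[OF w])
  have EK: "(\<integral>\<^sup>+\<omega>. ennreal (real (K w (U \<omega>) j n)) \<partial>M) = ennreal S"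
  proof -
    have "(\<integral>\<^sup>+\<omega>. ennreal (real (K w (U \<omega>) j n)) \<partial>M) = (\<integral>\<^sup>+\<omega>. \<integral>\<^sup>+u. indicator (hit w n u) \<omega> \<partial>?CL \<partial>M)"
      by (intro nn_integral_cong K)
    also have "\<dots> = (\<integral>\<^sup>+u. \<integral>\<^sup>+\<omega>. indicator (hit w n u) \<omega> \<partial>M \<partial>?CL)"
      by (rule nn_integral_count_space_nn_integral) auto
    also have "\<dots> = ennreal S"
      by (simp add: emeasure_hit S(1) occupied_mean_def)
    finally show ?thesis .
  qed
  have EKK: "(\<integral>\<^sup>+\<omega>. ennreal ((real (K w (U \<omega>) j n))\<^sup>2) \<partial>M) \<le> ennreal S + ennreal S * ennreal S"
  proof -
    have "(\<integral>\<^sup>+\<omega>. ennreal ((real (K w (U \<omega>) j n))\<^sup>2) \<partial>M) =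
      (\<integral>\<^sup>+\<omega>. (\<integral>\<^sup>+u. indicator (hit w n u) \<omega> \<partial>?CL) * (\<integral>\<^sup>+u. indicator (hit w n u) \<omega> \<partial>?CL) \<partial>M)"
      by (intro nn_integral_cong) (simp add: K[symmetric] power2_eq_square ennreal_mult)
    also have "\<dots> = (\<integral>\<^sup>+u. \<integral>\<^sup>+v. \<integral>\<^sup>+\<omega>. indicator (hit w n u) \<omega> * indicator (hit w n v) \<omega> \<partial>M \<partial>?CL \<partial>?CL)"
      by (rule nn_integral_count_space_mult) auto
    also have "\<dots> \<le> (\<integral>\<^sup>+u. \<integral>\<^sup>+v. (emeasure M (hit w n u) * indicator {u} v + emeasure M (hit w n u) * emeasure M (hit w n v)) \<partial>?CL \<partial>?CL)"
    proof (intro nn_integral_mono)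
      fix u v assume "u \<in> space ?CL" "v \<in> space ?CL"
      then have uv: "u \<in> level j" "v \<in> level j" by auto
      have "(\<integral>\<^sup>+\<omega>. indicator (hit w n u) \<omega> * indicator (hit w n v) \<omega> \<partial>M) = emeasure M (hit w n u \<inter> hit w n v)"
        by (simp add: indicator_inter_arith[symmetric])
      also have "\<dots> \<le> emeasure M (hit w n u) * indicator {u} v + emeasure M (hit w n u) * emeasure M (hit w n v)"
      proof (cases "u = v")
        case True then show ?thesis by (auto intro: add_increasing2)
      next
        case False
        then show ?thesis
          using prob_hit_Int_le[OF w uv] by (simp add: emeasure_eq_measure ennreal_mult[symmetric] ennreal_leI)
      qed
      finally show "(\<integral>\<^sup>+\<omega>. indicator (hit w n u) \<omega> * indicator (hit w n v) \<omega> \<partial>M) \<le>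
        emeasure M (hit w n u) * indicator {u} v + emeasure M (hit w n u) * emeasure M (hit w n v)" .
    qed
    also have "\<dots> = (\<integral>\<^sup>+u. emeasure M (hit w n u) + emeasure M (hit w n u) * ennreal S \<partial>?CL)"
      by (intro nn_integral_cong, subst nn_integral_add)
        (auto simp: nn_integral_cmult one_ennreal_def[symmetric] emeasure_hit S(1) occupied_mean_def)
    also have "\<dots> = ennreal S + ennreal S * ennreal S"
      by (subst nn_integral_add) (auto simp: nn_integral_multc emeasure_hit S(1) occupied_mean_def)
    finally show ?thesis .
  qed
  have real: "ennreal ((real k - S)\<^sup>2) + 2 * ennreal S * ennreal (real k) = ennreal ((real k)\<^sup>2) + ennreal S * ennreal S" for k
  proof -
    have "ennreal ((real k - S)\<^sup>2) + 2 * ennreal S * ennreal (real k) = ennreal ((real k - S)\<^sup>2) + ennreal (2 * S * real k)"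
      using S(2) by (simp add: ennreal_mult)
    also have "\<dots> = ennreal ((real k - S)\<^sup>2 + 2 * S * real k)"
      using S(2) by (intro ennreal_plus[symmetric]) auto
    also have "(real k - S)\<^sup>2 + 2 * S * real k = (real k)\<^sup>2 + S * S"
      by (simp add: power2_eq_square algebra_simps)
    also have "ennreal \<dots> = ennreal ((real k)\<^sup>2) + ennreal S * ennreal S"
      using S(2) by (simp add: ennreal_mult)
    finally show ?thesis .
  qed
  have "(\<integral>\<^sup>+\<omega>. ennreal ((real (K w (U \<omega>) j n) - S)\<^sup>2) \<partial>M) + 2 * ennreal S * ennreal S =
    (\<integral>\<^sup>+\<omega>. ennreal ((real (K w (U \<omega>) j n) - S)\<^sup>2) + 2 * ennreal S * ennreal (real (K w (U \<omega>) j n)) \<partial>M)"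
    by (subst nn_integral_add) (auto simp: nn_integral_cmult EK simp del: One_nat_def)
  also have "\<dots> = (\<integral>\<^sup>+\<omega>. ennreal ((real (K w (U \<omega>) j n))\<^sup>2) + ennreal S * ennreal S \<partial>M)"
    by (simp only: real)
  also have "\<dots> = (\<integral>\<^sup>+\<omega>. ennreal ((real (K w (U \<omega>) j n))\<^sup>2) \<partial>M) + ennreal S * ennreal S"
    by (subst nn_integral_add) (auto simp: emeasure_space_1 simp del: One_nat_def)
  also have "\<dots> \<le> ennreal S + 2 * ennreal S * ennreal S"
    using add_right_mono[OF EKK, of "ennreal S * ennreal S"] by (simp add: mult_2 distrib_right add.assoc)
  finally have "2 * ennreal S * ennreal S + (\<integral>\<^sup>+\<omega>. ennreal ((real (K w (U \<omega>) j n) - S)\<^sup>2) \<partial>M)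
    \<le> 2 * ennreal S * ennreal S + ennreal S"
    by (simp add: add.commute)
  then have "(\<integral>\<^sup>+\<omega>. ennreal ((real (K w (U \<omega>) j n) - S)\<^sup>2) \<partial>M) \<le> ennreal S"
    by (subst (asm) ennreal_add_left_cancel_le) (auto simp: ennreal_mult_eq_top_iff)
  also have "\<dots> \<le> ennreal (real n)" using S by (intro ennreal_leI)
  finally show ?thesis unfolding S_def .
qed

end

section \<open>Random trees and random balls\<close>

text \<open>\<open>infsum\<close> is junk on non-summable families; these variants of the box endpoint and of the
  occupancy count agree with the original ones on good trees and are measurable on all trees.\<close>

definition box_left :: "weights \<Rightarrow> nat list \<Rightarrow> real" where
  "box_left w u = enn2real (\<integral>\<^sup>+v. ennreal (Pw w v) \<partial>count_space {v. length v = length u \<and> lexlt v u})"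

definition occupancy :: "weights \<Rightarrow> (nat \<Rightarrow> real) \<Rightarrow> nat \<Rightarrow> nat \<Rightarrow> real" where
  "occupancy w x j n = enn2real (\<integral>\<^sup>+u. (if \<exists>i<n. box_left w u \<le> x i \<and> x i < box_left w u + Pw w u then 1 else 0)
    \<partial>count_space (level j))"

lemma Ibox_eq: "good w \<Longrightarrow> Ibox w u = {box_left w u ..< box_left w u + Pw w u}"
  unfolding Ibox_def Iright_eq Ileft_def box_left_def
  by (subst (1 2) infsum_Pw_eq[of w _ "length u"]) (auto simp: level_def)

lemma K_eq_occupancy: "good w \<Longrightarrow> real (K w x j n) = occupancy w x j n"
proof -
  assume "good w"
  then have "real (K w x j n) =
      enn2real (\<integral>\<^sup>+u. (if \<exists>i<n. x i \<in> Ibox w u then 1 else 0) \<partial>count_space (level j))"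
    by (subst K_eq_nn_integral[symmetric]) (simp_all del: One_nat_def)
  also have "\<dots> = occupancy w x j n"
    unfolding Ibox_eq[OF \<open>good w\<close>] atLeastLessThan_iff occupancy_def ..
  finally show ?thesis .
qed

lemma measurable_occupied_mean:
  "(\<lambda>p. occupied_mean (fst p) j n) \<in> borel_measurable (tree_space \<Otimes>\<^sub>M N)"
proof -
  have [measurable]: "(\<lambda>p. Pw (fst p) u) \<in> borel_measurable (tree_space \<Otimes>\<^sub>M N)" for u
    by (intro measurable_Pw measurable_compose[OF measurable_fst] measurable_tree_component)
  show ?thesis
    unfolding occupied_mean_def by (intro borel_measurable_nn_integral_countable) auto
qed

lemma measurable_occupancy:
  "(\<lambda>p. occupancy (fst p) (snd p) j n) \<in> borel_measurable (tree_space \<Otimes>\<^sub>M sequence_borel)"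
proof -
  let ?N = "tree_space \<Otimes>\<^sub>M sequence_borel"
  have Pw: "(\<lambda>p. Pw (fst p) u) \<in> borel_measurable ?N" for u
    by (intro measurable_Pw measurable_compose[OF measurable_fst] measurable_tree_component)
  have ball: "(\<lambda>p. snd p i) \<in> borel_measurable ?N" for i
    by (rule measurable_compose[OF measurable_snd measurable_component_singleton]) simp
  have left: "(\<lambda>p. box_left (fst p) u) \<in> borel_measurable ?N" for u
    unfolding box_left_def
    by (intro borel_measurable_enn2real borel_measurable_nn_integral_countable measurable_compose[OF Pw measurable_ennreal]) auto
  have pred: "Measurable.pred N (\<lambda>p. f p \<le> g p \<and> g p < f p + h p)"
    if [measurable]: "f \<in> borel_measurable N" "g \<in> borel_measurable N" "h \<in> borel_measurable N"
    for N :: "'z measure" and f g h :: "'z \<Rightarrow> real"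
    by measurable
  have [measurable]: "Measurable.pred ?N (\<lambda>p. box_left (fst p) u \<le> snd p i \<and> snd p i < box_left (fst p) u + Pw (fst p) u)"
    for i u
    by (rule pred[OF left ball Pw])
  have "(\<lambda>p. if \<exists>i<n. box_left (fst p) u \<le> snd p i \<and> snd p i < box_left (fst p) u + Pw (fst p) u
      then 1 else (0::ennreal)) \<in> borel_measurable ?N" for u
    by measurable
  then show ?thesis
    unfolding occupancy_def
    by (intro borel_measurable_enn2real borel_measurable_nn_integral_countable) auto
qed

locale balls_in_tree = finite_variance_tree M Q W a s2 + uniform_balls M U
  for M :: "'a measure" and Q W a s2 U +
  assumes product_law: "distr M tree_space W \<Otimes>\<^sub>M distr M sequence_borel U =
    distr M (tree_space \<Otimes>\<^sub>M sequence_borel) (\<lambda>\<omega>. (W \<omega>, U \<omega>))"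
begin

lemma measurable_U [measurable]: "U \<in> measurable M sequence_borel"
proof -
  have "(\<lambda>\<omega>. \<lambda>i\<in>UNIV. U \<omega> i) \<in> measurable M sequence_borel"
    by (intro measurable_restrict) auto
  then show ?thesis by (simp add: restrict_UNIV)
qed

abbreviation count :: "nat \<Rightarrow> nat \<Rightarrow> 'a \<Rightarrow> real" where
  "count j n \<omega> \<equiv> real (K (W \<omega>) (U \<omega>) j n)"

abbreviation mean_count :: "nat \<Rightarrow> nat \<Rightarrow> 'a \<Rightarrow> real" where
  "mean_count j n \<omega> \<equiv> enn2real (occupied_mean (W \<omega>) j n)"

lemma measurable_count [measurable]: "count j n \<in> borel_measurable M"
  using measurable_compose[OF _ measurable_occupancy, of "\<lambda>\<omega>. (W \<omega>, U \<omega>)" M j n]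
  by (simp add: K_eq_occupancy[OF W_good] del: One_nat_def)

lemma measurable_mean_count [measurable]: "mean_count j n \<in> borel_measurable M"
  using measurable_compose[OF _ measurable_occupied_mean, of "\<lambda>\<omega>. (W \<omega>, U \<omega>)" M sequence_borel j n]
  by simp

lemma annealed_variance:
  "(\<integral>\<^sup>+\<omega>. ennreal ((count j n \<omega> - mean_count j n \<omega>)\<^sup>2) \<partial>M) \<le> ennreal (real n)"
proof -
  let ?G = "\<lambda>w x. ennreal ((occupancy w x j n - enn2real (occupied_mean w j n))\<^sup>2)"
  note [measurable] = measurable_occupancy[of j n] measurable_occupied_mean[of j n sequence_borel]
  have "case_prod ?G \<in> borel_measurable (tree_space \<Otimes>\<^sub>M sequence_borel)"
    unfolding split_beta by measurable
  from nn_integral_product_law[OF measurable_W measurable_U product_law this]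
  have "(\<integral>\<^sup>+\<omega>. ennreal ((count j n \<omega> - mean_count j n \<omega>)\<^sup>2) \<partial>M) =
    (\<integral>\<^sup>+\<omega>. \<integral>\<^sup>+\<omega>'. ennreal ((real (K (W \<omega>) (U \<omega>') j n) - mean_count j n \<omega>)\<^sup>2) \<partial>M \<partial>M)"
    by (simp only: K_eq_occupancy[OF W_good])
  also have "\<dots> \<le> (\<integral>\<^sup>+\<omega>. ennreal (real n) \<partial>M)"
    by (intro nn_integral_mono variance_K_le W_good)
  finally show ?thesis by (simp add: emeasure_space_1)
qed

text \<open>Along \<open>n = k\<^sup>4\<close> the Chebyshev bounds are summable even after summing over all levels
  up to \<open>k\<close>; the counts in between are controlled by monotonicity.\<close>

lemma concentration:
  "AE \<omega> in M. (\<lambda>k. \<Sum>i\<le>k. ((count i (Suc k ^ 4) \<omega> - mean_count i (Suc k ^ 4) \<omega>) / real (Suc k ^ 4))\<^sup>2) \<longlonglongrightarrow> 0"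
proof (rule AE_tendsto_0_if_summable_bound)
  fix k :: nat
  let ?N = "Suc k ^ 4"
  have N: "0 < real ?N" by simp
  have "(\<integral>\<^sup>+\<omega>. ennreal (\<Sum>i\<le>k. ((count i ?N \<omega> - mean_count i ?N \<omega>) / real ?N)\<^sup>2) \<partial>M) =
      (\<integral>\<^sup>+\<omega>. (\<Sum>i\<le>k. ennreal (1 / (real ?N)\<^sup>2) * ennreal ((count i ?N \<omega> - mean_count i ?N \<omega>)\<^sup>2)) \<partial>M)"
    by (intro nn_integral_cong)
      (simp add: sum_ennreal[symmetric] ennreal_mult[symmetric] power_divide del: sum_ennreal of_nat_Suc of_nat_power One_nat_def)
  also have "\<dots> = (\<Sum>i\<le>k. ennreal (1 / (real ?N)\<^sup>2) * (\<integral>\<^sup>+\<omega>. ennreal ((count i ?N \<omega> - mean_count i ?N \<omega>)\<^sup>2) \<partial>M))"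
    by (simp add: nn_integral_sum nn_integral_cmult del: of_nat_Suc of_nat_power One_nat_def)
  also have "\<dots> \<le> (\<Sum>i\<le>k. ennreal (1 / (real ?N)\<^sup>2) * ennreal (real ?N))"
    by (intro sum_mono mult_left_mono annealed_variance) simp
  also have "\<dots> = (\<Sum>i\<le>k. ennreal (1 / real ?N))"
    using N by (intro sum.cong refl)
      (simp add: ennreal_mult[symmetric] power2_eq_square del: of_nat_Suc of_nat_power)
  also have "\<dots> = ennreal (real (Suc k) * (1 / real ?N))"
    by (subst ennreal_mult) (simp_all add: ennreal_of_nat_eq_real_of_nat del: of_nat_Suc of_nat_power)
  also have "real (Suc k) * (1 / real ?N) \<le> 1 / real (Suc k) ^ 2"
  proof -
    have "real (Suc k) * (1 / real ?N) = 1 / real (Suc k) ^ 3"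
      by (simp only: of_nat_power) (simp add: power4_eq_xxxx power3_eq_cube del: of_nat_Suc)
    also have "\<dots> \<le> 1 / real (Suc k) ^ 2"
      by (intro divide_left_mono power_increasing) auto
    finally show ?thesis .
  qed
  finally show "(\<integral>\<^sup>+\<omega>. ennreal (\<Sum>i\<le>k. ((count i ?N \<omega> - mean_count i ?N \<omega>) / real ?N)\<^sup>2) \<partial>M)
    \<le> ennreal (1 / real (Suc k) ^ 2)"
    by (simp add: ennreal_leI)
next
  show "summable (\<lambda>k. 1 / real (Suc k) ^ 2)"
    using inverse_power_summable[of 2, where 'a=real] by (subst summable_Suc_iff) (simp add: field_simps)
  show "(\<lambda>\<omega>. \<Sum>i\<le>k. ((count i (Suc k ^ 4) \<omega> - mean_count i (Suc k ^ 4) \<omega>) / real (Suc k ^ 4))\<^sup>2)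
      \<in> borel_measurable M" for k
    by measurable
qed (auto intro!: sum_nonneg)

end

definition quartic_root :: "nat \<Rightarrow> nat" where
  "quartic_root n = nat \<lfloor>real n powr (1/4)\<rfloor>"

lemma quartic_root_bounds:
  "real (quartic_root n) \<le> real n powr (1/4)" "real n powr (1/4) - 1 < real (quartic_root n)"
  by (auto simp: quartic_root_def)

lemma quartic_root_power_le: "quartic_root n ^ 4 \<le> n"
proof (cases "n = 0")
  case False
  have "real (quartic_root n) ^ 4 \<le> (real n powr (1/4)) ^ 4"
    by (intro power_mono quartic_root_bounds) simp
  also have "\<dots> = real n" using False by (simp add: powr_power)
  finally show ?thesis by (simp flip: of_nat_power)
qed (simp add: quartic_root_def)

lemma quartic_root_power_ratio: "(\<lambda>n. real (quartic_root n ^ 4) / real n) \<longlonglongrightarrow> 1"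
proof (rule tendsto_sandwich[OF _ _ _ tendsto_const])
  show "\<forall>\<^sub>F n in sequentially. (real n powr (1/4) - 1) ^ 4 / real n \<le> real (quartic_root n ^ 4) / real n"
    using eventually_ge_at_top[of 1]
  proof eventually_elim
    case (elim n)
    then have "(real n powr (1/4) - 1) ^ 4 \<le> real (quartic_root n) ^ 4"
      using quartic_root_bounds(2)[of n] by (intro power_mono) (auto intro: ge_one_powr_ge_zero)
    then show ?case by (intro divide_right_mono) auto
  qed
  show "(\<lambda>n. (real n powr (1/4) - 1) ^ 4 / real n) \<longlonglongrightarrow> 1" by real_asymp
  show "\<forall>\<^sub>F n in sequentially. real (quartic_root n ^ 4) / real n \<le> 1"
    using eventually_gt_at_top[of 0]
    by eventually_elim (use quartic_root_power_le in \<open>simp add: divide_le_eq del: of_nat_power\<close>)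
qed

lemma filterlim_quartic_root: "filterlim quartic_root at_top sequentially"
proof -
  have "filterlim (\<lambda>n. real (quartic_root n)) at_top sequentially"
    by (rule filterlim_at_top_mono[of "\<lambda>n. real n powr (1/4) - 1"])
      (real_asymp, use quartic_root_bounds(2) in \<open>auto intro!: always_eventually less_imp_le\<close>)
  then show ?thesis by (simp add: filterlim_sequentially_iff_filterlim_real)
qed

context
  fixes a b s2 :: real and j :: "nat \<Rightarrow> nat"
  assumes a: "0 < a" and s2: "0 < s2"
    and j_lim: "(\<lambda>n. (ln (real n) - a * real (j n)) / sqrt (ln (real n))) \<longlonglongrightarrow> b"
begin

lemma level_ratio: "(\<lambda>n. real (j n) / ln (real n)) \<longlonglongrightarrow> 1 / a"
proof -
  have inv: "(\<lambda>n. 1 / sqrt (ln (real n))) \<longlonglongrightarrow> 0" by real_asymp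
  have lim: "(\<lambda>n. (1 - (ln (real n) - a * real (j n)) / sqrt (ln (real n)) * (1 / sqrt (ln (real n)))) / a) \<longlonglongrightarrow> (1 - b * 0) / a"
    using a by (intro tendsto_intros j_lim inv) auto
  have "\<forall>\<^sub>F n in sequentially.
    (1 - (ln (real n) - a * real (j n)) / sqrt (ln (real n)) * (1 / sqrt (ln (real n)))) / a = real (j n) / ln (real n)"
    using eventually_gt_at_top[of 1]
  proof eventually_elim
    case (elim n)
    then have l: "0 < ln (real n)" by simp
    then have "(ln (real n) - a * real (j n)) / sqrt (ln (real n)) * (1 / sqrt (ln (real n))) = (ln (real n) - a * real (j n)) / ln (real n)"
      by simp
    then show ?case using l a by (simp add: field_simps)
  qed
  from Lim_transform_eventually[OF lim this] show ?thesis by simp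
qed

lemma filterlim_level: "filterlim j at_top sequentially"
proof -
  have "filterlim (\<lambda>n. real (j n) / ln (real n) * ln (real n)) at_top sequentially"
    by (rule filterlim_tendsto_pos_mult_at_top[OF level_ratio]) (use a in simp, real_asymp)
  moreover have "\<forall>\<^sub>F n in sequentially. real (j n) / ln (real n) * ln (real n) = real (j n)"
    using eventually_gt_at_top[of 1] by eventually_elim simp
  ultimately have "filterlim (\<lambda>n. real (j n)) at_top sequentially"
    by (subst (asm) filterlim_cong[OF refl refl]) 
  then show ?thesis by (simp add: filterlim_sequentially_iff_filterlim_real)
qed

lemma level_less_quartic_root: "\<forall>\<^sub>F n in sequentially. j n < quartic_root n"
proof -
  have "\<forall>\<^sub>F n in sequentially. real (j n) / ln (real n) < 1 / a + 1"
    using order_tendstoD(2)[OF level_ratio, of "1 / a + 1"] by simp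
  moreover have "\<forall>\<^sub>F n in sequentially. (1 / a + 1) * ln (real n) \<le> real n powr (1/4) - 1"
    using a by real_asymp
  ultimately show ?thesis
    using eventually_gt_at_top[of 1]
  proof eventually_elim
    case (elim n)
    then have "real (j n) < (1 / a + 1) * ln (real n)" by (simp add: divide_less_eq)
    then have "real (j n) < real (quartic_root n)" using elim quartic_root_bounds(2)[of n] by linarith
    then show ?case by simp
  qed
qed

lemma threshold_centering:
  assumes c: "0 < c"
  shows "(\<lambda>n. (ln (real (quartic_root n ^ 4)) - ln c - a * real (j n)) / sqrt (s2 * real (j n))) \<longlonglongrightarrow> b * sqrt (a / s2)"
proof -
  let ?N = "\<lambda>n. real (quartic_root n ^ 4)"
  have lnN: "(\<lambda>n. ln (?N n / real n)) \<longlonglongrightarrow> ln 1"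
    by (intro tendsto_ln quartic_root_power_ratio) simp
  have inv: "(\<lambda>n. 1 / sqrt (ln (real n))) \<longlonglongrightarrow> 0" by real_asymp
  have lim: "(\<lambda>n. ((ln (real n) - a * real (j n)) / sqrt (ln (real n)) + (ln (?N n / real n) - ln c) * (1 / sqrt (ln (real n))))
      / sqrt (s2 * (real (j n) / ln (real n)))) \<longlonglongrightarrow> (b + (ln 1 - ln c) * 0) / sqrt (s2 * (1 / a))"
    using a s2 by (intro tendsto_intros j_lim lnN inv level_ratio) auto
  have pos: "0 < quartic_root n" if "1 < n" for n
    using quartic_root_bounds(2)[of n] ge_one_powr_ge_zero[of "real n" "1/4"] that by (cases "quartic_root n") auto
  have "\<forall>\<^sub>F n in sequentially.
    ((ln (real n) - a * real (j n)) / sqrt (ln (real n)) + (ln (?N n / real n) - ln c) * (1 / sqrt (ln (real n))))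
      / sqrt (s2 * (real (j n) / ln (real n))) =
    (ln (?N n) - ln c - a * real (j n)) / sqrt (s2 * real (j n))"
    using eventually_gt_at_top[of 1]
  proof eventually_elim
    fix n :: nat
    assume n: "1 < n"
    define q where "q = sqrt (ln (real n))"
    have q: "0 < q" using n by (simp add: q_def)
    have "ln (?N n / real n) = ln (?N n) - ln (real n)"
      using n pos[OF n] by (subst ln_divide_pos) auto
    moreover have "sqrt (s2 * (real (j n) / ln (real n))) = sqrt (s2 * real (j n)) / q"
      by (simp add: q_def real_sqrt_divide[symmetric])
    ultimately show "((ln (real n) - a * real (j n)) / sqrt (ln (real n)) + (ln (?N n / real n) - ln c) * (1 / sqrt (ln (real n))))
      / sqrt (s2 * (real (j n) / ln (real n))) = (ln (?N n) - ln c - a * real (j n)) / sqrt (s2 * real (j n))"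
      using q unfolding q_def[symmetric] by (simp add: add_divide_distrib[symmetric])
  qed
  from Lim_transform_eventually[OF lim this] show ?thesis
    using a s2 by (simp add: real_sqrt_divide)
qed

end

context balls_in_tree
begin

theorem occupancy_limit:
  "AE \<omega> in M. \<forall>j b. (\<lambda>n. (ln (real n) - a * real (j n)) / sqrt (ln (real n))) \<longlonglongrightarrow> b \<longrightarrow>
    (\<lambda>n. count (j n) n \<omega> / real n) \<longlonglongrightarrow> Phi (- b * sqrt (a / s2))"
  using quenched_CLT concentration
proof (eventually_elim, intro allI impI)
  fix \<omega> and j :: "nat \<Rightarrow> nat" and b :: real
  assume CLT: "\<forall>j y x. filterlim j at_top sequentially \<longrightarrow>
      (\<lambda>n. (y n - a * real (j n)) / sqrt (s2 * real (j n))) \<longlonglongrightarrow> x \<longrightarrow>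
      (\<lambda>n. level_cdf \<omega> (j n) (y n)) \<longlonglongrightarrow> Phi x"
    and conc: "(\<lambda>k. \<Sum>i\<le>k. ((count i (Suc k ^ 4) \<omega> - mean_count i (Suc k ^ 4) \<omega>) / real (Suc k ^ 4))\<^sup>2) \<longlonglongrightarrow> 0"
    and j_lim: "(\<lambda>n. (ln (real n) - a * real (j n)) / sqrt (ln (real n))) \<longlonglongrightarrow> b"
  define \<beta> where "\<beta> = b * sqrt (a / s2)"
  define N where "N n = quartic_root n ^ 4" for n
  note lim = a_pos s2_pos j_lim
  have root_pos: "\<forall>\<^sub>F n in sequentially. 0 < quartic_root n"
    using filterlim_at_top[THEN iffD1, OF filterlim_quartic_root, rule_format, of 1] by eventually_elim simp
  have mean: "(\<lambda>n. mean_count (j n) (N n) \<omega> / real (N n)) \<longlonglongrightarrow> 1 - Phi \<beta>"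
  proof -
    have cdf: "(\<lambda>n. level_cdf \<omega> (j n) (ln (real (N n)) - ln c)) \<longlonglongrightarrow> Phi \<beta>" if "0 < c" for c
      unfolding \<beta>_def N_def
      by (rule CLT[rule_format, OF filterlim_level[OF lim] threshold_centering[OF lim that]])
    have R: "\<forall>\<^sub>F n in sequentially. 0 < N n \<and>
        enn2real (level_mean (j n) (W \<omega>) (indicator {c / real (N n)..})) = level_cdf \<omega> (j n) (ln (real (N n)) - ln c)"
      if "0 < c" for c
      using root_pos
    proof eventually_elim
      case (elim n)
      then have "0 < N n" by (simp add: N_def)
      moreover from this have "exp (- (ln (real (N n)) - ln c)) = c / real (N n)"
        using that by (simp add: exp_diff exp_minus field_simps)
      ultimately show ?case by (simp add: level_cdf_def)
    qed
    have up: "\<forall>\<^sub>F n in sequentially. mean_count (j n) (N n) \<omega> / real (N n) \<le>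
        1 / c + (1 - level_cdf \<omega> (j n) (ln (real (N n)) - ln c))" if "0 < c" for c
      using R[OF that] by eventually_elim (use occupied_mean_bounds(1)[OF W_good _ that] in metis)
    have low: "\<forall>\<^sub>F n in sequentially. (1 - level_cdf \<omega> (j n) (ln (real (N n)) - ln c)) / (1 + c) \<le>
        mean_count (j n) (N n) \<omega> / real (N n)" if "0 < c" for c
      using R[OF that] by eventually_elim (use occupied_mean_bounds(2)[OF W_good _ that] in metis)
    show ?thesis
    proof (rule order_tendstoI)
      fix y assume "y < 1 - Phi \<beta>"
      moreover have "(\<lambda>m. (1 - Phi \<beta>) / (1 + 1 / real (Suc m))) \<longlonglongrightarrow> (1 - Phi \<beta>) / (1 + 0)"
        by (intro tendsto_intros LIMSEQ_Suc[OF lim_1_over_n]) auto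
      ultimately have "\<forall>\<^sub>F m in sequentially. y < (1 - Phi \<beta>) / (1 + 1 / real (Suc m))"
        by (intro order_tendstoD(1)) auto
      then obtain m where m: "y < (1 - Phi \<beta>) / (1 + 1 / real (Suc m))"
        using eventually_happens'[OF sequentially_bot] by blast
      let ?c = "1 / real (Suc m)"
      have c: "0 < ?c" by simp
      then have ne: "1 + ?c \<noteq> 0" by linarith
      have "(\<lambda>n. (1 - level_cdf \<omega> (j n) (ln (real (N n)) - ln ?c)) / (1 + ?c)) \<longlonglongrightarrow> (1 - Phi \<beta>) / (1 + ?c)"
        by (intro tendsto_intros cdf c ne)
      from order_tendstoD(1)[OF this m] low[OF c]
      show "\<forall>\<^sub>F n in sequentially. y < mean_count (j n) (N n) \<omega> / real (N n)"
        by eventually_elim (rule less_le_trans)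
    next
      fix y assume "1 - Phi \<beta> < y"
      moreover have "(\<lambda>m. 1 / real (Suc m) + (1 - Phi \<beta>)) \<longlonglongrightarrow> 0 + (1 - Phi \<beta>)"
        by (intro tendsto_intros LIMSEQ_Suc[OF lim_1_over_n])
      ultimately have "\<forall>\<^sub>F m in sequentially. 1 / real (Suc m) + (1 - Phi \<beta>) < y"
        by (intro order_tendstoD(2)) auto
      then obtain m where m: "1 / real (Suc m) + (1 - Phi \<beta>) < y"
        using eventually_happens'[OF sequentially_bot] by blast
      let ?c = "real (Suc m)"
      have c: "0 < ?c" by simp
      have "(\<lambda>n. 1 / ?c + (1 - level_cdf \<omega> (j n) (ln (real (N n)) - ln ?c))) \<longlonglongrightarrow> 1 / ?c + (1 - Phi \<beta>)"
        using c by (intro tendsto_intros cdf) auto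
      from order_tendstoD(2)[OF this m] up[OF c]
      show "\<forall>\<^sub>F n in sequentially. mean_count (j n) (N n) \<omega> / real (N n) < y"
        by eventually_elim (rule le_less_trans)
    qed
  qed
  have diff: "(\<lambda>n. (count (j n) (N n) \<omega> - mean_count (j n) (N n) \<omega>) / real (N n)) \<longlonglongrightarrow> 0"
  proof -
    let ?X = "\<lambda>k. \<Sum>i\<le>k. ((count i (Suc k ^ 4) \<omega> - mean_count i (Suc k ^ 4) \<omega>) / real (Suc k ^ 4))\<^sup>2"
    let ?d = "\<lambda>n. (count (j n) (N n) \<omega> - mean_count (j n) (N n) \<omega>) / real (N n)"
    have "filterlim (\<lambda>n. quartic_root n - 1) at_top sequentially"
      by (rule filterlim_compose[OF filterlim_minus_const_nat_at_top filterlim_quartic_root])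
    then have X: "(\<lambda>n. ?X (quartic_root n - 1)) \<longlonglongrightarrow> 0"
      by (rule filterlim_compose[OF conc])
    have "(\<lambda>n. (?d n)\<^sup>2) \<longlonglongrightarrow> 0"
    proof (rule tendsto_sandwich[OF _ _ tendsto_const X])
      show "\<forall>\<^sub>F n in sequentially. (?d n)\<^sup>2 \<le> ?X (quartic_root n - 1)"
        using level_less_quartic_root[OF lim]
      proof eventually_elim
        case (elim n)
        then have "Suc (quartic_root n - 1) ^ 4 = N n" by (simp add: N_def)
        moreover have "j n \<in> {..quartic_root n - 1}" using elim by simp
        ultimately show ?case
          using member_le_sum[of "j n" "{..quartic_root n - 1}"
              "\<lambda>i. ((count i (N n) \<omega> - mean_count i (N n) \<omega>) / real (N n))\<^sup>2"]
          by (simp del: One_nat_def)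
      qed
    qed simp
    from tendsto_real_sqrt[OF this] have "(\<lambda>n. \<bar>?d n\<bar>) \<longlonglongrightarrow> 0"
      by (simp only: real_sqrt_abs real_sqrt_zero)
    then show ?thesis by (simp only: tendsto_rabs_zero_iff)
  qed
  have sub: "(\<lambda>n. count (j n) (N n) \<omega> / real (N n)) \<longlonglongrightarrow> 1 - Phi \<beta>"
    using tendsto_add[OF diff mean] by (simp add: diff_divide_distrib del: One_nat_def)
  have ratio: "(\<lambda>n. real (N n) / real n) \<longlonglongrightarrow> 1"
    unfolding N_def by (rule quartic_root_power_ratio)
  have low: "(\<lambda>n. count (j n) (N n) \<omega> / real (N n) * (real (N n) / real n)) \<longlonglongrightarrow> 1 - Phi \<beta>"
    using tendsto_mult[OF sub ratio] by simp
  have up: "(\<lambda>n. count (j n) (N n) \<omega> / real (N n) * (real (N n) / real n) + (1 - real (N n) / real n)) \<longlonglongrightarrow> 1 - Phi \<beta>"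
    using tendsto_add[OF low tendsto_diff[OF tendsto_const[of 1] ratio]] by simp
  have "(\<lambda>n. count (j n) n \<omega> / real n) \<longlonglongrightarrow> 1 - Phi \<beta>"
  proof (rule tendsto_sandwich[OF _ _ low up])
    show "\<forall>\<^sub>F n in sequentially. count (j n) (N n) \<omega> / real (N n) * (real (N n) / real n) \<le> count (j n) n \<omega> / real n"
      using root_pos
    proof eventually_elim
      case (elim n)
      have "count (j n) (N n) \<omega> \<le> count (j n) n \<omega>"
        using K_add(1)[OF W_good, of \<omega> "U \<omega>" "j n" "N n" "n - N n"] quartic_root_power_le[of n] by (simp add: N_def)
      then show ?case using elim by (simp add: N_def divide_right_mono del: One_nat_def)
    qed
    show "\<forall>\<^sub>F n in sequentially. count (j n) n \<omega> / real n \<le>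
        count (j n) (N n) \<omega> / real (N n) * (real (N n) / real n) + (1 - real (N n) / real n)"
      using root_pos eventually_gt_at_top[of 0]
    proof eventually_elim
      case (elim n)
      have le: "N n \<le> n" using quartic_root_power_le[of n] by (simp add: N_def)
      have "K (W \<omega>) (U \<omega>) (j n) n \<le> K (W \<omega>) (U \<omega>) (j n) (N n) + (n - N n)"
        using K_add(2)[OF W_good, of \<omega> "U \<omega>" "j n" "N n" "n - N n"] le by simp
      then have "count (j n) n \<omega> \<le> count (j n) (N n) \<omega> + (real n - real (N n))"
        using le by linarith
      then have "count (j n) n \<omega> / real n \<le> (count (j n) (N n) \<omega> + (real n - real (N n))) / real n"
        by (rule divide_right_mono) simp
      also have "\<dots> = count (j n) (N n) \<omega> / real (N n) * (real (N n) / real n) + (1 - real (N n) / real n)"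
        using elim by (simp add: N_def add_divide_distrib diff_divide_distrib del: One_nat_def)
      finally show ?case .
    qed
  qed
  then show "(\<lambda>n. count (j n) n \<omega> / real n) \<longlonglongrightarrow> Phi (- b * sqrt (a / s2))"
    using Phi_minus[of \<beta>] by (simp add: \<beta>_def)
qed

end

definition normalize_offspring :: "(nat \<Rightarrow> real) \<Rightarrow> nat \<Rightarrow> real" where
  "normalize_offspring p = (if (\<forall>k. 0 \<le> p k) \<and> (\<Sum>k. ennreal (p k)) = 1 then p else (\<lambda>k. if k = 0 then 1 else 0))"

lemma measurable_normalize_offspring [measurable]: "normalize_offspring \<in> measurable sequence_borel sequence_borel"
proof -
  have [measurable]: "(\<lambda>p. p k) \<in> borel_measurable sequence_borel" for k
    by (rule measurable_component_singleton) simp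
  have "(\<lambda>p. \<lambda>k\<in>UNIV. normalize_offspring p k) \<in> measurable sequence_borel sequence_borel"
  proof (rule measurable_restrict)
    fix k :: nat
    have "(\<lambda>p. normalize_offspring p k) =
      (\<lambda>p. if (\<forall>k. 0 \<le> p k) \<and> (\<Sum>k. ennreal (p k)) = 1 then p k else if k = 0 then 1 else 0)"
      by (auto simp: normalize_offspring_def)
    then show "(\<lambda>p. normalize_offspring p k) \<in> borel_measurable sequence_borel" by simp
  qed
  then show ?thesis by (simp add: restrict_UNIV)
qed

lemma good_normalize: "good (\<lambda>u. normalize_offspring (w u))"
proof -
  have "(\<forall>k. 0 \<le> normalize_offspring p k) \<and> normalize_offspring p sums 1" for p
  proof (cases "(\<forall>k. 0 \<le> p k) \<and> (\<Sum>k. ennreal (p k)) = 1")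
    case True
    then have sum: "summable p" by (intro summable_suminf_not_top) auto
    then have "ennreal (suminf p) = ennreal 1"
      using True suminf_ennreal2[of p] by simp
    then have "suminf p = 1"
      using sum True by (subst (asm) ennreal_inj) (auto intro: suminf_nonneg)
    then show ?thesis using True sum by (auto simp: normalize_offspring_def sums_iff)
  next
    case False
    then show ?thesis
      using sums_single[of 0 "\<lambda>_. 1::real"] by (auto simp: normalize_offspring_def)
  qed
  then show ?thesis by (simp add: good_def)
qed

lemma normalize_offspring_eq: "(\<forall>k. 0 \<le> p k) \<Longrightarrow> p sums 1 \<Longrightarrow> normalize_offspring p = p"
proof -
  assume "\<forall>k. 0 \<le> p k" "p sums 1"
  moreover from this have "(\<Sum>k. ennreal (p k)) = ennreal 1"
    by (intro suminf_ennreal_eq) auto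
  ultimately show ?thesis by (simp add: normalize_offspring_def)
qed

theorem theorem1:
  fixes M :: "'a measure"
    and Q :: "(nat \<Rightarrow> real) measure"
    and W :: "'a \<Rightarrow> weights"
    and U :: "'a \<Rightarrow> nat \<Rightarrow> real"
    and a b s2 :: real
    and j :: "nat \<Rightarrow> nat"
  assumes M: "prob_space M"
    and Q: "prob_space Q"
    and Q_sum: "AE p in Q. (\<forall>k. 0 \<le> p k) \<and> p sums 1"
    and Q_npos: "(\<integral>\<^sup>+ p. npos p \<partial>Q) > 1"
    and W_law: "\<And>u. distr M (Pi\<^sub>M UNIV (\<lambda>_. borel)) (\<lambda>\<omega>. W \<omega> u) = Q"
    and W_indep: "prob_space.indep_vars M (\<lambda>_. Pi\<^sub>M UNIV (\<lambda>_. borel)) (\<lambda>u \<omega>. W \<omega> u) UNIV"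
    and U_law: "\<And>i. distr M lborel (\<lambda>\<omega>. U \<omega> i) = uniform_measure lborel {0..1}"
    and U_indep: "prob_space.indep_vars M (\<lambda>_. borel) (\<lambda>i \<omega>. U \<omega> i) UNIV"
    and WU_indep: "prob_space.indep_set M
        (sets (vimage_algebra (space M) (\<lambda>\<omega>. W \<omega>) (Pi\<^sub>M UNIV (\<lambda>_. Pi\<^sub>M UNIV (\<lambda>_. borel)))))
        (sets (vimage_algebra (space M) (\<lambda>\<omega>. U \<omega>) (Pi\<^sub>M UNIV (\<lambda>_. borel))))"
    and nonlattice: "\<And>c d. c > 0 \<Longrightarrow>
        measure Q {p. \<forall>k. p k > 0 \<longrightarrow> (\<exists>z::int. - ln (p k) = c * of_int z + d)} < 1"
    and theta_star: "\<exists>\<theta>s D. \<theta>s \<in> lam_dom Q \<and>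
        (lam Q has_real_derivative D) (at \<theta>s within lam_dom Q) \<and> \<theta>s * D - lam Q \<theta>s = 0"
    and lam_deriv: "\<exists>\<epsilon>>0. \<exists>d. (\<forall>\<theta>\<in>{1..1+\<epsilon>}. \<theta> \<in> lam_dom Q \<and>
          (lam Q has_real_derivative d \<theta>) (at \<theta> within {1..})) \<and>
        d 1 = - a \<and> (d has_real_derivative s2) (at 1 within {1..})"
    and j_pos: "\<And>n. j n \<ge> 1"
    and j_lim: "((\<lambda>n. (ln (real n) - a * real (j n)) / sqrt (ln (real n))) \<longlongrightarrow> b) sequentially"
  shows "AE \<omega> in M. ((\<lambda>n. real (K (W \<omega>) (U \<omega>) (j n) n) / real n)
           \<longlongrightarrow> Phi (- b * sqrt (a / s2))) sequentially"
proof -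
  interpret prob_space M by (rule M)
  interpret Q: prob_space Q by (rule Q)
  have W_meas [measurable]: "(\<lambda>\<omega>. W \<omega> u) \<in> measurable M sequence_borel" for u
    using W_indep by (simp add: indep_vars_def)
  have sets_Q: "sets Q = sets sequence_borel"
    by (subst W_law[of "[]", symmetric]) simp
  define W' where "W' \<omega> u = normalize_offspring (W \<omega> u)" for \<omega> u
  have Q_norm: "AE p in Q. normalize_offspring p = p"
    using Q_sum by eventually_elim (auto intro: normalize_offspring_eq)
  have "AE \<omega> in M. normalize_offspring (W \<omega> u) = W \<omega> u" for u
    by (rule AE_distrD[OF W_meas]) (use Q_norm in \<open>simp only: W_law\<close>)
  then have "AE \<omega> in M. \<forall>u. normalize_offspring (W \<omega> u) = W \<omega> u"
    by (subst AE_all_countable) simp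
  then have W'_eq: "AE \<omega> in M. W' \<omega> = W \<omega>"
    by eventually_elim (simp add: W'_def fun_eq_iff)
  interpret T: weight_tree M Q W'
  proof
    show "indep_vars (\<lambda>_. sequence_borel) (\<lambda>u \<omega>. W' \<omega> u) UNIV"
      unfolding W'_def by (rule indep_vars_compose2[OF W_indep]) simp
    show "good (W' \<omega>)" for \<omega>
      unfolding W'_def by (rule good_normalize)
    show "distr M sequence_borel (\<lambda>\<omega>. W' \<omega> u) = Q" for u
    proof -
      have "distr M sequence_borel (\<lambda>\<omega>. W' \<omega> u) = distr (distr M sequence_borel (\<lambda>\<omega>. W \<omega> u)) sequence_borel normalize_offspring"
        unfolding W'_def by (subst distr_distr) (auto simp: comp_def)
      also have "\<dots> = distr Q sequence_borel (\<lambda>p. p)"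
        unfolding W_law using Q_norm
        by (intro distr_cong_AE) (auto simp: measurable_cong_sets[OF sets_Q refl])
      also have "\<dots> = Q"
        using sets_Q by (intro distr_id2) simp
      finally show ?thesis .
    qed
  qed
  obtain \<epsilon> d where \<epsilon>: "0 < \<epsilon>"
    and d': "\<forall>\<theta>\<in>{1..1 + \<epsilon>}. \<theta> \<in> lam_dom Q \<and> (lam Q has_real_derivative d \<theta>) (at \<theta> within {1..})"
    and d1: "d 1 = - a" and s2: "(d has_real_derivative s2) (at 1 within {1..})"
    using lam_deriv by blast
  have d: "(lam Q has_real_derivative d \<theta>) (at \<theta> within {1..})" if "1 \<le> \<theta>" "\<theta> \<le> 1 + \<epsilon>" for \<theta>
    using d' that by auto
  have shift: "((\<lambda>t. f (1 + t)) has_real_derivative D) (at t within {0..})"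
    if "(f has_real_derivative D) (at (1 + t) within {1..})" for f :: "real \<Rightarrow> real" and D t
  proof -
    have "(+) 1 ` {0..} = {1::real..}"
      by (auto simp: image_iff intro: bexI[of _ "_ - 1"])
    then have "(f has_real_derivative D) (at (1 + t) within (+) 1 ` {0..})" using that by simp
    moreover have "((+) 1 has_real_derivative 1) (at t within {0..})"
      by (auto intro!: derivative_eq_intros)
    ultimately show ?thesis
      using DERIV_image_chain[of f D "(+) 1" t "{0..}" 1] by (simp add: comp_def)
  qed
  have Lapl_eq: "Lapl Q (1 + t) = (\<integral>\<^sup>+y. ennreal (y powr t) \<partial>spine Q)" if "0 \<le> t" for t
  proof -
    have "Lapl Q (1 + t) = (\<integral>\<^sup>+p. \<integral>\<^sup>+k. ennreal (p k) * ennreal (p k powr t) \<partial>count_space UNIV \<partial>Q)"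
      unfolding Lapl_def nn_integral_count_space_nat[symmetric]
    proof (intro nn_integral_cong_AE, use Q_sum in eventually_elim, intro nn_integral_cong)
      fix p :: "nat \<Rightarrow> real" and k :: nat
      assume "(\<forall>k. 0 \<le> p k) \<and> p sums 1"
      then have "0 \<le> p k" by simp
      then show "ennreal (if 0 < p k then p k powr (1 + t) else 0) = ennreal (p k) * ennreal (p k powr t)"
        by (cases "p k = 0") (auto simp: powr_add ennreal_mult)
    qed
    also have "\<dots> = (\<integral>\<^sup>+y. ennreal (y powr t) \<partial>spine Q)"
      by (rule nn_integral_spine[OF sets_Q, symmetric]) simp
    finally show ?thesis .
  qed
  have 1: "lam Q (1 + t) = ln (enn2real (\<integral>\<^sup>+y. ennreal (y powr t) \<partial>spine Q))" if "0 \<le> t" for t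
    using Lapl_eq[OF that] by (simp add: lam_def)
  have 2: "((\<lambda>t. lam Q (1 + t)) has_real_derivative d (1 + t)) (at t within {0..})" if "0 \<le> t" "t \<le> \<epsilon>" for t
    using that by (intro shift d) auto
  have 3: "((\<lambda>t. d (1 + t)) has_real_derivative s2) (at 0 within {0..})"
    using s2 by (intro shift) simp
  note moments = T.spine.moments_from_log_Laplace[OF T.AE_spine_range 1 \<epsilon> 2 _ 3, simplified, OF d1]
  have spine_1: "\<not> (AE y in spine Q. y = 1)"
    by (rule T.spine_not_AE_1[OF Q_sum Q_npos])
  interpret finite_variance_tree M Q W' a s2
  proof
    show int: "integrable (spine Q) (\<lambda>y. - ln y)" "(\<integral>y. - ln y \<partial>spine Q) = a"
      and sq: "integrable (spine Q) (\<lambda>y. (- ln y)\<^sup>2)" "(\<integral>y. (- ln y)\<^sup>2 \<partial>spine Q) = a\<^sup>2 + s2"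
      using moments by simp_all
    show "0 < a" by (rule T.spine_mean_pos[OF int spine_1])
    show "0 < s2" by (rule T.spine_variance_pos[OF int sq nonlattice])
    show "T.rho < 1" by (rule T.rho_less_1[OF spine_1])
  qed
  interpret balls_in_tree M Q W' a s2 U
  proof
    have W_tree: "W \<in> measurable M tree_space"
      by (rule measurable_PiM_single'[where f="\<lambda>u \<omega>. W \<omega> u"]) (auto simp: space_PiM)
    have U_meas: "(\<lambda>\<omega>. U \<omega> i) \<in> borel_measurable M" for i
      using U_indep by (simp add: indep_vars_def)
    have U_balls: "U \<in> measurable M sequence_borel"
      by (rule measurable_PiM_single'[where f="\<lambda>i \<omega>. U \<omega> i"]) (auto simp: space_PiM U_meas)
    have norm: "(\<lambda>w u. normalize_offspring (w u)) \<in> measurable tree_space tree_space"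
      by (rule measurable_PiM_single')
        (auto simp: space_PiM intro!: measurable_compose[OF measurable_tree_component measurable_normalize_offspring])
    show "distr M tree_space W' \<Otimes>\<^sub>M distr M sequence_borel U =
        distr M (tree_space \<Otimes>\<^sub>M sequence_borel) (\<lambda>\<omega>. (W' \<omega>, U \<omega>))"
      using product_law_from_indep_set[OF W_tree U_balls WU_indep norm] by (simp add: W'_def[abs_def])
  qed (fact U_indep U_law)+
  from occupancy_limit W'_eq show ?thesis
    by eventually_elim (use j_lim in \<open>simp del: One_nat_def\<close>)
qed

end
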